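(* Let $d\ge 1$, let $\alpha\in(0,1)$, let $p>1$ be a real number, let $r:(0,\infty)\to\mathbb{R}$ be a bounded Borel function, and let $c>0$ be a constant. Then the function $$m(\xi)=c\,|\xi|^{\alpha}\int_0^\infty t\, r(t)\,e^{-2t|\xi|^{\alpha/2}}\,dt,\qquad \xi\in\mathbb{R}^d\setminus\{0\},$$ is an $L^p(\mathbb{R}^d)$-multiplier.
   Context: The Fourier transform is $\widehat f(\xi)=\int_{\mathbb{R}^d} f(x)\,e^{i\xi\cdot x}\,dx$. A bounded measurable function $m$ defined almost everywhere on $\mathbb{R}^d$ is called an $L^p(\mathbb{R}^d)$-multiplier if the operator $T_m$ given by $\widehat{T_mf}=m\,\widehat f$ for $f\in C_c^\infty(\mathbb{R}^d)$ satisfies $\|T_mf\|_p\le C\|f\|_p$ for some finite constant $C$ and all $f\in C_c^\infty(\mathbb{R}^d)$ (hence extends to a bounded operator on $L^p(\mathbb{R}^d)$). *)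

theory Defs
  imports "HOL-Analysis.Analysis"
begin

definition fourier_transform :: "('a::euclidean_space \<Rightarrow> complex) \<Rightarrow> 'a \<Rightarrow> complex" where
  "fourier_transform f \<xi> = (\<integral>x. f x * exp (\<i> * complex_of_real (\<xi> \<bullet> x)) \<partial>lebesgue)"

definition in_Lp :: "real \<Rightarrow> ('a::euclidean_space \<Rightarrow> complex) \<Rightarrow> bool" where
  "in_Lp p f \<longleftrightarrow> f \<in> borel_measurable lebesgue \<and> integrable lebesgue (\<lambda>x. norm (f x) powr p)"

definition Lp_norm :: "real \<Rightarrow> ('a::euclidean_space \<Rightarrow> complex) \<Rightarrow> real" where
  "Lp_norm p f = (\<integral>x. norm (f x) powr p \<partial>lebesgue) powr (1 / p)"

primrec times_differentiable :: "nat \<Rightarrow> ('a::real_normed_vector \<Rightarrow> 'b::real_normed_vector) \<Rightarrow> bool" where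
  "times_differentiable 0 f \<longleftrightarrow> continuous_on UNIV f"
| "times_differentiable (Suc k) f \<longleftrightarrow>
     (\<forall>x. f differentiable (at x)) \<and>
     (\<forall>v. times_differentiable k (\<lambda>x. frechet_derivative f (at x) v))"

definition Cc_infinity :: "('a::euclidean_space \<Rightarrow> complex) set" where
  "Cc_infinity = {f. (\<forall>k. times_differentiable k f) \<and> compact (closure {x. f x \<noteq> 0})}"

text \<open>
  A function in \<open>L\<^sup>2\<close> need not be integrable, so its Fourier transform is the Plancherel
  extension: the \<open>L\<^sup>2\<close> limit of the Fourier integrals of its truncations to balls. The distance
  is taken as a nonnegative integral, because a Bochner integral would be \<open>0\<close> if it diverged.
\<close>

definition has_L2_fourier_transform ::
  "('a::euclidean_space \<Rightarrow> complex) \<Rightarrow> ('a \<Rightarrow> complex) \<Rightarrow> bool" where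
  "has_L2_fourier_transform g h \<longleftrightarrow> in_Lp 2 g \<and> in_Lp 2 h \<and>
     ((\<lambda>R. \<integral>\<^sup>+\<xi>. ennreal ((norm (fourier_transform (\<lambda>x. indicator (ball 0 R) x *\<^sub>R g x) \<xi> - h \<xi>))\<^sup>2)
        \<partial>lebesgue) \<longlongrightarrow> 0) at_top"

text \<open>
  A function defined almost everywhere is modelled by a total function; each clause below is
  insensitive to its values on a null set. The function \<open>g\<close> plays the role of \<open>T\<^sub>m f\<close>: it is
  determined almost everywhere by its Fourier transform \<open>m \<cdot> fourier_transform f\<close>.
\<close>

definition Lp_multiplier :: "real \<Rightarrow> ('a::euclidean_space \<Rightarrow> complex) \<Rightarrow> bool" where
  "Lp_multiplier p m \<longleftrightarrow>
     m \<in> borel_measurable lebesgue \<and>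
     (\<exists>B. AE \<xi> in lebesgue. norm (m \<xi>) \<le> B) \<and>
     (\<exists>C. \<forall>f\<in>Cc_infinity. \<exists>g.
        has_L2_fourier_transform g (\<lambda>\<xi>. m \<xi> * fourier_transform f \<xi>) \<and>
        in_Lp p g \<and> Lp_norm p g \<le> C * Lp_norm p f)"

end

theory Submission
  imports Defs "HOL-Probability.Probability" "HOL-Real_Asymp.Real_Asymp"
begin

text \<open>
  The operator is approximated by finite sums of differences of powers of a Markov operator \<open>S\<close> on
  a lattice. Let \<open>K\<close> be a lazy nearest-neighbour average with mesh tending to \<open>0\<close>, and put
  \<open>S = 1 - (1 - K)^d\<close> and \<open>K' = 1 - (1 - K)^(2 d)\<close> with \<open>d = \<alpha> / 4\<close>. Since \<open>2 d \<le> 1\<close>, both are power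
  series in \<open>K\<close> with nonnegative coefficients of sum at most \<open>1\<close>, and \<open>S^2 + K' = 2 S\<close>. Thus
  \<open>u\<^sub>n = S^n f\<close> has the mean value property \<open>u\<^sub>n = (u\<^bsub>n+1\<^esub> + K' u\<^bsub>n-1\<^esub>) / 2\<close>, a discrete version of
  harmonic extension to the half space.

  For a Bellman function \<open>B(u, v)\<close> of size \<open>\<bar>u\<bar>^p + \<bar>v\<bar>^q\<close> such that \<open>B(u, v) \<plusminus> u v\<close> are convex, the mean
  value property bounds the sum of \<open>n \<integral> \<bar>u\<^bsub>n+1\<^esub> - u\<^sub>n\<bar> \<bar>v\<^bsub>n+1\<^esub> - v\<^sub>n\<bar>\<close> by \<open>\<integral> B(f, h)\<close>, uniformly in the
  mesh. Duality turns this into \<open>L\<^sup>p\<close> bounds for the approximants; their symbols are Riemann sums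
  converging to \<open>m\<close>, and Plancherel and Fatou yield the limit operator.
\<close>

text \<open>The exponent \<open>\<alpha> / 4\<close> is chosen because \<open>1 - K\<close> is of
  the order of the Laplacian: its \<open>d\<close>-th power has symbol of order
  \<open>|xi|^(\<alpha> / 2)\<close>, so \<open>S^n\<close> stands for the semigroup with symbol
  \<open>exp (- t |xi|^(\<alpha> / 2))\<close>. The kernel
  \<open>|xi|^\<alpha> exp (-2 t |xi|^(\<alpha> / 2))\<close> is the square of the time derivative
  of this symbol. As \<open>S\<close> is self-adjoint, \<open>(1 - S)^2 S^(2 n)\<close> splits
  evenly between \<open>f\<close> and \<open>h\<close>, and a weight in the multiplier becomes a
  weight on products of increments. The factor \<open>n\<close>, the \<open>t\<close> of the
  integral, is what summation by parts of a second difference produces. In continuous time such an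
  estimate would call for Ito's formula or a differential equation and a smooth Bellman function;
  here two-point convexity, Jensen's inequality and finite sums suffice, at the price of a passage
  to the limit. The walk is lazy so that the symbols of \<open>K\<close> and \<open>S\<close> lie in
  [0, 1], and \<open>r\<close>, being merely Borel, enters through averages over time cells rather
  than through sample values.\<close>

section \<open>The Bellman function\<close>

lemma powr_shift: "x powr (r - 1) * x = x powr r" if "0 < x" for x r :: real
  using that powr_add[of x "r-1" 1] by simp

text \<open>Two derivatives of \<open>K * \<rho> powr (q/2) + \<mu> * \<sigma> powr th\<close> along
  a line with direction \<open>(x, y)\<close> give the right-hand side; the suffixes 1 and 2 mark
  these derivatives. Only the mixed term and the \<open>\<rho>1^2\<close> term of the second summand
  can be negative. They are absorbed by the \<open>x^2\<close> term of the second summand and by the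
  positive \<open>y^2\<close> term of the first, whose factor \<open>K\<close> is chosen large
  enough.\<close>

lemma hessian_bound:
  fixes a q th K \<mu> \<rho> u v x y :: real
  defines "m \<equiv> \<mu> powr a" and "\<sigma> \<equiv> \<rho> + \<mu> powr a"
  assumes q: "1 < q" "q \<le> 2" and a: "a = 1 / (q - 1)" and th: "th = 1 - q / 2"
    and K: "K * (q * (q - 1)) = 5 + 16 * (1 + a)\<^sup>2"
    and pos: "0 < \<mu>" "0 < \<rho>" and u: "u\<^sup>2 \<le> \<mu>" and v: "v\<^sup>2 \<le> \<rho>"
  defines "\<mu>1 \<equiv> 2 * u * x" and "\<mu>2 \<equiv> 2 * x\<^sup>2" and "\<rho>1 \<equiv> 2 * v * y" and "\<rho>2 \<equiv> 2 * y\<^sup>2"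
  defines "\<sigma>1 \<equiv> \<rho>1 + a * \<mu> powr (a - 1) * \<mu>1"
    and "\<sigma>2 \<equiv> \<rho>2 + a * ((a - 1) * \<mu> powr (a - 2) * \<mu>1\<^sup>2 + \<mu> powr (a - 1) * \<mu>2)"
  shows "2 * \<bar>x * y\<bar> \<le> K * (q / 2) * ((q / 2 - 1) * \<rho> powr (q / 2 - 2) * \<rho>1\<^sup>2 + \<rho> powr (q / 2 - 1) * \<rho>2)
    + (\<mu>2 * \<sigma> powr th + 2 * \<mu>1 * (th * \<sigma> powr (th - 1) * \<sigma>1)
       + \<mu> * (th * ((th - 1) * \<sigma> powr (th - 2) * \<sigma>1\<^sup>2 + \<sigma> powr (th - 1) * \<sigma>2)))"
proof -
  have a1: "1 \<le> a" using q unfolding a by (simp add: field_simps)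
  have th01: "0 \<le> th" "th < 1/2" using q unfolding th by auto
  define M1 M2 s0 s1 s2 R1 R2 where "M1 = \<mu> powr (a - 1)" and "M2 = \<mu> powr (a - 2)"
    and "s0 = \<sigma> powr th" and "s1 = \<sigma> powr (th - 1)" and "s2 = \<sigma> powr (th - 2)"
    and "R1 = \<rho> powr (q/2 - 1)" and "R2 = \<rho> powr (q/2 - 2)"
  note defs = M1_def M2_def s0_def s1_def s2_def R1_def R2_def
  have mpos: "0 < m" using pos by (simp add: m_def)
  have \<sigma>m: "\<sigma> = \<rho> + m" by (simp add: \<sigma>_def m_def)
  have \<sigma>pos: "0 < \<sigma>" using pos mpos \<sigma>m by simp
  have E: "M1 * \<mu> = m" "M2 * \<mu> = M1" "s1 * \<sigma> = s0" "s2 * \<sigma> = s1" "R2 * \<rho> = R1"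
    using powr_shift[OF pos(1), of a] powr_shift[OF pos(1), of "a-1"]
      powr_shift[OF \<sigma>pos, of th] powr_shift[OF \<sigma>pos, of "th-1"] powr_shift[OF pos(2), of "q/2-1"]
    by (simp_all add: defs m_def diff_diff_eq)
  have P: "0 < M1" "0 < M2" "0 < s0" "0 < s1" "0 < s2" "0 < R1" "0 < R2"
    using pos \<sigma>pos by (simp_all add: defs)
  \<comment> \<open>As \<open>1/a = q - 1\<close>, \<open>\<mu>\<close> is at most
    \<open>\<sigma> powr (q - 1)\<close>. The exponents \<open>q - 1\<close> and
    \<open>th - 1 = - q/2\<close> add up to \<open>q/2 - 1 \<le> 0\<close>, so passing from
    \<open>\<sigma>\<close> to the smaller \<open>\<rho>\<close> increases the power.\<close>
  have F1: "\<mu> * s1 \<le> R1"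
  proof -
    have "\<mu> = (\<mu> powr a) powr (1/a)" using pos a1 by (simp add: powr_powr)
    also have "\<dots> \<le> \<sigma> powr (1/a)" using pos a1 by (intro powr_mono2) (auto simp: \<sigma>_def)
    also have "1/a = q - 1" using a q by simp
    finally have "\<mu> * s1 \<le> \<sigma> powr (q - 1) * s1" using P by (intro mult_right_mono) auto
    also have "\<dots> = \<sigma> powr (q/2 - 1)" unfolding s1_def powr_add[symmetric] th by (simp add: field_simps)
    also have "\<dots> \<le> R1" unfolding R1_def using q pos \<sigma>m mpos by (intro powr_mono2') auto
    finally show ?thesis .
  qed
  have F2: "1 \<le> s0 * R1"
  proof -
    have "1 = \<rho> powr th * R1" using pos unfolding R1_def th powr_add[symmetric] by simp
    also have "\<dots> \<le> s0 * R1" using P unfolding s0_def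
      by (intro mult_right_mono powr_mono2) (use pos th01 \<sigma>m mpos in auto)
    finally show ?thesis .
  qed
  let ?X = "x\<^sup>2" and ?Y = "y\<^sup>2"
  have T1: "q * (q - 1) * R1 * ?Y \<le> (q / 2) * ((q / 2 - 1) * R2 * \<rho>1\<^sup>2 + R1 * \<rho>2)"
  proof -
    have "(q / 2) * ((q / 2 - 1) * R2 * \<rho>1\<^sup>2 + R1 * \<rho>2) - q * (q - 1) * R1 * ?Y
      = q * (2 - q) * R2 * ?Y * (\<rho> - v\<^sup>2)"
      unfolding E(5)[symmetric] \<rho>1_def \<rho>2_def by (simp add: field_simps power2_eq_square)
    also have "\<dots> \<ge> 0" using q P v by (intro mult_nonneg_nonneg) auto
    finally show ?thesis by simp
  qed
  \<comment> \<open>The \<open>\<mu>1^2\<close> part is nonnegative because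
    \<open>2 a + a (a - 1) = a^2 + a\<close> exceeds \<open>(1 - th) a^2\<close>; the mixed part and
    the \<open>\<rho>1^2\<close> part cause the two losses on the left.\<close>
  have T2: "- (8 * (1 + a) * s1 * \<bar>u * v * x * y\<bar>) - 4 * \<mu> * s1 * ?Y \<le>
     2 * \<mu>1 * (th * s1 * \<sigma>1) + \<mu> * (th * ((th - 1) * s2 * \<sigma>1\<^sup>2 + s1 * \<sigma>2))" (is "_ \<le> ?R")
  proof -
    have "?R = th * s2 * M1 * \<mu>1\<^sup>2 * (2*a*\<sigma> + a*(a-1)*\<sigma> - (1-th)*a\<^sup>2*m)
        + th * s2 * (\<mu>1 * \<rho>1) * (2 * \<sigma> - 2*(1-th)*a*m)
        - th * (1-th) * \<mu> * s2 * \<rho>1\<^sup>2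
        + th * s1 * \<mu> * \<rho>2 + th * s1 * a * m * \<mu>2"
      unfolding \<sigma>1_def \<sigma>2_def M1_def[symmetric] M2_def[symmetric] E(1)[symmetric] E(2)[symmetric] E(4)[symmetric]
      by (simp add: algebra_simps power2_eq_square)
    moreover have "0 \<le> th * s2 * M1 * \<mu>1\<^sup>2 * (2*a*\<sigma> + a*(a-1)*\<sigma> - (1-th)*a\<^sup>2*m)"
    proof (intro mult_nonneg_nonneg)
      have "(1-th)*a\<^sup>2*m \<le> 1 * a\<^sup>2 * \<sigma>" using th01 \<sigma>m pos mpos by (intro mult_mono) auto
      also have "\<dots> \<le> 2*a*\<sigma> + a*(a-1)*\<sigma>" using a1 \<sigma>pos by (simp add: algebra_simps power2_eq_square)
      finally show "0 \<le> 2*a*\<sigma> + a*(a-1)*\<sigma> - (1-th)*a\<^sup>2*m" by simp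
    qed (use P th01 in auto)
    moreover have "- (8 * (1 + a) * s1 * \<bar>u * v * x * y\<bar>) \<le> th * s2 * (\<mu>1 * \<rho>1) * (2 * \<sigma> - 2*(1-th)*a*m)"
    proof -
      have b: "(1-th)*a*m \<le> 1 * a*\<sigma>" using th01 \<sigma>m pos mpos a1 by (intro mult_mono) auto
      have b': "0 \<le> (1-th)*a*m" using th01 mpos a1 by (intro mult_nonneg_nonneg) auto
      have "0 \<le> a * \<sigma>" using a1 \<sigma>pos by simp
      moreover have "2*(1-th)*a*m = 2*((1-th)*a*m)" by simp
      ultimately have "\<bar>2 * \<sigma> - 2*(1-th)*a*m\<bar> \<le> 2 * \<sigma> + 2 * (a * \<sigma>)" using b b' \<sigma>pos by linarith
      then have b: "\<bar>2 * \<sigma> - 2*(1-th)*a*m\<bar> \<le> 2 * (1 + a) * \<sigma>" by (simp add: algebra_simps)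
      have "\<bar>th * s2 * (\<mu>1 * \<rho>1) * (2 * \<sigma> - 2*(1-th)*a*m)\<bar> = th * s2 * \<bar>\<mu>1 * \<rho>1\<bar> * \<bar>2 * \<sigma> - 2*(1-th)*a*m\<bar>"
        using th01 P by (simp add: abs_mult)
      also have "\<dots> \<le> 1 * s2 * \<bar>\<mu>1 * \<rho>1\<bar> * (2 * (1 + a) * \<sigma>)"
        using th01 P b by (intro mult_mono) auto
      also have "\<dots> = 8 * (1 + a) * s1 * \<bar>u * v * x * y\<bar>"
        unfolding E(4)[symmetric] \<mu>1_def \<rho>1_def by (simp add: abs_mult)
      finally show ?thesis by linarith
    qed
    moreover have "th * (1-th) * \<mu> * s2 * \<rho>1\<^sup>2 \<le> 4 * \<mu> * s1 * ?Y"
    proof -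
      have "th * (1-th) \<le> 1 * 1" using th01 by (intro mult_mono) auto
      moreover have "v\<^sup>2 \<le> \<sigma>" using v \<sigma>m mpos by simp
      ultimately have "(th * (1-th)) * (\<mu> * s2 * 4 * ?Y * v\<^sup>2) \<le> (1*1) * (\<mu> * s2 * 4 * ?Y * \<sigma>)"
        using pos P th01 by (intro mult_mono) auto
      then show ?thesis unfolding E(4)[symmetric] \<rho>1_def by (simp add: algebra_simps power2_eq_square)
    qed
    moreover have "0 \<le> th * s1 * \<mu> * \<rho>2" "0 \<le> th * s1 * a * m * \<mu>2"
      using th01 P pos mpos a1 by (auto simp: \<rho>2_def \<mu>2_def)
    ultimately show ?thesis by linarith
  qed
  \<comment> \<open>Completing a square with weight \<open>s2\<close>. The coefficient
    \<open>4 (1 + a)\<close> is half of the cross term, and its square is the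
    \<open>16 (1 + a)^2\<close> of the constant.\<close>
  have T3: "8 * (1 + a) * s1 * \<bar>u * v * x * y\<bar> \<le> ?X * s0 + 16 * (1+a)\<^sup>2 * R1 * ?Y"
  proof -
    have sq: "s2 * (\<sigma> * X - 4 * (1 + a) * U * Y)\<^sup>2 = X\<^sup>2 * (s2 * \<sigma> * \<sigma>)
        + 16 * (1 + a)\<^sup>2 * (s2 * U\<^sup>2) * Y\<^sup>2 - 8 * (1 + a) * (s2 * \<sigma>) * (U * X * Y)" for X U Y :: real
      by (simp add: algebra_simps power2_eq_square)
    have "0 \<le> s2 * (\<sigma> * abs x - 4 * (1 + a) * abs (u * v) * abs y)\<^sup>2" using P by simp
    then have "8 * (1 + a) * s1 * \<bar>u * v * x * y\<bar> \<le> ?X * s0 + 16 * (1 + a)\<^sup>2 * (s2 * (u * v)\<^sup>2) * ?Y"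
      unfolding sq E(3)[symmetric] E(4)[symmetric] by (simp add: abs_mult power_mult_distrib)
    moreover have "s2 * (u * v)\<^sup>2 \<le> R1"
    proof -
      have "v\<^sup>2 \<le> \<sigma>" using v \<sigma>m mpos by simp
      then have "s2 * (u\<^sup>2 * v\<^sup>2) \<le> s2 * (\<mu> * \<sigma>)" using P u pos by (intro mult_left_mono mult_mono) auto
      also have "\<dots> = \<mu> * s1" unfolding E(4)[symmetric] by simp
      finally show ?thesis using F1 by (simp add: power_mult_distrib)
    qed
    then have "16 * (1+a)\<^sup>2 * (s2 * (u * v)\<^sup>2) * ?Y \<le> 16 * (1+a)\<^sup>2 * R1 * ?Y"
      by (intro mult_right_mono mult_left_mono) auto
    ultimately show ?thesis by linarith
  qed
  have T4: "4 * \<mu> * s1 * ?Y \<le> 4 * R1 * ?Y" using F1 by (intro mult_right_mono) auto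
  have T5: "2 * \<bar>x * y\<bar> \<le> ?X * s0 + R1 * ?Y"
  proof -
    have "(\<bar>x\<bar> * \<bar>y\<bar>) * 1 \<le> (\<bar>x\<bar> * \<bar>y\<bar>) * sqrt (s0 * R1)"
      using F2 by (intro mult_left_mono) auto
    moreover have "0 \<le> (abs x * sqrt s0 - abs y * sqrt R1)\<^sup>2" by simp
    then have "2 * ((\<bar>x\<bar> * \<bar>y\<bar>) * sqrt (s0 * R1)) \<le> ?X * s0 + R1 * ?Y"
      using P by (simp add: power2_diff power_mult_distrib real_sqrt_mult algebra_simps)
    ultimately show ?thesis by (simp add: abs_mult)
  qed
  have Kp: "0 \<le> K"
  proof (rule ccontr)
    assume "\<not> 0 \<le> K"
    then have "K * (q * (q - 1)) \<le> 0" using q by (intro mult_nonpos_nonneg) auto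
    moreover have "0 \<le> 16 * (1 + a)\<^sup>2" by simp
    ultimately show False using K by linarith
  qed
  \<comment> \<open>The balance: the \<open>y^2\<close> term pays \<open>16 (1 + a)^2\<close> in
    \<open>T3\<close>, 4 in \<open>T4\<close> and 1 in \<open>T5\<close>, together
    \<open>K * (q * (q - 1))\<close>. The \<open>x^2\<close> term
    \<open>\<mu>2 * s0 = 2 x^2 s0\<close> pays once in \<open>T3\<close> and once in
    \<open>T5\<close>.\<close>
  have T6: "(5 + 16 * (1+a)\<^sup>2) * R1 * ?Y \<le> K * ((q / 2) * ((q / 2 - 1) * R2 * \<rho>1\<^sup>2 + R1 * \<rho>2))"
    using mult_left_mono[OF T1 Kp] unfolding K[symmetric] by (simp add: algebra_simps)
  have "\<mu>2 * s0 = 2 * (?X * s0)" by (simp add: \<mu>2_def)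
  moreover have "(5 + 16 * (1+a)\<^sup>2) * R1 * ?Y = 5 * R1 * ?Y + 16 * (1+a)\<^sup>2 * R1 * ?Y"
    by (simp add: algebra_simps)
  moreover have "5 * R1 * ?Y = 4 * R1 * ?Y + R1 * ?Y" by simp
  ultimately show ?thesis unfolding defs[symmetric]
    using T2 T3 T4 T5 T6 by (simp only: mult.assoc[of K])
qed

text \<open>
  The second summand is a smooth substitute for \<open>u\<^sup>2 \<bar>v\<bar>^(2-q)\<close> where \<open>\<bar>u\<bar>^p \<le> \<bar>v\<bar>^q\<close> and for \<open>\<bar>u\<bar>^p\<close>
  elsewhere (\<open>1 / (q - 1) = p - 1\<close>); the constant lets the Hessian of \<open>\<bar>v\<bar>^q\<close> absorb its negative part. The parameter \<open>\<kappa>\<close> removes the singularities at \<open>0\<close>.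
\<close>

definition bellman :: "real \<Rightarrow> real \<Rightarrow> real \<Rightarrow> real \<Rightarrow> real" where
  "bellman q \<kappa> u v =
     (5 + 16 * (1 + 1 / (q - 1))\<^sup>2) / (q * (q - 1)) * (v\<^sup>2 + \<kappa>) powr (q / 2)
     + (u\<^sup>2 + \<kappa>) * (v\<^sup>2 + \<kappa> + (u\<^sup>2 + \<kappa>) powr (1 / (q - 1))) powr (1 - q / 2)"

lemma DERIV_powr_const:
  assumes "(g has_real_derivative g') (at t)" "0 < g t"
  shows "((\<lambda>t. g t powr r) has_real_derivative r * g t powr (r - 1) * g') (at t)"
  using DERIV_chain2[OF has_real_derivative_powr[OF assms(2)] assms(1)] by simp

text \<open>Subtracting \<open>|x y| t^2\<close> on the segment lowers the second derivative by
  exactly \<open>2 |x y|\<close>, which \<open>hessian_bound\<close> affords. Convexity of the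
  difference between the end points 0 and 1 then leaves the gain
  \<open>(t - t^2) |x y|\<close>.\<close>

lemma bellman_line:
  assumes q: "1 < q" "q \<le> 2" and \<kappa>: "0 < \<kappa>" and t: "0 \<le> t" "t \<le> 1"
  shows "bellman q \<kappa> (u + t * x) (v + t * y) \<le>
    (1 - t) * bellman q \<kappa> u v + t * bellman q \<kappa> (u + x) (v + y) - t * (1 - t) * \<bar>x * y\<bar>"
proof -
  define a th K where "a = 1 / (q - 1)" and "th = 1 - q / 2"
    and "K = (5 + 16 * (1 + 1 / (q - 1))\<^sup>2) / (q * (q - 1))"
  have K: "K * (q * (q - 1)) = 5 + 16 * (1 + a)\<^sup>2" using q by (simp add: K_def a_def)
  define \<mu> \<rho> \<sigma> where "\<mu> t = (u + t * x)\<^sup>2 + \<kappa>" and "\<rho> t = (v + t * y)\<^sup>2 + \<kappa>"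
    and "\<sigma> t = \<rho> t + \<mu> t powr a" for t
  define \<mu>1 \<rho>1 \<sigma>1 \<sigma>2 where "\<mu>1 t = 2 * (u + t * x) * x" and "\<rho>1 t = 2 * (v + t * y) * y"
    and "\<sigma>1 t = \<rho>1 t + a * \<mu> t powr (a - 1) * \<mu>1 t"
    and "\<sigma>2 t = 2 * y\<^sup>2 + a * ((a - 1) * \<mu> t powr (a - 2) * (\<mu>1 t)\<^sup>2 + \<mu> t powr (a - 1) * (2 * x\<^sup>2))" for t
  have pos: "0 < \<mu> t" "0 < \<rho> t" "0 < \<sigma> t" for t
    unfolding \<sigma>_def \<mu>_def \<rho>_def using \<kappa> by (intro add_nonneg_pos add_pos_nonneg zero_le_power2 powr_ge_zero; assumption)+
  have D\<mu>: "(\<mu> has_real_derivative \<mu>1 t) (at t)" and D\<rho>: "(\<rho> has_real_derivative \<rho>1 t) (at t)" for t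
    unfolding \<mu>_def \<rho>_def \<mu>1_def \<rho>1_def by (auto intro!: derivative_eq_intros)
  have D\<mu>1: "(\<mu>1 has_real_derivative 2 * x\<^sup>2) (at t)" and D\<rho>1: "(\<rho>1 has_real_derivative 2 * y\<^sup>2) (at t)" for t
    unfolding \<mu>1_def \<rho>1_def by (auto intro!: derivative_eq_intros simp: power2_eq_square)
  note Dp = DERIV_powr_const[OF D\<mu> pos(1)] DERIV_powr_const[OF D\<rho> pos(2)]
  have D\<sigma>: "(\<sigma> has_real_derivative \<sigma>1 t) (at t)" for t
    unfolding \<sigma>_def \<sigma>1_def by (rule DERIV_add D\<rho> Dp)+
  have D\<sigma>1: "(\<sigma>1 has_real_derivative \<sigma>2 t) (at t)" for t
    unfolding \<sigma>1_def \<sigma>2_def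
    by (rule derivative_eq_intros D\<rho>1 D\<mu>1 Dp refl)+ (simp add: power2_eq_square algebra_simps)
  note Dp = Dp DERIV_powr_const[OF D\<sigma> pos(3)]
  define f f1 f2 where "f t = bellman q \<kappa> (u + t * x) (v + t * y) - \<bar>x * y\<bar> * t\<^sup>2"
    and "f1 t = K * ((q/2) * \<rho> t powr (q/2 - 1) * \<rho>1 t) +
      (\<mu>1 t * \<sigma> t powr th + \<mu> t * (th * \<sigma> t powr (th - 1) * \<sigma>1 t)) - \<bar>x * y\<bar> * (2 * t)"
    and "f2 t = K * (q / 2) * ((q / 2 - 1) * \<rho> t powr (q / 2 - 2) * (\<rho>1 t)\<^sup>2 + \<rho> t powr (q / 2 - 1) * (2 * y\<^sup>2))
    + (2 * x\<^sup>2 * \<sigma> t powr th + 2 * \<mu>1 t * (th * \<sigma> t powr (th - 1) * \<sigma>1 t)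
       + \<mu> t * (th * ((th - 1) * \<sigma> t powr (th - 2) * (\<sigma>1 t)\<^sup>2 + \<sigma> t powr (th - 1) * \<sigma>2 t))) - 2 * \<bar>x * y\<bar>" for t
  have f: "f = (\<lambda>t. K * \<rho> t powr (q / 2) + \<mu> t * \<sigma> t powr th - \<bar>x * y\<bar> * t\<^sup>2)"
    by (simp add: f_def bellman_def \<mu>_def \<rho>_def \<sigma>_def K_def th_def a_def fun_eq_iff)
  have "convex_on UNIV f"
  proof (rule f''_ge0_imp_convex[where f' = f1 and f'' = f2])
    show "DERIV f t :> f1 t" for t
      unfolding f f1_def
      by (rule DERIV_cong[OF DERIV_diff[OF DERIV_add[OF DERIV_cmult[OF Dp(2)] DERIV_mult'[OF D\<mu> Dp(3)]]
              DERIV_cmult[OF DERIV_power[OF DERIV_ident]]]]) simp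
    show "DERIV f1 t :> f2 t" for t
      unfolding f1_def f2_def 
      by (rule DERIV_cong[OF DERIV_diff[OF DERIV_add[OF
              DERIV_cmult[OF DERIV_mult'[OF DERIV_cmult[OF Dp(2)] D\<rho>1]]
              DERIV_add[OF DERIV_mult'[OF D\<mu>1 Dp(3)] DERIV_mult'[OF D\<mu> DERIV_mult'[OF DERIV_cmult[OF Dp(3)] D\<sigma>1]]]]
            DERIV_cmult[OF DERIV_cmult[OF DERIV_ident]]]])
        (simp add: power2_eq_square distrib_left distrib_right mult_ac)
    show "0 \<le> f2 t" for t
      using hessian_bound[OF q a_def th_def K pos(1) pos(2), where u = "u + t * x" and v = "v + t * y" and x = x and y = y] \<kappa>
      unfolding f2_def \<sigma>2_def \<sigma>1_def \<sigma>_def \<rho>1_def \<mu>1_def by (simp add: \<mu>_def \<rho>_def)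
  qed auto
  from convex_onD[OF this, of t 0 1] t have "f t \<le> (1 - t) * f 0 + t * f 1" by simp
  then show ?thesis unfolding f_def by (simp add: algebra_simps power2_eq_square)
qed

lemma bellman_tendsto:
  assumes q: "1 < q" "q \<le> 2"
  shows "((\<lambda>\<kappa>. bellman q \<kappa> u v) \<longlongrightarrow> bellman q 0 u v) (at_right 0)"
proof -
  have ev0: "\<forall>\<^sub>F \<kappa> in at_right 0. 0 \<le> w\<^sup>2 + \<kappa>" for w :: real
    by (rule eventually_mono[OF eventually_at_right_less]) simp
  have pw: "((\<lambda>\<kappa>. (w\<^sup>2 + \<kappa>) powr r) \<longlongrightarrow> (w\<^sup>2 + 0) powr r) (at_right 0)" if "0 < r" for w r :: real
    by (rule tendsto_powr2[OF _ tendsto_const ev0 that]) (intro tendsto_intros)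
  show ?thesis
\<comment> \<open>The origin is treated apart: for \<open>q = 2\<close> the exponent
  \<open>1 - q / 2\<close> is 0, and since \<open>0 powr 0 = 0\<close> the last factor jumps there;
  the vanishing factor \<open>u^2 + \<kappa>\<close> compensates. Elsewhere the base has a nonzero
  limit.\<close>
proof (cases "u = 0 \<and> v = 0")
  case True
  define K where "K = (5 + 16 * (1 + 1 / (q - 1))\<^sup>2) / (q * (q - 1))"
  have *: "((\<lambda>\<kappa>. K * \<kappa> powr (q/2) + \<kappa> * 2 powr (1 - q/2)) \<longlongrightarrow> K * 0 powr (q/2) + 0 * 2 powr (1 - q/2)) (at_right 0)"
    using pw[of "q/2" 0] q by (intro tendsto_add tendsto_mult tendsto_const tendsto_ident_at) simp
  have Kp: "0 \<le> K" using q by (simp add: K_def)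
  have z: "bellman q 0 u v = 0" using True by (simp add: bellman_def)
  show ?thesis unfolding z
  proof (rule tendsto_sandwich[OF _ _ tendsto_const])
    have ev: "eventually (\<lambda>\<kappa>::real. 0 < \<kappa> \<and> \<kappa> < 1) (at_right 0)"
      using eventually_at_right_real[of 0 "1::real"] by simp
    have "0 \<le> bellman q \<kappa> u v" if "0 < \<kappa>" for \<kappa>
      unfolding bellman_def K_def[symmetric] using Kp that by (intro add_nonneg_nonneg mult_nonneg_nonneg) simp_all
    then show "\<forall>\<^sub>F \<kappa> in at_right 0. 0 \<le> bellman q \<kappa> u v"
      by (intro eventually_mono[OF ev]) blast
    have "bellman q \<kappa> u v \<le> K * \<kappa> powr (q/2) + \<kappa> * 2 powr (1 - q/2)" if "0 < \<kappa>" "\<kappa> < 1" for \<kappa>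
    proof -
      have "\<kappa> powr (1 / (q - 1)) \<le> \<kappa> powr 0" using q that by (intro powr_mono') auto
      then have "(\<kappa> + \<kappa> powr (1 / (q - 1))) powr (1 - q/2) \<le> 2 powr (1 - q/2)"
        using q that by (intro powr_mono2) auto
      then show ?thesis using True that by (simp add: bellman_def K_def)
    qed
    then show "\<forall>\<^sub>F \<kappa> in at_right 0. bellman q \<kappa> u v \<le> K * \<kappa> powr (q/2) + \<kappa> * 2 powr (1 - q/2)"
      by (intro eventually_mono[OF ev]) auto
    show "((\<lambda>\<kappa>. K * \<kappa> powr (q/2) + \<kappa> * 2 powr (1 - q/2)) \<longlongrightarrow> 0) (at_right 0)"
      using * by simp
  qed
next
  case False
  have "v\<^sup>2 + 0 + (u\<^sup>2 + 0) powr (1 / (q - 1)) \<noteq> 0"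
  proof -
    have "0 \<le> (u\<^sup>2) powr (1 / (q - 1))" "v \<noteq> 0 \<Longrightarrow> 0 < v\<^sup>2" "u \<noteq> 0 \<Longrightarrow> 0 < (u\<^sup>2) powr (1 / (q - 1))"
      "0 \<le> v\<^sup>2" by auto
    with False show ?thesis by (cases "v = 0") (simp_all add: add_nonneg_eq_0_iff)
  qed
  then show ?thesis unfolding bellman_def using q
    by (intro tendsto_add tendsto_mult tendsto_powr pw tendsto_const tendsto_ident_at) auto
qed
qed

lemma bellman_convex:
  assumes q: "1 < q" "q \<le> 2" and t: "0 \<le> t" "t \<le> 1"
  shows "bellman q 0 ((1 - t) * u + t * u') ((1 - t) * v + t * v') \<le>
    (1 - t) * bellman q 0 u v + t * bellman q 0 u' v' - t * (1 - t) * (\<bar>u' - u\<bar> * \<bar>v' - v\<bar>)"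
proof (rule tendsto_le[OF _ _ bellman_tendsto[OF q]])
  show "((\<lambda>\<kappa>. (1 - t) * bellman q \<kappa> u v + t * bellman q \<kappa> u' v' - t * (1 - t) * (\<bar>u' - u\<bar> * \<bar>v' - v\<bar>)) \<longlongrightarrow>
      (1 - t) * bellman q 0 u v + t * bellman q 0 u' v' - t * (1 - t) * (\<bar>u' - u\<bar> * \<bar>v' - v\<bar>)) (at_right 0)"
    by (intro tendsto_intros bellman_tendsto q)
  show "\<forall>\<^sub>F \<kappa> in at_right 0. bellman q \<kappa> ((1 - t) * u + t * u') ((1 - t) * v + t * v')
        \<le> (1 - t) * bellman q \<kappa> u v + t * bellman q \<kappa> u' v' - t * (1 - t) * (\<bar>u' - u\<bar> * \<bar>v' - v\<bar>)"
    using eventually_at_right_less[of "0::real"]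
  proof eventually_elim
    case (elim \<kappa>)
    have e: "(1 - t) * w + t * w' = w + t * (w' - w)" for w w' :: real by (simp add: algebra_simps)
    show ?case using bellman_line[OF q elim t, of u "u' - u" v "v' - v"]
      by (simp add: e abs_mult)
  qed
qed auto

lemma bellman_nonneg: "1 < q \<Longrightarrow> 0 \<le> bellman q 0 u v"
  by (simp add: bellman_def)

lemma bellman_zero [simp]: "bellman q 0 0 0 = 0"
  by (simp add: bellman_def)

lemma bellman_growth:
  assumes q: "1 < q" "q \<le> 2" and p: "p = q / (q - 1)"
  shows "bellman q 0 u v \<le> ((5 + 16 * (1 + 1 / (q - 1))\<^sup>2) / (q * (q - 1)) + 2) * (\<bar>u\<bar> powr p + \<bar>v\<bar> powr q)"
proof -
  define a K where "a = 1 / (q - 1)" and "K = (5 + 16 * (1 + 1 / (q - 1))\<^sup>2) / (q * (q - 1))"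
  have a: "0 < a" "a * q = p" "1 / a = q - 1" using q by (auto simp: a_def p)
  have Kp: "0 \<le> K" using q by (simp add: K_def)
  \<comment> \<open>As \<open>a * q = p\<close>, \<open>X powr q\<close> is the larger of
    \<open>\<bar>u\<bar> powr p\<close> and \<open>\<bar>v\<bar> powr q\<close>. Bounding
    \<open>\<bar>u\<bar>\<close> by \<open>X powr (q - 1)\<close> and \<open>\<bar>v\<bar>\<close>
    by \<open>X\<close> gives the second summand the degree \<open>2 (q - 1) + (2 - q) = q\<close>
    in \<open>X\<close>.\<close>
  define X where "X = max (\<bar>u\<bar> powr a) \<bar>v\<bar>"
  have X0: "0 \<le> X" by (simp add: X_def)
  have sq: "(w\<^sup>2) powr r = \<bar>w\<bar> powr (2 * r)" for w r :: real
    by (simp add: powr_powr[symmetric])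
  have "v\<^sup>2 + (u\<^sup>2) powr a \<le> 2 * X\<^sup>2"
  proof -
    have "\<bar>v\<bar>\<^sup>2 \<le> X\<^sup>2" "(\<bar>u\<bar> powr a)\<^sup>2 \<le> X\<^sup>2" by (intro power_mono; simp add: X_def)+
    moreover have "(u\<^sup>2) powr a = (\<bar>u\<bar> powr a)\<^sup>2" 
      unfolding sq by (cases "u = 0") (auto simp: powr_powr mult.commute simp flip: powr_numeral)
    ultimately show ?thesis by simp
  qed
  then have "(v\<^sup>2 + (u\<^sup>2) powr a) powr (1 - q/2) \<le> (2 * X\<^sup>2) powr (1 - q/2)"
    using q by (intro powr_mono2) auto
  also have "\<dots> = 2 powr (1 - q/2) * X powr (2 - q)"
    using X0 unfolding powr_mult sq by (simp add: powr_mult sq right_diff_distrib)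
  also have "\<dots> \<le> 2 powr 1 * X powr (2 - q)" using q by (intro mult_right_mono powr_mono) auto
  finally have 1: "(v\<^sup>2 + (u\<^sup>2) powr a) powr (1 - q/2) \<le> 2 * X powr (2 - q)" by simp
  have 2: "u\<^sup>2 \<le> X powr (2 * (q - 1))"
  proof -
    have "a * (1/a) = 1" using a(1) by simp
    then have "\<bar>u\<bar> = (\<bar>u\<bar> powr a) powr (1/a)" by (simp only: powr_powr powr_one abs_ge_zero)
    also have "\<dots> \<le> X powr (1/a)"  using a(1) by (intro powr_mono2) (auto simp: X_def)
    finally have "\<bar>u\<bar>\<^sup>2 \<le> (X powr (q - 1))\<^sup>2" unfolding a by (intro power_mono) auto
    then show ?thesis by (cases "X = 0") (auto simp: powr_powr mult.commute X0 simp flip: powr_numeral)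
  qed
  have "u\<^sup>2 * (v\<^sup>2 + (u\<^sup>2) powr a) powr (1 - q/2) \<le> X powr (2 * (q - 1)) * (2 * X powr (2 - q))"
    by (intro mult_mono 1 2) auto
  also have "\<dots> = 2 * X powr q" by (simp add: powr_add[symmetric] field_simps)
  also have "X powr q \<le> \<bar>u\<bar> powr p + \<bar>v\<bar> powr q"
    unfolding X_def max_def using a by (auto simp: powr_powr)
  finally have 3: "u\<^sup>2 * (v\<^sup>2 + (u\<^sup>2) powr a) powr (1 - q/2) \<le> 2 * (\<bar>u\<bar> powr p + \<bar>v\<bar> powr q)" by simp
  have "bellman q 0 u v = K * \<bar>v\<bar> powr q + u\<^sup>2 * (v\<^sup>2 + (u\<^sup>2) powr a) powr (1 - q/2)"
    by (simp add: bellman_def K_def a_def sq)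
  also have "\<dots> \<le> K * (\<bar>u\<bar> powr p + \<bar>v\<bar> powr q) + 2 * (\<bar>u\<bar> powr p + \<bar>v\<bar> powr q)"
    by (intro add_mono 3 mult_left_mono) (auto simp: Kp)
  finally show ?thesis by (simp add: K_def algebra_simps)
qed

section \<open>Markov operators generated by a symmetric random walk\<close>

lemmas integrable_bound' = Bochner_Integration.integrable_bound

text \<open>A class stable under translations, products, powers with exponent at least 1 and all
  operators below. Boundedness makes products and powers integrable again; integrability permits the
  exchange of integrals with series.\<close>

definition tame :: "('a::euclidean_space \<Rightarrow> real) \<Rightarrow> bool" where
  "tame f \<longleftrightarrow> f \<in> borel_measurable borel \<and> integrable lborel f \<and> bounded (range f)"

lemma tameD [measurable_dest]: "tame f \<Longrightarrow> f \<in> borel_measurable borel"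
  by (simp add: tame_def)

lemma tame_integrable: "tame f \<Longrightarrow> integrable lborel f"
  by (simp add: tame_def)

lemma tame_bound:
  assumes "tame f" obtains M where "0 < M" "\<And>x. \<bar>f x\<bar> \<le> M"
  using assms unfolding tame_def bounded_pos by auto

lemma tameI:
  assumes "f \<in> borel_measurable borel" "integrable lborel f" "\<And>x. \<bar>f x\<bar> \<le> M"
  shows "tame f"
  using assms unfolding tame_def bounded_iff by auto

lemma tame_add: "tame f \<Longrightarrow> tame g \<Longrightarrow> tame (\<lambda>x. f x + g x)"
  unfolding tame_def by (auto intro: bounded_plus_comp)

lemma tame_diff: "tame f \<Longrightarrow> tame g \<Longrightarrow> tame (\<lambda>x. f x - g x)"
  unfolding tame_def by (auto intro: bounded_minus_comp)

lemma tame_cmult: "tame f \<Longrightarrow> tame (\<lambda>x. c * f x)"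
  unfolding tame_def using bounded_scaleR_comp[of f UNIV c] by auto

lemma tame_zero: "tame (\<lambda>x. 0)"
  unfolding tame_def by auto

lemma tame_sum: "(\<And>i. i \<in> I \<Longrightarrow> tame (f i)) \<Longrightarrow> tame (\<lambda>x. \<Sum>i\<in>I. f i x)"
  by (induction I rule: infinite_finite_induct) (auto intro!: tame_zero tame_add)

lemma tame_abs: "tame f \<Longrightarrow> tame (\<lambda>x. \<bar>f x\<bar>)"
  unfolding tame_def bounded_iff by auto

lemma tame_mult:
  assumes "tame f" "tame g" shows "tame (\<lambda>x. f x * g x)"
proof -
  obtain M N where M: "0 < M" "\<And>x. \<bar>f x\<bar> \<le> M" and N: "0 < N" "\<And>x. \<bar>g x\<bar> \<le> N"
    using assms by (metis tame_bound)
  have m: "(\<lambda>x. f x * g x) \<in> borel_measurable borel" using assms by measurable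
  show ?thesis
  proof (rule tameI[OF m])
    show "integrable lborel (\<lambda>x. f x * g x)"
    proof (rule integrable_bound')
      show "integrable lborel (\<lambda>x. M * g x)" using assms tame_integrable by auto
      show "AE x in lborel. norm (f x * g x) \<le> norm (M * g x)"
        using M by (auto simp: abs_mult intro!: mult_right_mono)
    qed (use m in simp)
    show "\<bar>f x * g x\<bar> \<le> M * N" for x
      unfolding abs_mult using M N by (intro mult_mono) (auto intro: less_imp_le)
  qed
qed

lemma tame_powr:
  assumes f: "tame f" and p: "1 \<le> p" shows "tame (\<lambda>x. \<bar>f x\<bar> powr p)"
proof -
  obtain M where M: "0 < M" "\<And>x. \<bar>f x\<bar> \<le> M" using tame_bound[OF f] by metis
  have m: "(\<lambda>x. \<bar>f x\<bar> powr p) \<in> borel_measurable borel" using f by measurable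
  show ?thesis
  proof (rule tameI[OF m])
    show "\<bar>\<bar>f x\<bar> powr p\<bar> \<le> M powr p" for x
      using M(2)[of x] p by (auto intro!: powr_mono2)
    show "integrable lborel (\<lambda>x. \<bar>f x\<bar> powr p)"
    proof (rule integrable_bound')
      show "integrable lborel (\<lambda>x. M powr (p - 1) * f x)" using f tame_integrable by auto
      have "\<bar>f x\<bar> powr p \<le> M powr (p - 1) * \<bar>f x\<bar>" for x
      proof (cases "f x = 0")
        case False
        then have "\<bar>f x\<bar> powr p = \<bar>f x\<bar> powr (p - 1) * \<bar>f x\<bar>" by (simp add: powr_shift)
        also have "\<dots> \<le> M powr (p - 1) * \<bar>f x\<bar>" using M(2)[of x] p
          by (intro mult_right_mono powr_mono2) auto
        finally show ?thesis .
      qed simp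
      then show "AE x in lborel. norm (\<bar>f x\<bar> powr p) \<le> norm (M powr (p - 1) * f x)"
        by (simp add: abs_mult)
    qed (use m in simp)
  qed
qed

lemma integrable_translate:
  fixes f :: "'a::euclidean_space \<Rightarrow> 'b::{banach, second_countable_topology}"
  assumes "integrable lborel f" shows "integrable lborel (\<lambda>x. f (x + y))"
  using integrable_distr_eq[of "(+) y" lborel borel f] lborel_distr_plus[of y] assms
  by (auto simp: add.commute)

lemma integral_translate:
  fixes f :: "'a::euclidean_space \<Rightarrow> 'b::{banach, second_countable_topology}"
  assumes "f \<in> borel_measurable borel" shows "(LBINT x. f (x + y)) = (LBINT x. f x)"
  using integral_distr[of "(+) y" lborel borel f] lborel_distr_plus[of y] assms by (simp add: add.commute)

lemma tame_translate:
  assumes "tame f" shows "tame (\<lambda>x. f (x + y))"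
  using assms integrable_translate[of f y] unfolding tame_def bounded_iff by auto

lemma integrable_indicator_bounded:
  fixes S :: "'a::euclidean_space set"
  assumes "bounded S" "S \<in> sets borel" shows "integrable lborel (indicat_real S)"
  using assms emeasure_bounded_finite[of S] by (intro integrable_real_indicator) auto

section \<open>Symmetric averages and power series in them\<close>

definition sub_prob :: "(nat \<Rightarrow> real) \<Rightarrow> bool" where
  "sub_prob a \<longleftrightarrow> (\<forall>n. 0 \<le> a n) \<and> summable a \<and> suminf a \<le> 1"

text \<open>Symmetry is expressed through averages of test functions, so no involution of the index
  set has to be exhibited. It is the source of self-adjointness and of real symbols.\<close>

locale symmetric_walk =
  fixes I :: "'i set" and w :: "'i \<Rightarrow> real" and y :: "'i \<Rightarrow> 'a::euclidean_space"
  assumes finite_I: "finite I" and w_nonneg: "\<And>i. i \<in> I \<Longrightarrow> 0 \<le> w i" and w_sum: "sum w I = 1"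
    and w_sym: "\<And>g :: 'a \<Rightarrow> real. (\<Sum>i\<in>I. w i * g (- y i)) = (\<Sum>i\<in>I. w i * g (y i))"
begin

definition step :: "('a \<Rightarrow> real) \<Rightarrow> 'a \<Rightarrow> real" where
  "step f x = (\<Sum>i\<in>I. w i * f (x + y i))"

definition series :: "(nat \<Rightarrow> real) \<Rightarrow> ('a \<Rightarrow> real) \<Rightarrow> 'a \<Rightarrow> real" where
  "series a f x = (\<Sum>n. a n * (step ^^ n) f x)"

lemma step_bound: "(\<And>x. \<bar>f x\<bar> \<le> M) \<Longrightarrow> \<bar>step f x\<bar> \<le> M"
proof -
  assume f: "\<And>x. \<bar>f x\<bar> \<le> M"
  have "\<bar>step f x\<bar> \<le> (\<Sum>i\<in>I. \<bar>w i * f (x + y i)\<bar>)" unfolding step_def by (rule sum_abs)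
  also have "\<dots> \<le> (\<Sum>i\<in>I. w i * M)"
    by (intro sum_mono) (auto simp: abs_mult w_nonneg f intro!: mult_left_mono)
  also have "\<dots> = M" by (simp add: w_sum sum_distrib_right[symmetric])
  finally show ?thesis .
qed

lemma pow_bound: "(\<And>x. \<bar>f x\<bar> \<le> M) \<Longrightarrow> \<bar>(step ^^ n) f x\<bar> \<le> M"
  by (induction n arbitrary: x) (auto intro: step_bound)

lemma step_mono: "(\<And>x. f x \<le> g x) \<Longrightarrow> step f x \<le> step g x"
  unfolding step_def by (intro sum_mono mult_left_mono) (auto simp: w_nonneg)

lemma tame_step: "tame f \<Longrightarrow> tame (step f)"
  unfolding step_def[abs_def] by (intro tame_sum tame_cmult tame_translate)

lemma tame_pow: "tame f \<Longrightarrow> tame ((step ^^ n) f)"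
  by (induction n) (auto intro: tame_step)

lemma integral_step:
  assumes "tame f" shows "(LBINT x. step f x) = (LBINT x. f x)"
proof -
  have "(LBINT x. step f x) = (\<Sum>i\<in>I. w i * (LBINT x. f (x + y i)))"
    unfolding step_def using tame_integrable[OF tame_translate[OF assms]]
    by (subst Bochner_Integration.integral_sum) auto
  also have "\<dots> = (\<Sum>i\<in>I. w i * (LBINT x. f x))"
    using tameD[OF assms] by (simp add: integral_translate)
  finally show ?thesis by (simp add: w_sum sum_distrib_right[symmetric])
qed

lemma integral_pow: "tame f \<Longrightarrow> (LBINT x. (step ^^ n) f x) = (LBINT x. f x)"
  by (induction n) (auto simp: integral_step tame_pow)

lemma step_abs: "\<bar>step f x\<bar> \<le> step (\<lambda>x. \<bar>f x\<bar>) x"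
  unfolding step_def by (rule order_trans[OF sum_abs]) (auto simp: abs_mult w_nonneg intro!: sum_mono)

lemma pow_abs: "\<bar>(step ^^ n) f x\<bar> \<le> (step ^^ n) (\<lambda>x. \<bar>f x\<bar>) x"
proof (induction n arbitrary: x)
  case (Suc n)
  have "\<bar>(step ^^ Suc n) f x\<bar> \<le> step (\<lambda>x. \<bar>(step ^^ n) f x\<bar>) x" by (simp add: step_abs)
  also have "\<dots> \<le> step ((step ^^ n) (\<lambda>x. \<bar>f x\<bar>)) x" by (intro step_mono Suc)
  finally show ?case by simp
qed simp

lemma integral_abs_pow:
  assumes "tame f" shows "(LBINT x. \<bar>(step ^^ n) f x\<bar>) \<le> (LBINT x. \<bar>f x\<bar>)"
proof -
  have "(LBINT x. \<bar>(step ^^ n) f x\<bar>) \<le> (LBINT x. (step ^^ n) (\<lambda>x. \<bar>f x\<bar>) x)"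
    by (intro integral_mono pow_abs tame_integrable tame_pow tame_abs assms)
  then show ?thesis by (simp add: integral_pow tame_abs assms)
qed

lemma summable_series:
  assumes "sub_prob a" "\<And>x. \<bar>f x\<bar> \<le> M"
  shows "summable (\<lambda>n. \<bar>a n * (step ^^ n) f x\<bar>)" "summable (\<lambda>n. a n * (step ^^ n) f x)"
proof -
  show "summable (\<lambda>n. \<bar>a n * (step ^^ n) f x\<bar>)"
  proof (rule summable_comparison_test)
    show "summable (\<lambda>n. a n * M)" using assms(1) by (auto simp: sub_prob_def intro: summable_mult2)
    show "\<exists>N. \<forall>n\<ge>N. norm \<bar>a n * (step ^^ n) f x\<bar> \<le> a n * M"
      using assms pow_bound[OF assms(2)] by (auto simp: sub_prob_def abs_mult intro!: mult_left_mono)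
  qed
  then show "summable (\<lambda>n. a n * (step ^^ n) f x)" by (rule summable_rabs_cancel)
qed

lemma series_bound:
  assumes "sub_prob a" "\<And>x. \<bar>f x\<bar> \<le> M"
  shows "\<bar>series a f x\<bar> \<le> M"
proof -
  have M: "0 \<le> M" using assms(2)[of x] by linarith
  have "\<bar>series a f x\<bar> \<le> (\<Sum>n. \<bar>a n * (step ^^ n) f x\<bar>)"
    unfolding series_def by (rule summable_rabs[OF summable_series(1)[OF assms]])
  also have "\<dots> \<le> (\<Sum>n. a n * M)"
  proof (rule suminf_le[OF _ summable_series(1)[OF assms]])
    show "summable (\<lambda>n. a n * M)" using assms(1) by (auto simp: sub_prob_def intro: summable_mult2)
    show "\<bar>a n * (step ^^ n) f x\<bar> \<le> a n * M" for n
      using assms pow_bound[OF assms(2)] by (auto simp: sub_prob_def abs_mult intro!: mult_left_mono)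
  qed
  also have "\<dots> = suminf a * M" using assms(1) by (simp add: sub_prob_def suminf_mult2)
  also have "\<dots> \<le> 1 * M" using assms(1) M by (intro mult_right_mono) (auto simp: sub_prob_def)
  finally show ?thesis by simp
qed

text \<open>Powers of \<open>step\<close> do not increase the L1 norm, so the L1 norms of the terms
  are at most \<open>a n\<close> times a constant, and sum and integral may be exchanged. The
  bounded factor \<open>g\<close> is 1 for total masses, a tame function for pairings and a
  character for Fourier integrals, whence the general codomain.\<close>

lemma series_integral:
  fixes g :: "'a \<Rightarrow> 'b::{banach, second_countable_topology, real_normed_algebra_1}"
  assumes a: "sub_prob a" and f: "tame f" and g: "g \<in> borel_measurable borel" "\<And>x. norm (g x) \<le> B"
  shows "integrable lborel (\<lambda>x. series a f x *\<^sub>R g x)"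
    and "(LBINT x. series a f x *\<^sub>R g x) = (\<Sum>n. a n *\<^sub>R (LBINT x. (step ^^ n) f x *\<^sub>R g x))"
    and "summable (\<lambda>n. norm (a n *\<^sub>R (LBINT x. (step ^^ n) f x *\<^sub>R g x)))"
proof -
  obtain M where M: "0 < M" "\<And>x. \<bar>f x\<bar> \<le> M" using tame_bound[OF f] by metis
  have B: "0 \<le> B" using g(2)[of 0] norm_ge_zero order_trans by blast
  let ?h = "\<lambda>n x. (a n * (step ^^ n) f x) *\<^sub>R g x"
  have int: "integrable lborel (\<lambda>x. (step ^^ n) f x *\<^sub>R g x)" for n
  proof (rule integrable_bound')
    show "integrable lborel (\<lambda>x. B * (step ^^ n) f x)" by (simp add: tame_integrable tame_pow f)
    show "AE x in lborel. norm ((step ^^ n) f x *\<^sub>R g x) \<le> norm (B * (step ^^ n) f x)"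
      using g B by (intro AE_I2) (simp add: abs_mult mult.commute mult_right_mono)
    show "(\<lambda>x. (step ^^ n) f x *\<^sub>R g x) \<in> borel_measurable lborel"
      using g tameD[OF tame_pow[OF f]] by simp
  qed
  then have i: "integrable lborel (?h n)" for n
    using integrable_scaleR_right[of "a n" lborel "\<lambda>x. (step ^^ n) f x *\<^sub>R g x"] by simp
  have bnd: "(LBINT x. norm (?h n x)) \<le> a n * (B * (LBINT x. \<bar>f x\<bar>))" for n
  proof -
    have "(LBINT x. norm (?h n x)) \<le> (LBINT x. a n * (B * \<bar>(step ^^ n) f x\<bar>))"
    proof (intro integral_mono)
      show "integrable lborel (\<lambda>x. norm (?h n x))" using i by (rule integrable_norm)
      show "integrable lborel (\<lambda>x. a n * (B * \<bar>(step ^^ n) f x\<bar>))"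
        by (intro tame_integrable tame_cmult tame_abs tame_pow f)
      show "norm (?h n x) \<le> a n * (B * \<bar>(step ^^ n) f x\<bar>)" for x
      proof -
        have "a n * (norm (g x) * \<bar>(step ^^ n) f x\<bar>) \<le> a n * (B * \<bar>(step ^^ n) f x\<bar>)"
          using a g by (intro mult_left_mono mult_right_mono) (auto simp: sub_prob_def)
        then show ?thesis using a by (simp add: sub_prob_def abs_mult mult_ac)
      qed
    qed
    also have "\<dots> \<le> a n * (B * (LBINT x. \<bar>f x\<bar>))"
      using a B integral_abs_pow[OF f] by (auto simp: sub_prob_def intro!: mult_left_mono)
    finally show ?thesis .
  qed
  have s: "summable (\<lambda>n. a n * (B * (LBINT x. \<bar>f x\<bar>)))"
    using a by (auto simp: sub_prob_def intro: summable_mult2)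
  have s1: "summable (\<lambda>n. \<integral>x. norm (?h n x) \<partial>lborel)"
    by (rule summable_comparison_test[OF _ s]) (use bnd in auto)
  have s2: "AE x in lborel. summable (\<lambda>n. norm (?h n x))"
  proof (intro AE_I2)
    show "summable (\<lambda>n. norm (?h n x))" for x
      using summable_mult2[OF summable_series(1)[of a f M x, OF a M(2)], of "norm (g x)"] by simp
  qed
  have eq: "series a f x *\<^sub>R g x = (\<Sum>n. ?h n x)" for x
    unfolding series_def using summable_series(2)[of a f M x, OF a M(2)] by (simp add: suminf_scaleR_left)
  show "integrable lborel (\<lambda>x. series a f x *\<^sub>R g x)"
    unfolding eq by (rule integrable_suminf[OF i s2 s1])
  have e2: "(LBINT x. ?h n x) = a n *\<^sub>R (LBINT x. (step ^^ n) f x *\<^sub>R g x)" for n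
    unfolding scaleR_scaleR[symmetric] by (rule integral_scaleR_right)
  show "(LBINT x. series a f x *\<^sub>R g x) = (\<Sum>n. a n *\<^sub>R (LBINT x. (step ^^ n) f x *\<^sub>R g x))"
    unfolding eq integral_suminf[OF i s2 s1] e2 ..
  show "summable (\<lambda>n. norm (a n *\<^sub>R (LBINT x. (step ^^ n) f x *\<^sub>R g x)))"
    unfolding e2[symmetric]
    by (rule summable_comparison_test[OF _ s1]) (use integral_norm_bound[of lborel "?h _"] in auto)
qed

lemma tame_series:
  assumes a: "sub_prob a" and f: "tame f" shows "tame (series a f)"
proof -
  obtain M where M: "0 < M" "\<And>x. \<bar>f x\<bar> \<le> M" using tame_bound[OF f] by metis
  have "integrable lborel (series a f)"
    using series_integral(1)[OF a f, of "\<lambda>x. 1::real" 1] by simp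
  then show ?thesis
    by (intro tameI[where M = M] series_bound[OF a M(2)]) (auto dest: borel_measurable_integrable)
qed

lemma integral_series_le:
  assumes a: "sub_prob a" and f: "tame f" and nn: "\<And>x. 0 \<le> f x"
  shows "(LBINT x. series a f x) \<le> (LBINT x. f x)"
proof -
  have "(LBINT x. series a f x) = suminf a * (LBINT x. f x)"
    using series_integral(2)[OF a f, of "\<lambda>x. 1::real" 1] a
    by (simp add: integral_pow f sub_prob_def suminf_mult2)
  also have "\<dots> \<le> 1 * (LBINT x. f x)"
    using a nn by (intro mult_right_mono) (auto simp: sub_prob_def intro: integral_nonneg)
  finally show ?thesis by simp
qed

lemma continuous_step: "continuous_on UNIV f \<Longrightarrow> continuous_on UNIV (step f)"
  unfolding step_def[abs_def]
  by (intro continuous_on_sum continuous_on_mult_left continuous_on_compose2[where f = "\<lambda>x. x + y _" and g = f])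
    (auto intro!: continuous_on_add)

lemma continuous_pow: "continuous_on UNIV f \<Longrightarrow> continuous_on UNIV ((step ^^ n) f)"
  by (induction n) (auto intro: continuous_step)

lemma continuous_series:
  assumes a: "sub_prob a" and f: "tame f" and c: "continuous_on UNIV f"
  shows "continuous_on UNIV (series a f)"
proof -
  obtain M where M: "0 < M" "\<And>x. \<bar>f x\<bar> \<le> M" using tame_bound[OF f] by metis
  have "uniform_limit UNIV (\<lambda>N x. \<Sum>n<N. a n * (step ^^ n) f x) (\<lambda>x. \<Sum>n. a n * (step ^^ n) f x) sequentially"
  proof (rule Weierstrass_m_test)
    show "summable (\<lambda>n. a n * M)" using a by (auto simp: sub_prob_def intro: summable_mult2)
    show "norm (a n * (step ^^ n) f x) \<le> a n * M" for n x
      using a pow_bound[OF M(2)] by (auto simp: sub_prob_def abs_mult intro!: mult_left_mono)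
  qed
  then show ?thesis unfolding series_def[abs_def]
    by (rule uniform_limit_theorem[rotated]) (auto intro!: always_eventually continuous_intros continuous_pow c)
qed

text \<open>A shift by \<open>z\<close> moves to the other factor as a shift by \<open>- z\<close>,
  and the symmetry of the walk undoes the sign.\<close>

lemma step_symmetric:
  assumes "tame f" "tame h"
  shows "(LBINT x. step f x * h x) = (LBINT x. f x * step h x)"
proof -
  have i: "integrable lborel (\<lambda>x. f (x + z) * h x)" "integrable lborel (\<lambda>x. f x * h (x + z))" for z
    using assms by (auto intro!: tame_integrable tame_mult tame_translate)
  have tr: "(LBINT x. f (x + z) * h x) = (LBINT x. f x * h (x + (- z)))" for z
    using integral_translate[OF tameD[OF tame_mult[OF assms(1) tame_translate[OF assms(2), of "- z"]]], of z] by simp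
  have "(LBINT x. step f x * h x) = (\<Sum>i\<in>I. w i * (LBINT x. f (x + y i) * h x))"
    unfolding step_def sum_distrib_right mult.assoc using i
    by (subst Bochner_Integration.integral_sum) auto
  also have "\<dots> = (\<Sum>i\<in>I. w i * (LBINT x. f x * h (x + y i)))"
    unfolding tr by (rule w_sym)
  also have "\<dots> = (LBINT x. f x * step h x)"
    unfolding step_def sum_distrib_left mult.left_commute[of "f _"] using i
    by (subst Bochner_Integration.integral_sum) auto
  finally show ?thesis .
qed

lemma pow_symmetric:
  assumes "tame f" "tame h"
  shows "(LBINT x. (step ^^ n) f x * h x) = (LBINT x. f x * (step ^^ n) h x)"
  using assms
proof (induction n arbitrary: h)
  case (Suc n)
  then show ?case
    using step_symmetric[OF tame_pow[OF Suc.prems(1)], of h n] Suc.IH[OF Suc.prems(1) tame_step[OF Suc.prems(2)]]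
    by (simp add: funpow_swap1)
qed simp

lemma series_symmetric:
  assumes a: "sub_prob a" and f: "tame f" and h: "tame h"
  shows "(LBINT x. series a f x * h x) = (LBINT x. f x * series a h x)"
proof -
  obtain M where M: "0 < M" "\<And>x. \<bar>f x\<bar> \<le> M" using tame_bound[OF f] by metis
  obtain N where N: "0 < N" "\<And>x. \<bar>h x\<bar> \<le> N" using tame_bound[OF h] by metis
  show ?thesis
    using series_integral(2)[OF a f, of h N] series_integral(2)[OF a h, of f M] f h M N
      pow_symmetric[OF f h] by (simp add: tameD mult.commute[of _ "f _"])
qed

text \<open>A shift multiplies the transform by a unimodular constant, and averaging these constants
  over a symmetric walk leaves only their cosine parts.\<close>

lemma step_fourier:
  assumes f: "tame f"
  shows "(LBINT x. step f x *\<^sub>R cis (\<xi> \<bullet> x)) = (\<Sum>i\<in>I. w i * cos (\<xi> \<bullet> y i)) *\<^sub>R (LBINT x. f x *\<^sub>R cis (\<xi> \<bullet> x))"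
proof -
  have m: "(\<lambda>x. cis (\<xi> \<bullet> x)) \<in> borel_measurable borel"
    by (intro borel_measurable_continuous_onI continuous_intros)
  have i: "integrable lborel (\<lambda>x. f (x + z) *\<^sub>R cis (\<xi> \<bullet> x))" for z
  proof (rule integrable_bound')
    show "integrable lborel (\<lambda>x. f (x + z))" using f by (intro tame_integrable tame_translate)
  qed (use tameD[OF tame_translate[OF f]] m in auto)
  have tr: "(LBINT x. f (x + z) *\<^sub>R cis (\<xi> \<bullet> x)) = cis (- (\<xi> \<bullet> z)) * (LBINT x. f x *\<^sub>R cis (\<xi> \<bullet> x))" (is "?l = _") for z
  proof -
    have "(\<lambda>x. cis (\<xi> \<bullet> (x - z))) \<in> borel_measurable borel"
      by (intro borel_measurable_continuous_onI continuous_intros)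
    then have m2: "(\<lambda>x. f x *\<^sub>R cis (\<xi> \<bullet> (x - z))) \<in> borel_measurable borel"
      using tameD[OF f] by simp
    have "?l = (LBINT x. f x *\<^sub>R cis (\<xi> \<bullet> (x - z)))"
      using integral_translate[of "\<lambda>x. f x *\<^sub>R cis (\<xi> \<bullet> (x - z))" z] m2 by simp
    also have "\<dots> = (LBINT x. cis (- (\<xi> \<bullet> z)) * (f x *\<^sub>R cis (\<xi> \<bullet> x)))"
      by (simp add: inner_diff_right cis_mult algebra_simps)
    finally show ?thesis by (simp only: integral_mult_right_zero)
  qed
  have "(LBINT x. step f x *\<^sub>R cis (\<xi> \<bullet> x)) = (\<Sum>i\<in>I. w i *\<^sub>R (LBINT x. f (x + y i) *\<^sub>R cis (\<xi> \<bullet> x)))"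
    unfolding step_def scaleR_left.sum scaleR_scaleR[symmetric] using i
    by (subst Bochner_Integration.integral_sum) (auto simp del: scaleR_scaleR)
  also have "\<dots> = (\<Sum>i\<in>I. w i *\<^sub>R cis (- (\<xi> \<bullet> y i))) * (LBINT x. f x *\<^sub>R cis (\<xi> \<bullet> x))"
    unfolding tr by (simp add: sum_distrib_right)
  also have "(\<Sum>i\<in>I. w i *\<^sub>R cis (- (\<xi> \<bullet> y i))) = complex_of_real (\<Sum>i\<in>I. w i * cos (\<xi> \<bullet> y i))"
    using w_sym[of "\<lambda>z. sin (\<xi> \<bullet> z)"] by (simp add: complex_eq_iff sum_negf)
  finally show ?thesis by (simp add: scaleR_conv_of_real)
qed

definition symbol :: "'a \<Rightarrow> real" where
  "symbol \<xi> = (\<Sum>i\<in>I. w i * cos (\<xi> \<bullet> y i))"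

lemma pow_fourier:
  assumes f: "tame f"
  shows "(LBINT x. (step ^^ n) f x *\<^sub>R cis (\<xi> \<bullet> x)) = (symbol \<xi>) ^ n *\<^sub>R (LBINT x. f x *\<^sub>R cis (\<xi> \<bullet> x))"
  by (induction n) (simp_all add: step_fourier tame_pow f symbol_def)

lemma symbol_abs: "\<bar>symbol \<xi>\<bar> \<le> 1"
proof -
  have "\<bar>symbol \<xi>\<bar> \<le> (\<Sum>i\<in>I. \<bar>w i * cos (\<xi> \<bullet> y i)\<bar>)" unfolding symbol_def by (rule sum_abs)
  also have "\<dots> \<le> (\<Sum>i\<in>I. w i * 1)"
    by (intro sum_mono) (auto simp: abs_mult w_nonneg simp del: mult_1_right intro!: mult_left_mono)
  finally show ?thesis using w_sum by simp
qed

lemma series_fourier: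
  assumes a: "sub_prob a" and f: "tame f"
  shows "(LBINT x. series a f x *\<^sub>R cis (\<xi> \<bullet> x)) = (\<Sum>n. a n * symbol \<xi> ^ n) *\<^sub>R (LBINT x. f x *\<^sub>R cis (\<xi> \<bullet> x))"
proof -
  have m: "(\<lambda>x. cis (\<xi> \<bullet> x)) \<in> borel_measurable borel"
    by (intro borel_measurable_continuous_onI continuous_intros)
  have s: "summable (\<lambda>n. a n * symbol \<xi> ^ n)"
  proof (rule summable_comparison_test)
    show "summable a" using a by (simp add: sub_prob_def)
    show "\<exists>N. \<forall>n\<ge>N. norm (a n * symbol \<xi> ^ n) \<le> a n"
      using a symbol_abs[of \<xi>] by (auto simp: sub_prob_def abs_mult power_abs power_le_one mult_left_le)
  qed
  show ?thesis
    using series_integral(2)[OF a f m, of 1] s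
    by (simp add: pow_fourier f suminf_scaleR_left[OF s] scaleR_scaleR[symmetric] del: scaleR_scaleR)
qed

lemma step_jensen:
  assumes "convex_on UNIV \<Psi>"
  shows "\<Psi> (step u x, step v x) \<le> step (\<lambda>x. \<Psi> (u x, v x)) x"
proof -
  have "(step u x, step v x) = (\<Sum>i\<in>I. w i *\<^sub>R (u (x + y i), v (x + y i)))"
    by (simp add: step_def prod_eq_iff fst_sum snd_sum)
  moreover have "I \<noteq> {}" using w_sum by auto
  ultimately show ?thesis
    using convex_on_sum[OF finite_I _ assms w_sum w_nonneg, of "\<lambda>i. (u (x + y i), v (x + y i))"]
    by (simp add: step_def)
qed

lemma pow_jensen:
  assumes "convex_on UNIV \<Psi>"
  shows "\<Psi> ((step ^^ n) u x, (step ^^ n) v x) \<le> (step ^^ n) (\<lambda>x. \<Psi> (u x, v x)) x"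
proof (induction n arbitrary: x)
  case (Suc n)
  have "\<Psi> ((step ^^ Suc n) u x, (step ^^ Suc n) v x)
      \<le> step (\<lambda>x. \<Psi> ((step ^^ n) u x, (step ^^ n) v x)) x"
    using step_jensen[OF assms] by simp
  also have "\<dots> \<le> step ((step ^^ n) (\<lambda>x. \<Psi> (u x, v x))) x" by (intro step_mono Suc)
  finally show ?case by simp
qed simp

text \<open>The coefficients may have total mass below 1; the missing mass is placed at the origin,
  where \<open>\<Psi>\<close> vanishes. Partial sums then obey the finite Jensen inequality, and a
  finite convex function on the plane is continuous, which allows the limit.\<close>

lemma series_jensen:
  assumes conv: "convex_on UNIV \<Psi>" and \<Psi>0: "\<Psi> (0, 0) = 0"
    and a: "sub_prob a" and u: "tame u" and v: "tame v" and G: "tame (\<lambda>x. \<Psi> (u x, v x))"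
  shows "\<Psi> (series a u x, series a v x) \<le> series a (\<lambda>x. \<Psi> (u x, v x)) x"
proof -
  obtain M where M: "0 < M" "\<And>x. \<bar>u x\<bar> \<le> M" using tame_bound[OF u] by metis
  obtain N where N: "0 < N" "\<And>x. \<bar>v x\<bar> \<le> N" using tame_bound[OF v] by metis
  obtain L where L: "0 < L" "\<And>x. \<bar>\<Psi> (u x, v x)\<bar> \<le> L" using tame_bound[OF G] by metis
  define W where "W n = ((step ^^ n) u x, (step ^^ n) v x)" for n
  have le: "\<Psi> (\<Sum>n<k. a n *\<^sub>R W n) \<le> (\<Sum>n<k. a n * (step ^^ n) (\<lambda>x. \<Psi> (u x, v x)) x)" for k
  proof -
    define s where "s = sum a {..<k}"
    have s1: "0 \<le> s" "s \<le> 1" using a sum_le_suminf[of a "{..<k}"]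
      by (auto simp: s_def sub_prob_def intro!: sum_nonneg)
    have "\<Psi> (\<Sum>n<k. a n *\<^sub>R W n) \<le> (\<Sum>n<k. a n * \<Psi> (W n))"
    proof (cases "s = 0")
      case True
      then have "a n = 0" if "n < k" for n
        using a that by (auto simp: s_def sub_prob_def sum_nonneg_eq_0_iff)
      then show ?thesis using \<Psi>0 by (simp flip: zero_prod_def)
    next
      case False
      then have pos: "0 < s" using s1 by simp
      have "(\<Sum>n<k. a n *\<^sub>R W n) = (1 - s) *\<^sub>R (0, 0) + s *\<^sub>R (\<Sum>n<k. (a n / s) *\<^sub>R W n)"
        using pos by (simp add: scaleR_sum_right zero_prod_def[symmetric])
      also have "\<Psi> \<dots> \<le> (1 - s) * \<Psi> (0, 0) + s * \<Psi> (\<Sum>n<k. (a n / s) *\<^sub>R W n)"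
        by (intro convex_onD[OF conv]) (use s1 in auto)
      also have "\<Psi> (\<Sum>n<k. (a n / s) *\<^sub>R W n) \<le> (\<Sum>n<k. (a n / s) * \<Psi> (W n))"
      proof (rule convex_on_sum[OF _ _ conv])
        show "{..<k} \<noteq> {}" using pos by (auto simp: s_def)
        show "(\<Sum>n<k. a n / s) = 1" using pos by (simp add: s_def sum_divide_distrib[symmetric])
      qed (use a pos in \<open>auto simp: sub_prob_def\<close>)
      finally show ?thesis using pos \<Psi>0 by (simp add: sum_distrib_left)
    qed
    also have "\<dots> \<le> (\<Sum>n<k. a n * (step ^^ n) (\<lambda>x. \<Psi> (u x, v x)) x)"
      unfolding W_def using a by (intro sum_mono mult_left_mono pow_jensen conv) (auto simp: sub_prob_def)
    finally show ?thesis .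
  qed
  have "(\<lambda>k. (\<Sum>n<k. a n * (step ^^ n) u x, \<Sum>n<k. a n * (step ^^ n) v x)) \<longlonglongrightarrow> (series a u x, series a v x)"
    unfolding series_def
    by (intro tendsto_Pair summable_LIMSEQ summable_series(2)[OF a M(2)] summable_series(2)[OF a N(2)])
  moreover have "(\<Sum>n<k. a n *\<^sub>R W n) = (\<Sum>n<k. a n * (step ^^ n) u x, \<Sum>n<k. a n * (step ^^ n) v x)" for k
    by (simp add: W_def prod_eq_iff fst_sum snd_sum)
  ultimately have "(\<lambda>k. \<Sum>n<k. a n *\<^sub>R W n) \<longlonglongrightarrow> (series a u x, series a v x)" by simp
  moreover have "isCont \<Psi> (series a u x, series a v x)"
    using convex_on_continuous[OF open_UNIV conv] by (simp add: continuous_on_eq_continuous_at)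
  ultimately have "(\<lambda>k. \<Psi> (\<Sum>n<k. a n *\<^sub>R W n)) \<longlonglongrightarrow> \<Psi> (series a u x, series a v x)"
    by (rule isCont_tendsto_compose[rotated])
  moreover have "(\<lambda>k. \<Sum>n<k. a n * (step ^^ n) (\<lambda>x. \<Psi> (u x, v x)) x) \<longlonglongrightarrow> series a (\<lambda>x. \<Psi> (u x, v x)) x"
    unfolding series_def by (intro summable_LIMSEQ summable_series(2)[OF a L(2)])
  ultimately show ?thesis using le by (intro LIMSEQ_le) auto
qed

lemma step_series:
  assumes a: "sub_prob a" and f: "\<And>x. \<bar>f x\<bar> \<le> M"
  shows "step (series a f) = series a (step f)"
proof
  fix x
  have s: "summable (\<lambda>n. a n * (step ^^ n) f z)" for z
    by (rule summable_series(2)[OF a f])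
  have "step (series a f) x = (\<Sum>i\<in>I. \<Sum>n. w i * (a n * (step ^^ n) f (x + y i)))"
    unfolding step_def[of "series a f"] series_def by (intro sum.cong refl suminf_mult[symmetric] s)
  also have "\<dots> = (\<Sum>n. \<Sum>i\<in>I. w i * (a n * (step ^^ n) f (x + y i)))"
    by (rule suminf_sum[symmetric]) (intro summable_mult s)
  also have "\<dots> = series a (step f) x"
    unfolding series_def funpow_swap1[symmetric]
    by (simp add: step_def sum_distrib_left mult.left_commute)
  finally show "step (series a f) x = series a (step f) x" .
qed

lemma pow_series:
  assumes a: "sub_prob a" and f: "\<And>x. \<bar>f x\<bar> \<le> M"
  shows "(step ^^ n) (series a f) = series a ((step ^^ n) f)"
proof (induction n)
  case (Suc n)
  have "(step ^^ Suc n) (series a f) = step (series a ((step ^^ n) f))" by (simp add: Suc)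
  also have "\<dots> = series a ((step ^^ Suc n) f)"
    using step_series[OF a, of "(step ^^ n) f" M] pow_bound[OF f] by simp
  finally show ?case .
qed simp

text \<open>This is the Cauchy product, through which identities between coefficient sequences
  become identities between operators. The double family is dominated by
  \<open>a n * b m * M\<close>, hence absolutely summable, and may be summed along the diagonals on
  which \<open>n + m\<close> is constant.\<close>

lemma series_series:
  assumes a: "sub_prob a" and b: "sub_prob b" and f: "\<And>x. \<bar>f x\<bar> \<le> M"
  shows "series a (series b f) x = (\<Sum>n. (\<Sum>i\<le>n. a i * b (n - i)) * (step ^^ n) f x)"
    and "summable (\<lambda>n. (\<Sum>i\<le>n. a i * b (n - i)) * (step ^^ n) f x)"
proof -
  define s where "s n = (step ^^ n) f x" for n
  have M: "0 \<le> M" using f[of x] by linarith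
  have sM: "\<bar>s n\<bar> \<le> M" for n unfolding s_def by (rule pow_bound[OF f])
  have an: "0 \<le> a n" "0 \<le> b n" for n using a b by (auto simp: sub_prob_def)
  have sa: "summable a" "summable b" using a b by (auto simp: sub_prob_def)
  have s1: "series a (series b f) x = (\<Sum>n. \<Sum>m. a n * b m * s (n + m))"
  proof -
    have "(step ^^ n) (series b f) x = (\<Sum>m. b m * s (n + m))" for n
      unfolding pow_series[OF b f] unfolding series_def s_def
      by (simp add: add.commute[of n] funpow_add)
    moreover have "summable (\<lambda>m. b m * s (n + m))" for n
      by (rule summable_comparison_test[OF _ summable_mult2[OF sa(2), of M]])
        (use sM an in \<open>auto simp: abs_mult intro!: mult_left_mono\<close>)
    ultimately show ?thesis unfolding series_def by (simp add: suminf_mult mult.assoc)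
  qed
  define F where "F = (\<lambda>(n, m). a n * b m * s (n + m))"
  have "(\<lambda>z. norm (F z)) summable_on UNIV \<times> UNIV"
  proof (rule Infinite_Sum.abs_summable_on_comparison_test')
    show "(\<lambda>(n, m). a n * b m * M) summable_on UNIV \<times> UNIV"
    proof (rule summable_on_SigmaI)
      fix n
      show "((\<lambda>m. (\<lambda>(n, m). a n * b m * M) (n, m)) has_sum a n * (suminf b * M)) UNIV"
        using an M sa by (intro sums_nonneg_imp_has_sum) (auto simp: mult.assoc intro!: sums_mult sums_mult2 summable_sums)
    next
      show "(\<lambda>n. a n * (suminf b * M)) summable_on UNIV"
        using an M sa by (intro summable_nonneg_imp_summable_on summable_mult2) (auto intro!: suminf_nonneg mult_nonneg_nonneg)
    qed (use an M in auto)
    show "norm (F z) \<le> (\<lambda>(n, m). a n * b m * M) z" if "z \<in> UNIV \<times> UNIV" for z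
      using an sM by (auto simp: F_def abs_mult split: prod.splits intro!: mult_left_mono)
  qed
  then have Fs: "F summable_on UNIV \<times> UNIV"
    by (rule Infinite_Sum.abs_summable_summable)
  have i2s: "(\<Sum>n. g n) = infsum g UNIV" "summable g" if "g summable_on (UNIV :: nat set)" for g :: "nat \<Rightarrow> real"
    using has_sum_imp_sums[OF has_sum_infsum[OF that]] by (auto simp: sums_iff)
  have inner: "(\<lambda>m. F (n, m)) summable_on UNIV" for n
    by (rule summable_on_SigmaD1[where A = UNIV and B = "\<lambda>_. UNIV" and f = "\<lambda>x y. F (x, y)"]) (use Fs in auto)
  have "series a (series b f) x = (\<Sum>n. \<Sum>m. F (n, m))"
    unfolding s1 F_def by simp
  also have "\<dots> = (\<Sum>n. infsum (\<lambda>m. F (n, m)) UNIV)"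
    using i2s(1)[OF inner] by simp
  also have "\<dots> = infsum (\<lambda>n. infsum (\<lambda>m. F (n, m)) UNIV) UNIV"
    by (rule i2s(1), rule summable_on_Sigma_banach) (use Fs in \<open>simp add: case_prod_unfold\<close>)
  also have "\<dots> = infsum F (UNIV \<times> UNIV)"
    by (rule infsum_Sigma_banach[OF Fs])
  finally have e1: "series a (series b f) x = infsum F (UNIV \<times> UNIV)" .
  have bij: "bij_betw (\<lambda>(k, i). (i, k - i)) (SIGMA k:UNIV. {..k}) (UNIV \<times> UNIV :: (nat \<times> nat) set)"
    by (rule bij_betwI[of _ _ _ "\<lambda>(n, m). (n + m, n)"]) auto
  define G where "G = (\<lambda>(k, i). a i * b (k - i) * s k)"
  have GF: "G z = F ((\<lambda>(k, i). (i, k - i)) z)" if "z \<in> (SIGMA k:UNIV. {..k})" for z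
    using that by (auto simp: G_def F_def)
  have e2: "infsum F (UNIV \<times> UNIV) = infsum G (SIGMA k:UNIV. {..k})"
    unfolding infsum_reindex_bij_betw[OF bij, of F, symmetric] by (rule infsum_cong) (rule GF[symmetric])
  have Gs: "G summable_on (SIGMA k:UNIV. {..k})"
    using Fs unfolding summable_on_reindex_bij_betw[OF bij, of F, symmetric]
    by (rule summable_on_cong[THEN iffD1, rotated]) (rule GF[symmetric])
  have fin: "infsum (\<lambda>i. G (k, i)) {..k} = (\<Sum>i\<le>k. a i * b (k - i)) * s k" for k
    by (simp add: G_def sum_distrib_right)
  have Ks: "(\<lambda>k. (\<Sum>i\<le>k. a i * b (k - i)) * s k) summable_on UNIV"
    unfolding fin[symmetric] by (rule summable_on_Sigma_banach) (use Gs in \<open>simp add: case_prod_unfold\<close>)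
  have "infsum G (SIGMA k:UNIV. {..k}) = infsum (\<lambda>k. (\<Sum>i\<le>k. a i * b (k - i)) * s k) UNIV"
    unfolding fin[symmetric] by (rule infsum_Sigma_banach[OF Gs, symmetric])
  then show "series a (series b f) x = (\<Sum>n. (\<Sum>i\<le>n. a i * b (n - i)) * (step ^^ n) f x)"
    using e1 e2 i2s(1)[OF Ks] by (simp add: s_def)
  show "summable (\<lambda>n. (\<Sum>i\<le>n. a i * b (n - i)) * (step ^^ n) f x)"
    using i2s(2)[OF Ks] by (simp add: s_def)
qed

end

section \<open>The bilinear estimate\<close>

lemma tame_dominated:
  assumes "f \<in> borel_measurable borel" "tame g" "\<And>x. \<bar>f x\<bar> \<le> g x"
  shows "tame f"
proof -
  obtain M where M: "0 < M" "\<And>x. \<bar>g x\<bar> \<le> M" using tame_bound[OF assms(2)] by metis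
  show ?thesis
  proof (rule tameI[OF assms(1)])
    show "integrable lborel f"
      by (rule integrable_bound'[OF tame_integrable[OF assms(2)]])
        (use assms in \<open>auto intro!: order_trans[OF assms(3)]\<close>)
    show "\<bar>f x\<bar> \<le> M" for x using assms(3)[of x] M(2)[of x] by linarith
  qed
qed

definition bellman_const :: "real \<Rightarrow> real" where
  "bellman_const q = (5 + 16 * (1 + 1 / (q - 1))\<^sup>2) / (q * (q - 1)) + 2"

lemma bellman_const_pos: "1 < q \<Longrightarrow> 0 < bellman_const q"
  unfolding bellman_const_def by (intro add_nonneg_pos divide_nonneg_nonneg) auto

lemma convex_bellman:
  assumes q: "1 < q" "q \<le> 2"
  shows "convex_on UNIV (\<lambda>w. bellman q 0 (fst w) (snd w))"
proof (rule convex_onI)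
  fix t :: real and w w' :: "real \<times> real" assume t: "0 < t" "t < 1"
  have "t * (1 - t) * (\<bar>fst w' - fst w\<bar> * \<bar>snd w' - snd w\<bar>) \<ge> 0" using t by simp
  then show "bellman q 0 (fst ((1 - t) *\<^sub>R w + t *\<^sub>R w')) (snd ((1 - t) *\<^sub>R w + t *\<^sub>R w'))
    \<le> (1 - t) * bellman q 0 (fst w) (snd w) + t * bellman q 0 (fst w') (snd w')"
    using bellman_convex[OF q, of t "fst w" "fst w'" "snd w" "snd w'"] t
    unfolding fst_add snd_add fst_scaleR snd_scaleR real_scaleR_def by linarith
qed simp

lemma tame_bellman:
  assumes q: "1 < q" "q \<le> 2" and u: "tame u" and v: "tame v"
  shows "tame (\<lambda>x. bellman q 0 (u x) (v x))"
proof (rule tame_dominated)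
  have "(\<lambda>w. bellman q 0 (fst w) (snd w)) \<in> borel_measurable borel"
    using convex_on_continuous[OF open_UNIV convex_bellman[OF q]] by (rule borel_measurable_continuous_onI)
  moreover have "(\<lambda>x. (u x, v x)) \<in> borel_measurable borel"
    using tameD[OF u] tameD[OF v] by simp
  ultimately show "(\<lambda>x. bellman q 0 (u x) (v x)) \<in> borel_measurable borel"
    using measurable_compose[of "\<lambda>x. (u x, v x)" borel borel "\<lambda>w. bellman q 0 (fst w) (snd w)" borel] by simp
  let ?p = "q / (q - 1)"
  have p: "1 \<le> ?p" using q by (simp add: field_simps)
  show "tame (\<lambda>x. bellman_const q * (\<bar>u x\<bar> powr ?p + \<bar>v x\<bar> powr q))"
    using u v p q by (intro tame_cmult tame_add tame_powr) auto
  show "\<bar>bellman q 0 (u x) (v x)\<bar> \<le> bellman_const q * (\<bar>u x\<bar> powr ?p + \<bar>v x\<bar> powr q)" for x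
    using bellman_growth[OF q refl] bellman_nonneg[OF q(1)] unfolding bellman_const_def by simp
qed

text \<open>The sequences stand for the coefficients of \<open>S\<close> and of \<open>K'\<close>,
  and \<open>coefficients\<close> is \<open>S^2 + K' = 2 S\<close> read off term by term. Besides
  positivity and mass at most 1, this is all that the estimate uses of the fractional
  powers.\<close>

locale half_space_walk = symmetric_walk I w y
  for I :: "'i set" and w :: "'i \<Rightarrow> real" and y :: "'i \<Rightarrow> 'a::euclidean_space" +
  fixes a b :: "nat \<Rightarrow> real"
  assumes sub_prob_a: "sub_prob a" and sub_prob_b: "sub_prob b"
    and coefficients: "\<And>n. (\<Sum>i\<le>n. a i * a (n - i)) + b n = 2 * a n"
begin

definition down :: "nat \<Rightarrow> ('a \<Rightarrow> real) \<Rightarrow> 'a \<Rightarrow> real" where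
  "down n = series a ^^ n"

lemma down_0 [simp]: "down 0 f = f" and down_Suc: "down (Suc n) f = series a (down n f)"
  by (simp_all add: down_def)

lemma tame_down: "tame f \<Longrightarrow> tame (down n f)"
  by (induction n) (auto simp: down_Suc intro: tame_series sub_prob_a)

lemma continuous_down: "tame f \<Longrightarrow> continuous_on UNIV f \<Longrightarrow> continuous_on UNIV (down n f)"
  by (induction n) (auto simp: down_Suc intro!: continuous_series sub_prob_a tame_down)

lemma down_fourier:
  assumes f: "tame f"
  shows "(LBINT x. down n f x *\<^sub>R cis (\<xi> \<bullet> x))
    = (\<Sum>n. a n * symbol \<xi> ^ n) ^ n *\<^sub>R (LBINT x. f x *\<^sub>R cis (\<xi> \<bullet> x))"
  by (induction n) (simp_all add: down_Suc series_fourier[OF sub_prob_a] tame_down f)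

lemma down_add_symmetric:
  assumes "tame f" "tame h"
  shows "(LBINT x. down (i + j) f x * h x) = (LBINT x. down i f x * down j h x)"
  using assms
proof (induction j arbitrary: i)
  case (Suc j)
  have "(LBINT x. down (i + Suc j) f x * h x) = (LBINT x. down (Suc i) f x * down j h x)"
    using Suc.IH[of "Suc i"] Suc.prems by simp
  also have "\<dots> = (LBINT x. down i f x * down (Suc j) h x)"
    unfolding down_Suc using Suc.prems by (intro series_symmetric sub_prob_a tame_down)
  finally show ?case .
qed simp

lemma mean_value:
  assumes f: "tame f"
  shows "series a (series a f) x + series b f x = 2 * series a f x"
proof -
  obtain M where M: "0 < M" "\<And>x. \<bar>f x\<bar> \<le> M" using tame_bound[OF f] by metis
  note s = series_series[of a a f M x, OF sub_prob_a sub_prob_a M(2)]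
    summable_series(2)[of b f M x, OF sub_prob_b M(2)] summable_series(2)[of a f M x, OF sub_prob_a M(2)]
  have "series a (series a f) x + series b f x =
      (\<Sum>n. (\<Sum>i\<le>n. a i * a (n - i)) * (step ^^ n) f x + b n * (step ^^ n) f x)"
    unfolding s(1) series_def[of b] by (rule suminf_add[OF s(2) s(3)])
  also have "\<dots> = (\<Sum>n. 2 * (a n * (step ^^ n) f x))"
    unfolding distrib_right[symmetric] coefficients by (simp add: mult.assoc)
  also have "\<dots> = 2 * series a f x" unfolding series_def by (rule suminf_mult[OF s(4)])
  finally show ?thesis .
qed

text \<open>The absolute values stand inside the integral, so that one bound serves all admissible
  weight sequences.\<close>

definition energy :: "nat \<Rightarrow> ('a \<Rightarrow> real) \<Rightarrow> ('a \<Rightarrow> real) \<Rightarrow> real" where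
  "energy n f h = (LBINT x. \<bar>down (Suc n) f x - down n f x\<bar> * \<bar>down (Suc n) h x - down n h x\<bar>)"

lemma energy_commute: "energy n f h = energy n h f"
  by (simp add: energy_def mult.commute)

text \<open>By \<open>mean_value\<close>, the function at height 1 is the midpoint of the one at
  height 2 and of \<open>K'\<close> applied to the one at height 0. Convexity at
  \<open>t = 1/2\<close> gains a quarter of the product of the end point differences, and each
  difference is twice an increment. Jensen's inequality for \<open>K'\<close>, whose mass is at most
  1, brings the term with \<open>K'\<close> back to \<open>f\<close> and \<open>h\<close>.\<close>

lemma bellman_mean:
  assumes q: "1 < q" "q \<le> 2" and f: "tame f" and h: "tame h"
  shows "2 * (LBINT x. bellman q 0 (series a f x) (series a h x))
    \<le> (LBINT x. bellman q 0 (series a (series a f) x) (series a (series a h) x))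
      + (LBINT x. bellman q 0 (f x) (h x))
      - 2 * (LBINT x. \<bar>series a (series a f) x - series a f x\<bar> * \<bar>series a (series a h) x - series a h x\<bar>)"
proof -
  note T = tame_series[OF sub_prob_a]
  let ?B = "\<lambda>u v x. bellman q 0 (u x) (v x)"
  let ?f1 = "series a f" and ?h1 = "series a h"
  let ?f2 = "series a ?f1" and ?h2 = "series a ?h1"
  let ?D = "\<lambda>x. \<bar>?f2 x - ?f1 x\<bar> * \<bar>?h2 x - ?h1 x\<bar>"
  let ?G = "series b (?B f h)"
  have pw: "2 * ?B ?f1 ?h1 x \<le> ?B ?f2 ?h2 x + ?G x - 2 * ?D x" for x
  proof -
    have e: "?f1 x = (1 - 1/2) * ?f2 x + 1/2 * series b f x" "?h1 x = (1 - 1/2) * ?h2 x + 1/2 * series b h x"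
      using mean_value[OF f, of x] mean_value[OF h, of x] by simp_all
    have d: "series b f x - ?f2 x = 2 * (?f1 x - ?f2 x)" "series b h x - ?h2 x = 2 * (?h1 x - ?h2 x)"
      using mean_value[OF f, of x] mean_value[OF h, of x] by simp_all
    have "bellman q 0 (?f1 x) (?h1 x) \<le> 1/2 * bellman q 0 (?f2 x) (?h2 x)
      + 1/2 * bellman q 0 (series b f x) (series b h x) - 1/4 * (\<bar>series b f x - ?f2 x\<bar> * \<bar>series b h x - ?h2 x\<bar>)"
      using bellman_convex[OF q, of "1/2" "?f2 x" "series b f x" "?h2 x" "series b h x"]
      unfolding e[symmetric] by simp
    moreover have "bellman q 0 (series b f x) (series b h x) \<le> ?G x"
      using series_jensen[OF convex_bellman[OF q] _ sub_prob_b f h] tame_bellman[OF q f h] by simp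
    moreover have "\<bar>series b f x - ?f2 x\<bar> * \<bar>series b h x - ?h2 x\<bar> = 4 * ?D x"
      unfolding d abs_mult by (simp add: abs_minus_commute)
    ultimately show ?thesis by simp
  qed
  have tD: "tame ?D" using f h by (intro tame_mult tame_abs tame_diff T)
  have t1: "tame (?B ?f1 ?h1)" "tame (?B ?f2 ?h2)" "tame (?B f h)"
    using f h by (auto intro!: tame_bellman[OF q] T)
  note t2 = tame_series[OF sub_prob_b t1(3)]
  have "(LBINT x. 2 * ?B ?f1 ?h1 x) \<le> (LBINT x. ?B ?f2 ?h2 x + ?G x - 2 * ?D x)"
    by (intro integral_mono pw tame_integrable tame_cmult tame_diff tame_add t1 t2 tD)
  also have "\<dots> = (LBINT x. ?B ?f2 ?h2 x) + (LBINT x. ?G x) - 2 * (LBINT x. ?D x)"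
    using t1 t2 tD by (simp add: tame_integrable)
  also have "(LBINT x. ?G x) \<le> (LBINT x. ?B f h x)"
    by (rule integral_series_le[OF sub_prob_b t1(3)]) (rule bellman_nonneg[OF q(1)])
  finally show ?thesis by simp
qed

lemma bellman_decreasing:
  assumes q: "1 < q" "q \<le> 2" and f: "tame f" and h: "tame h"
  shows "(LBINT x. bellman q 0 (series a f x) (series a h x)) \<le> (LBINT x. bellman q 0 (f x) (h x))"
proof -
  let ?G = "\<lambda>x. bellman q 0 (f x) (h x)"
  have t: "tame ?G" by (rule tame_bellman[OF q f h])
  have "(LBINT x. bellman q 0 (series a f x) (series a h x)) \<le> (LBINT x. series a ?G x)"
    using series_jensen[OF convex_bellman[OF q] _ sub_prob_a f h] t f h
    by (intro integral_mono tame_integrable tame_bellman[OF q] tame_series sub_prob_a) auto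
  also have "\<dots> \<le> (LBINT x. ?G x)"
    by (rule integral_series_le[OF sub_prob_a t]) (rule bellman_nonneg[OF q(1)])
  finally show ?thesis .
qed

text \<open>The Bellman integrals \<open>F n\<close> are nonnegative and decreasing, and their
  second differences dominate twice the energies. The weight \<open>n\<close> is annihilated by
  second differences, so summation by parts leaves boundary terms only.\<close>

lemma energy_sum_le_aux:
  assumes q: "1 < q" "q \<le> 2" and f: "tame f" and h: "tame h"
  shows "(\<Sum>n\<le>N. real n * energy n f h)
    \<le> bellman_const q / 2 * ((LBINT x. \<bar>f x\<bar> powr (q / (q - 1))) + (LBINT x. \<bar>h x\<bar> powr q))"
proof -
  define F where "F n = (LBINT x. bellman q 0 (down n f x) (down n h x))" for n
  have F1: "2 * F (Suc n) \<le> F (Suc (Suc n)) + F n - 2 * energy (Suc n) f h" for n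
    using bellman_mean[OF q tame_down[OF f] tame_down[OF h], of n n] by (simp add: F_def energy_def down_Suc)
  have F2: "F (Suc n) \<le> F n" for n
    using bellman_decreasing[OF q tame_down[OF f] tame_down[OF h], of n n] by (simp add: F_def down_Suc)
  have F3: "0 \<le> F n" for n unfolding F_def by (simp add: bellman_nonneg q)
  \<comment> \<open>No second difference is available at \<open>n = 0\<close>, where the weight
    vanishes. The boundary terms at \<open>k\<close> are at most \<open>- F k\<close> by
    monotonicity, so only \<open>F 0\<close> survives.\<close>
  have "(\<Sum>n\<le>k. real n * (2 * energy n f h)) \<le> F 0 + real k * F (Suc k) - real (Suc k) * F k" for k
  proof (induction k)
    case (Suc k)
    have "real (Suc k) * (2 * energy (Suc k) f h) \<le> real (Suc k) * (F (Suc (Suc k)) + F k - 2 * F (Suc k))"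
      using F1[of k] by (intro mult_left_mono) auto
    with Suc show ?case by (simp add: algebra_simps)
  qed simp
  from this[of N] have "(\<Sum>n\<le>N. real n * (2 * energy n f h)) \<le> F 0"
    using mult_left_mono[OF F2[of N], of "real N"] F3[of N] by (simp add: algebra_simps)
  then have "(\<Sum>n\<le>N. real n * energy n f h) \<le> F 0 / 2"
    unfolding mult.left_commute[of _ 2] sum_distrib_left[symmetric] by simp
  also have "F 0 \<le> (LBINT x. bellman_const q * (\<bar>f x\<bar> powr (q / (q - 1)) + \<bar>h x\<bar> powr q))"
    unfolding F_def down_0 bellman_const_def using q f h
    by (intro integral_mono bellman_growth refl tame_integrable tame_bellman tame_cmult tame_add tame_powr)
      (auto simp: field_simps)
  also have "\<dots> = bellman_const q * ((LBINT x. \<bar>f x\<bar> powr (q / (q - 1))) + (LBINT x. \<bar>h x\<bar> powr q))"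
    using tame_integrable[OF tame_powr[OF f, of "q / (q - 1)"]] tame_integrable[OF tame_powr[OF h, of q]] q
    by (simp add: field_simps)
  finally show ?thesis by simp
qed

text \<open>The Bellman function wants the exponent of its second argument in (1, 2]. Of two
  conjugate exponents one is at most 2, and the energy is symmetric, so \<open>f\<close> and
  \<open>h\<close> exchange roles when \<open>p \<le> 2\<close>; the \<open>min\<close> in the
  constant records the choice.\<close>

lemma energy_sum_le:
  assumes p: "1 < p" and f: "tame f" and h: "tame h"
  shows "(\<Sum>n\<le>N. real n * energy n f h) \<le> bellman_const (min p (p / (p - 1))) / 2 *
    ((LBINT x. \<bar>f x\<bar> powr p) + (LBINT x. \<bar>h x\<bar> powr (p / (p - 1))))"
proof (cases "p \<le> 2")
  case True
  then have "p \<le> p / (p - 1)" using p by (simp add: field_simps mult_left_mono)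
  then show ?thesis
    using energy_sum_le_aux[OF p True h f, of N] by (simp add: energy_commute add.commute min_absorb1)
next
  case False
  let ?q = "p / (p - 1)"
  have q: "1 < ?q" "?q \<le> 2" "?q / (?q - 1) = p" using False p by (auto simp: field_simps)
  then have "?q \<le> p" using False by simp
  then show ?thesis using energy_sum_le_aux[OF q(1,2) f h, of N] unfolding q(3) by (simp add: min_absorb2)
qed

text \<open>The second difference is \<open>(1 - S)^2 S^(2 n)\<close>. The even power lets each of
  \<open>f\<close> and \<open>h\<close> receive one factor \<open>(1 - S) S^n\<close> in a
  pairing.\<close>

definition truncated :: "(nat \<Rightarrow> real) \<Rightarrow> nat \<Rightarrow> ('a \<Rightarrow> real) \<Rightarrow> 'a \<Rightarrow> real" where
  "truncated \<rho> N f x = (\<Sum>n\<le>N. \<rho> n * (down (2 * n) f x - 2 * down (2 * n + 1) f x + down (2 * n + 2) f x))"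

lemma tame_truncated: "tame f \<Longrightarrow> tame (truncated \<rho> N f)"
  unfolding truncated_def[abs_def] by (intro tame_sum tame_cmult tame_add tame_diff tame_down)

lemma continuous_truncated: "tame f \<Longrightarrow> continuous_on UNIV f \<Longrightarrow> continuous_on UNIV (truncated \<rho> N f)"
  unfolding truncated_def[abs_def] by (intro continuous_intros continuous_down)

text \<open>Self-adjointness moves \<open>(1 - S) S^n\<close> onto \<open>h\<close>, so every
  summand becomes a pairing of two increments at height \<open>n\<close>, which the energy
  dominates.\<close>

lemma truncated_pairing:
  assumes f: "tame f" and h: "tame h" and \<rho>: "\<And>n. \<bar>\<rho> n\<bar> \<le> R * real n"
  shows "\<bar>\<integral>x. truncated \<rho> N f x * h x \<partial>lborel\<bar> \<le> R * (\<Sum>n\<le>N. real n * energy n f h)"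
proof -
  let ?W = "\<lambda>n x. down (2 * n) f x - 2 * down (2 * n + 1) f x + down (2 * n + 2) f x"
  have i: "integrable lborel (\<lambda>x. down i f x * h x)" for i
    using f h by (intro tame_integrable tame_mult tame_down)
  have i2: "integrable lborel (\<lambda>x. down i f x * down j h x)" for i j
    using f h by (intro tame_integrable tame_mult tame_down)
  have i3: "integrable lborel (\<lambda>x. ?W n x * h x)" for n
    using f h by (intro tame_integrable tame_mult tame_down tame_add tame_diff tame_cmult)
  have s: "(LBINT x. down (i + j) f x * h x) = (LBINT x. down i f x * down j h x)" for i j
    by (rule down_add_symmetric[OF f h])
  have p: "(LBINT x. ?W n x * h x)
     = (LBINT x. (down (Suc n) f x - down n f x) * (down (Suc n) h x - down n h x))" for n
  proof -
    have s2: "(LBINT x. down n f x * down (Suc n) h x) = (LBINT x. down (Suc n) f x * down n h x)"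
      using s[of n "Suc n"] s[of "Suc n" n] by simp
    have e: "2 * n = n + n" "2 * n + 1 = n + Suc n" "2 * n + 2 = Suc n + Suc n" by simp_all
    have "(LBINT x. ?W n x * h x)
      = (LBINT x. down (n + n) f x * h x) - 2 * (LBINT x. down (n + Suc n) f x * h x)
        + (LBINT x. down (Suc n + Suc n) f x * h x)"
      unfolding e distrib_right left_diff_distrib mult.assoc using i by simp
    also have "\<dots> = (LBINT x. down n f x * down n h x) - (LBINT x. down n f x * down (Suc n) h x)
        - (LBINT x. down (Suc n) f x * down n h x) + (LBINT x. down (Suc n) f x * down (Suc n) h x)"
      unfolding s using s2 by simp
    also have "\<dots> = (LBINT x. (down (Suc n) f x - down n f x) * (down (Suc n) h x - down n h x))"
      unfolding left_diff_distrib right_diff_distrib using i2 by simp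
    finally show ?thesis .
  qed
  have "(LBINT x. truncated \<rho> N f x * h x) = (\<Sum>n\<le>N. \<rho> n * (LBINT x. ?W n x * h x))"
    unfolding truncated_def sum_distrib_right mult.assoc using i3
    by (subst Bochner_Integration.integral_sum) auto
  also have "\<bar>\<dots>\<bar> \<le> (\<Sum>n\<le>N. R * (real n * energy n f h))"
  proof (rule order_trans[OF sum_abs], rule sum_mono)
    fix n
    have "\<bar>\<integral>x. (down (Suc n) f x - down n f x) * (down (Suc n) h x - down n h x) \<partial>lborel\<bar> \<le> energy n f h"
      unfolding energy_def abs_mult[symmetric] by (rule integral_abs_bound)
    then have "\<bar>\<rho> n\<bar> * \<bar>\<integral>x. (down (Suc n) f x - down n f x) * (down (Suc n) h x - down n h x) \<partial>lborel\<bar>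
      \<le> (R * real n) * energy n f h"
      using \<rho>[of n] by (intro mult_mono) auto
    then show "\<bar>\<rho> n * (LBINT x. ?W n x * h x)\<bar> \<le> R * (real n * energy n f h)"
      unfolding p by (simp add: abs_mult mult.assoc)
  qed
  finally show ?thesis by (simp add: sum_distrib_left)
qed

text \<open>Duality: the image is tested against a multiple of its own
  \<open>sgn G * \<bar>G\<bar> powr (p - 1)\<close>. The energy bound is a sum of two integrals
  rather than a product of norms, so the multiple \<open>l\<close> is tuned until the contribution
  of the test function is half of the left-hand side and can be absorbed.\<close>

lemma truncated_Lp:
  assumes p: "1 < p" and R: "0 < R" and f: "tame f" and \<rho>: "\<And>n. \<bar>\<rho> n\<bar> \<le> R * real n"
  defines "C \<equiv> R * (bellman_const (min p (p / (p - 1))) / 2)"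
  shows "(LBINT x. \<bar>truncated \<rho> N f x\<bar> powr p) \<le> (2 * C) powr p * (LBINT x. \<bar>f x\<bar> powr p)"
proof -
  define q where "q = p / (p - 1)"
  have q: "1 < q" "q - 1 = 1 / (p - 1)" using p by (auto simp: q_def field_simps)
  \<comment> \<open>The solution of \<open>C * l powr q = l / 2\<close>.\<close>
  define l where "l = (2 * C) powr (1 - p)"
  have C: "0 < C" unfolding C_def using R p q(1)[unfolded q_def]
    by (intro mult_pos_pos divide_pos_pos bellman_const_pos) auto
  have l: "0 < l" using C by (simp add: l_def)
  define G where "G = truncated \<rho> N f"
  have G: "tame G" unfolding G_def by (rule tame_truncated[OF f])
  obtain M where M: "0 < M" "\<And>x. \<bar>G x\<bar> \<le> M" using tame_bound[OF G] by metis
  define X where "X k = (LBINT x. indicator (ball 0 (real k)) x * \<bar>G x\<bar> powr p)" for k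
  define Y where "Y = (LBINT x. \<bar>f x\<bar> powr p)"
  have "X k \<le> (2 * C) powr p * Y" for k
  proof -
    \<comment> \<open>The cut-off to a ball makes \<open>h\<close> tame: for \<open>p < 2\<close>
      the exponent \<open>p - 1\<close> is below 1, and \<open>\<bar>G\<bar> powr (p - 1)\<close>
      need not be integrable on the whole space.\<close>
    define h where "h x = l * (indicator (ball 0 (real k)) x * (sgn (G x) * \<bar>G x\<bar> powr (p - 1)))" for x
    have tind: "tame (indicat_real (ball (0::'a) (real k)))"
    proof (rule tameI[where M = 1])
      show "integrable lborel (indicat_real (ball (0::'a) (real k)))"
        by (rule integrable_indicator_bounded) auto
    qed (auto simp: indicator_def borel_measurable_indicator)
    have [measurable]: "G \<in> borel_measurable borel" by (rule tameD[OF G])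
    have [measurable]: "ball (0::'a) (real k) \<in> sets borel" by simp
    have hm: "h \<in> borel_measurable borel"
      unfolding h_def[abs_def] sgn_real_def by (intro borel_measurable_times borel_measurable_indicator) measurable
    have hb: "\<bar>h x\<bar> = l * (indicator (ball 0 (real k)) x * \<bar>G x\<bar> powr (p - 1))" for x
      using l by (auto simp: h_def abs_mult indicator_def abs_sgn_eq)
    have h: "tame h"
    proof (rule tame_dominated[OF hm tame_cmult[OF tind]])
      show "\<bar>h x\<bar> \<le> (l * M powr (p - 1)) * indicator (ball 0 (real k)) x" for x
        unfolding hb using l M p by (auto simp: indicator_def intro!: powr_mono2)
    qed
    have Gh: "G x * h x = l * (indicator (ball 0 (real k)) x * \<bar>G x\<bar> powr p)" for x
    proof (cases "G x = 0")
      case False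
      then have "\<bar>G x\<bar> powr p = \<bar>G x\<bar> powr (p - 1) * \<bar>G x\<bar>" by (simp add: powr_shift)
      moreover have "G x * sgn (G x) = \<bar>G x\<bar>" by (simp add: abs_sgn)
      ultimately show ?thesis by (simp add: h_def mult_ac)
    qed (simp add: h_def)
    have pq: "(p - 1) * q = p" using p by (simp add: q_def)
    have hq: "\<bar>h x\<bar> powr q = l powr q * (indicator (ball 0 (real k)) x * \<bar>G x\<bar> powr p)" for x
      unfolding hb using l by (auto simp: indicator_def powr_mult powr_powr pq)
    have "l * X k = (LBINT x. G x * h x)" unfolding Gh X_def by simp
    also have "\<dots> \<le> R * (\<Sum>n\<le>N. real n * energy n f h)"
      using truncated_pairing[OF f h \<rho>, of N] unfolding G_def by linarith
    also have "\<dots> \<le> R * (bellman_const (min p (p / (p - 1))) / 2 * (Y + (LBINT x. \<bar>h x\<bar> powr (p / (p - 1)))))"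
      unfolding Y_def using R by (intro mult_left_mono energy_sum_le p f h) auto
    also have "\<dots> = C * (Y + l powr q * X k)"
      unfolding q_def[symmetric] hq X_def C_def by simp
    finally have *: "l * X k \<le> C * Y + (C * l powr q) * X k" by (simp add: algebra_simps)
    have "l powr q = l * l powr (q - 1)" using powr_shift[OF l, of q] by (simp add: mult.commute)
    also have "l powr (q - 1) = 1 / (2 * C)"
    proof -
      have e: "(1 - p) * (1 / (p - 1)) = - 1" using p by (simp add: field_simps)
      show ?thesis unfolding l_def q powr_powr e using C by (simp add: powr_minus_divide)
    qed
    finally have "C * l powr q = l / 2" using l C by simp
    with * have "l * X k \<le> 2 * (C * Y)" by simp
    then have "X k \<le> 2 * C / l * Y" using l by (simp add: field_simps)
    also have "2 * C / l = (2 * C) powr 1 / (2 * C) powr (1 - p)" using C by (simp add: l_def)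
    also have "\<dots> = (2 * C) powr p" unfolding powr_diff[symmetric] by simp
    finally show ?thesis .
  qed
  moreover have "X \<longlonglongrightarrow> (LBINT x. \<bar>G x\<bar> powr p)"
    unfolding X_def
  proof (rule integral_dominated_convergence)
    show "integrable lborel (\<lambda>x. \<bar>G x\<bar> powr p)" using p by (intro tame_integrable tame_powr G) auto
    have [measurable]: "G \<in> borel_measurable borel" by (rule tameD[OF G])
    show "(\<lambda>x. \<bar>G x\<bar> powr p) \<in> borel_measurable lborel" by measurable
    have [measurable]: "ball (0::'a) (real k) \<in> sets borel" for k by simp
    show "(\<lambda>x. indicator (ball 0 (real k)) x * \<bar>G x\<bar> powr p) \<in> borel_measurable lborel" for k
      by measurable
    show "AE x in lborel. (\<lambda>k. indicator (ball 0 (real k)) x * \<bar>G x\<bar> powr p) \<longlonglongrightarrow> \<bar>G x\<bar> powr p"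
    proof (intro AE_I2)
      fix x :: 'a
      obtain k0 where "norm x < real k0" using reals_Archimedean2 by blast
      then have "\<forall>\<^sub>F k in sequentially. indicator (ball 0 (real k)) x * \<bar>G x\<bar> powr p = \<bar>G x\<bar> powr p"
        by (intro eventually_sequentiallyI[of k0]) (auto simp: indicator_def)
      then show "(\<lambda>k. indicator (ball 0 (real k)) x * \<bar>G x\<bar> powr p) \<longlonglongrightarrow> \<bar>G x\<bar> powr p"
        by (rule tendsto_eventually)
    qed
  qed (auto simp: indicator_def)
  ultimately show ?thesis unfolding G_def[symmetric] Y_def[symmetric]
    by (intro LIMSEQ_le_const2) auto
qed

end

section \<open>Plancherel\<close>

lemma lborel_integral_affine:
  fixes f :: "'a::euclidean_space \<Rightarrow> 'b::{banach, second_countable_topology}"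
  assumes f: "f \<in> borel_measurable borel" and c: "c \<noteq> 0"
  shows "(LBINT x. f x) = \<bar>c\<bar> ^ DIM('a) *\<^sub>R (LBINT x. f (t + c *\<^sub>R x))"
  using f by (subst lborel_affine[OF c, of t]) (simp add: integral_density integral_distr)

lemma lborel_integrable_affine:
  fixes f :: "'a::euclidean_space \<Rightarrow> 'b::{banach, second_countable_topology}"
  assumes f: "integrable lborel f" and c: "c \<noteq> 0"
  shows "integrable lborel (\<lambda>x. f (t + c *\<^sub>R x))"
proof -
  have m: "f \<in> borel_measurable borel" using f by auto
  have "integrable (density (distr lborel borel (\<lambda>x. t + c *\<^sub>R x)) (\<lambda>_. ennreal (\<bar>c\<bar> ^ DIM('a)))) f"
    using f lborel_affine[OF c, of t] by simp
  then have "integrable lborel (\<lambda>x. \<bar>c\<bar> ^ DIM('a) *\<^sub>R f (t + c *\<^sub>R x))"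
    using m by (simp add: integrable_density integrable_distr_eq)
  from integrable_scaleR_right[OF this, of "inverse (\<bar>c\<bar> ^ DIM('a))"] show ?thesis using c by simp
qed

lemma sum_Basis_sq: "(\<Sum>b\<in>Basis. (x \<bullet> b)\<^sup>2) = (norm x)\<^sup>2" for x :: "'a::euclidean_space"
  unfolding power2_norm_eq_inner euclidean_inner[of x x] by (simp add: power2_eq_square)

text \<open>The standard normal density; as a product over the axes, its Fourier integral reduces to
  the one-dimensional characteristic function.\<close>

definition gauss :: "'a::euclidean_space \<Rightarrow> real" where
  "gauss x = (\<Prod>b\<in>Basis. std_normal_density (x \<bullet> b))"

lemma gauss_nonneg: "0 \<le> gauss x"
  by (simp add: gauss_def prod_nonneg normal_density_nonneg)

lemma gauss_eq: "gauss (x :: 'a::euclidean_space) = (1 / sqrt (2 * pi)) ^ DIM('a) * exp (- (norm x)\<^sup>2 / 2)"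
proof -
  have "gauss x = (1 / sqrt (2 * pi)) ^ DIM('a) * exp (\<Sum>b\<in>Basis. - (x \<bullet> b)\<^sup>2 / 2)"
    by (simp add: gauss_def std_normal_density_def prod.distrib exp_sum prod_dividef power_divide)
  also have "(\<Sum>b\<in>Basis. - (x \<bullet> b)\<^sup>2 / 2) = - (norm x)\<^sup>2 / 2"
    by (simp add: sum_Basis_sq[symmetric] sum_negf sum_divide_distrib)
  finally show ?thesis .
qed

lemma gauss_measurable [measurable]: "gauss \<in> borel_measurable borel"
  unfolding gauss_eq[abs_def] by measurable

lemma lborel_integral_prod_Basis:
  fixes f :: "'a::euclidean_space \<Rightarrow> real \<Rightarrow> complex"
  assumes f: "\<And>b. b \<in> Basis \<Longrightarrow> integrable lborel (f b)"
  shows "integrable lborel (\<lambda>x. \<Prod>b\<in>Basis. f b (x \<bullet> b))"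
    and "(LBINT x. (\<Prod>b\<in>Basis. f b (x \<bullet> b))) = (\<Prod>b\<in>Basis. \<integral>x. f b x \<partial>lborel)"
proof -
  interpret product_sigma_finite "\<lambda>_::'a. lborel :: real measure" ..
  have m: "(\<lambda>x::'a. \<Prod>b\<in>Basis. f b (x \<bullet> b)) \<in> borel_measurable borel"
  proof (rule borel_measurable_prod)
    fix b :: 'a assume "b \<in> Basis"
    then have "f b \<in> borel_measurable borel" using f by auto
    then show "(\<lambda>x. f b (x \<bullet> b)) \<in> borel_measurable borel"
      by (rule measurable_compose[rotated]) simp
  qed
  have e: "(\<Prod>b\<in>Basis. f b ((\<Sum>b'\<in>Basis. x b' *\<^sub>R b') \<bullet> b)) = (\<Prod>b\<in>Basis. f b (x b))" for x :: "'a \<Rightarrow> real"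
    by (intro prod.cong refl) simp
  have L: "(lborel :: 'a measure) = distr (\<Pi>\<^sub>M b\<in>Basis. lborel) borel (\<lambda>f. \<Sum>b\<in>Basis. f b *\<^sub>R b)"
    by (rule lborel_eq)
  have mm: "(\<lambda>f. \<Sum>b\<in>Basis. f b *\<^sub>R b) \<in> (\<Pi>\<^sub>M b\<in>Basis. lborel) \<rightarrow>\<^sub>M (borel :: 'a measure)"
    by measurable
  show "integrable lborel (\<lambda>x. \<Prod>b\<in>Basis. f b (x \<bullet> b))"
    unfolding L integrable_distr_eq[OF mm m] e using f by (intro product_integrable_prod) auto
  show "(LBINT x. (\<Prod>b\<in>Basis. f b (x \<bullet> b))) = (\<Prod>b\<in>Basis. \<integral>x. f b x \<partial>lborel)"
    unfolding L integral_distr[OF mm m] e using f by (intro product_integral_prod) auto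
qed

lemma std_normal_fourier: "(LBINT x. std_normal_density x *\<^sub>R cis (t * x)) = of_real (exp (- t\<^sup>2 / 2))"
proof -
  have "char std_normal_distribution t = (LBINT x. std_normal_density x *\<^sub>R iexp (t * x))"
    unfolding char_def by (subst integral_density) (auto simp: normal_density_nonneg)
  then show ?thesis by (simp add: char_std_normal_distribution cis_conv_exp)
qed

lemma gauss_fourier:
  fixes t :: "'a::euclidean_space"
  shows "(LBINT x. gauss x *\<^sub>R cis (t \<bullet> x)) = of_real (sqrt (2 * pi) ^ DIM('a) * gauss t)"
    and "integrable lborel (gauss :: 'a \<Rightarrow> real)" and "(LBINT x. gauss (x :: 'a)) = 1"
proof -
  define f where "f t b x = std_normal_density x *\<^sub>R cis ((t \<bullet> b) * x)" for t b :: 'a and x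
  have i: "integrable lborel (f t b)" for t b
    unfolding f_def
  proof (rule integrable_bound'[OF integrable_normal_density[of 1 0]])
    have "(\<lambda>x. cis ((t \<bullet> b) * x)) \<in> borel_measurable borel"
      by (intro borel_measurable_continuous_onI continuous_intros)
    then show "(\<lambda>x. std_normal_density x *\<^sub>R cis ((t \<bullet> b) * x)) \<in> borel_measurable lborel" by simp
  qed (auto simp: normal_density_nonneg)
  have e: "(\<Prod>b\<in>Basis. f t b (x \<bullet> b)) = gauss x *\<^sub>R cis (t \<bullet> x)" for t x
  proof -
    have "(\<Prod>b\<in>Basis. f t b (x \<bullet> b)) = of_real (gauss x) * (\<Prod>b\<in>Basis. cis ((t \<bullet> b) * (x \<bullet> b)))"
      by (simp add: f_def gauss_def scaleR_conv_of_real prod.distrib)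
    also have "(\<Prod>b\<in>Basis. cis ((t \<bullet> b) * (x \<bullet> b))) = cis (t \<bullet> x)"
      by (simp add: cis_conv_exp exp_sum[symmetric] euclidean_inner[of t x] sum_distrib_left)
    finally show ?thesis by (simp add: scaleR_conv_of_real)
  qed
  have g: "(LBINT x. gauss x *\<^sub>R cis (t \<bullet> x)) = of_real (exp (- (norm t)\<^sup>2 / 2))" for t :: 'a
  proof -
    have "(LBINT x. gauss x *\<^sub>R cis (t \<bullet> x)) = (\<Prod>b\<in>Basis. of_real (exp (- (t \<bullet> b)\<^sup>2 / 2)))"
      using lborel_integral_prod_Basis(2)[of "f t", OF i] unfolding e by (simp add: f_def std_normal_fourier)
    also have "\<dots> = of_real (exp (\<Sum>b\<in>Basis. - (t \<bullet> b)\<^sup>2 / 2))" by (simp add: exp_sum)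
    also have "(\<Sum>b\<in>Basis. - (t \<bullet> b)\<^sup>2 / 2) = - (norm t)\<^sup>2 / 2"
      by (simp add: sum_Basis_sq[symmetric] sum_negf sum_divide_distrib)
    finally show ?thesis .
  qed
  show "(LBINT x. gauss x *\<^sub>R cis (t \<bullet> x)) = of_real (sqrt (2 * pi) ^ DIM('a) * gauss t)"
    unfolding g by (simp add: gauss_eq power_divide)
  have "integrable lborel (\<lambda>x::'a. norm (gauss x *\<^sub>R cis (0 \<bullet> x)))"
    using lborel_integral_prod_Basis(1)[of "f 0", OF i] unfolding e by (rule integrable_norm)
  then show "integrable lborel (gauss :: 'a \<Rightarrow> real)" by (simp add: gauss_nonneg)
  have "complex_of_real (LBINT x. gauss (x :: 'a)) = 1"
    using g[of 0] by (simp add: scaleR_conv_of_real)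
  then show "(LBINT x. gauss (x :: 'a)) = 1" by (simp only: of_real_eq_1_iff)
qed

text \<open>An integral against \<open>lborel\<close>, where Fubini's theorem and changes of
  variables apply directly; on Borel functions it agrees with
  \<open>fourier_transform\<close>.\<close>

definition ft :: "('a::euclidean_space \<Rightarrow> complex) \<Rightarrow> 'a \<Rightarrow> complex" where
  "ft g \<xi> = (LBINT x. g x * cis (\<xi> \<bullet> x))"

lemma cis_measurable [measurable]:
  "(\<lambda>x. cis (\<xi> \<bullet> x)) \<in> borel_measurable borel"
  by (intro borel_measurable_continuous_onI continuous_intros)

lemma cis_measurable_pair [measurable]:
  "(\<lambda>(x, y). cis (x \<bullet> y)) \<in> borel_measurable (borel \<Otimes>\<^sub>M (borel :: 'a::euclidean_space measure))"
  unfolding borel_prod case_prod_unfold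
  by (intro borel_measurable_continuous_onI continuous_intros)

lemma integrable_mult_cis:
  assumes "integrable lborel g" shows "integrable lborel (\<lambda>x. g x * cis (\<xi> \<bullet> x))"
  by (rule integrable_bound'[OF assms]) (use assms in \<open>auto simp: norm_mult\<close>)

lemma ft_measurable [measurable]:
  assumes [measurable]: "g \<in> borel_measurable borel" shows "ft g \<in> borel_measurable borel"
proof -
  have [measurable]: "(\<lambda>p::'a \<times> 'a. cis (fst p \<bullet> snd p)) \<in> borel_measurable (borel \<Otimes>\<^sub>M borel)"
    using cis_measurable_pair by (simp add: case_prod_unfold)
  have "(\<lambda>\<xi>. \<integral>x. g x * cis (\<xi> \<bullet> x) \<partial>lborel) \<in> borel_measurable borel"
    by (rule lborel.borel_measurable_lebesgue_integral) (simp add: case_prod_unfold)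
  then show ?thesis by (simp add: ft_def[abs_def])
qed

lemma ft_bound:
  assumes "integrable lborel g" shows "norm (ft g \<xi>) \<le> (LBINT x. norm (g x))"
  unfolding ft_def using integral_norm_bound[of lborel "\<lambda>x. g x * cis (\<xi> \<bullet> x)"] by (simp add: norm_mult)

text \<open>The convolution of \<open>g\<close> with its reflected conjugate. Its transform is the
  squared modulus of \<open>ft g\<close> and its value at 0 is the squared L2 norm of
  \<open>g\<close>, so Plancherel's formula is Fourier inversion of this function at 0.\<close>

definition autocorrelation :: "('a::euclidean_space \<Rightarrow> complex) \<Rightarrow> 'a \<Rightarrow> complex" where
  "autocorrelation g z = (LBINT x. g x * cnj (g (x - z)))"

lemma autocorrelation_fourier:
  fixes g :: "'a::euclidean_space \<Rightarrow> complex"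
  assumes g: "integrable lborel g"
  shows "integrable lborel (autocorrelation g)" and "ft (autocorrelation g) \<xi> = of_real ((norm (ft g \<xi>))\<^sup>2)"
proof -
  have [measurable]: "g \<in> borel_measurable borel" using g by auto
  have [measurable]: "cnj \<in> borel_measurable borel"
    by (intro borel_measurable_continuous_onI continuous_intros)
  have gr: "integrable lborel (\<lambda>z. cnj (g (x - z)))" for x
    using lborel_integrable_affine[OF g, of "-1" x] by simp
  have gn: "(LBINT z. norm (g (x - z))) = (LBINT z. norm (g z))" for x
    using lborel_integral_affine[of "\<lambda>z. norm (g z)" "-1" x] by simp
  have int: "integrable (lborel \<Otimes>\<^sub>M lborel) (\<lambda>(x, z). g x * cnj (g (x - z)) * cis (\<xi> \<bullet> z))" for \<xi>
  proof (rule lborel_pair.Fubini_integrable)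
    show "(\<lambda>(x, z). g x * cnj (g (x - z)) * cis (\<xi> \<bullet> z)) \<in> borel_measurable (lborel \<Otimes>\<^sub>M lborel)"
      by measurable
    show "integrable lborel (\<lambda>x. \<integral>z. norm (case (x, z) of (x, z) \<Rightarrow> g x * cnj (g (x - z)) * cis (\<xi> \<bullet> z)) \<partial>lborel)"
      using g by (simp add: norm_mult gn)
    show "AE x in lborel. integrable lborel (\<lambda>z. case (x, z) of (x, z) \<Rightarrow> g x * cnj (g (x - z)) * cis (\<xi> \<bullet> z))"
      using integrable_mult_cis[OF gr] by (simp add: mult.assoc)
  qed
  have int0: "integrable (lborel \<Otimes>\<^sub>M lborel) (\<lambda>(x, z). g x * cnj (g (x - z)))"
    using int[of 0] by simp
  show "integrable lborel (autocorrelation g)"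
    unfolding autocorrelation_def[abs_def] using lborel_pair.integrable_snd[OF int0] by simp
  have "ft (autocorrelation g) \<xi> = (LBINT z. (LBINT x. g x * cnj (g (x - z)) * cis (\<xi> \<bullet> z)))"
    unfolding ft_def autocorrelation_def by simp
  also have "\<dots> = (LBINT x. (LBINT z. g x * cnj (g (x - z)) * cis (\<xi> \<bullet> z)))"
    using lborel_pair.Fubini_integral[OF int[of \<xi>]] by simp
  also have "\<dots> = (LBINT x. g x * cis (\<xi> \<bullet> x) * cnj (ft g \<xi>))"
  proof (rule Bochner_Integration.integral_cong[OF refl])
    fix x
    have "(LBINT z. cnj (g (x - z)) * cis (\<xi> \<bullet> z)) = (LBINT y. cnj (g y) * cis (\<xi> \<bullet> (x - y)))"
    proof -
      have [measurable]: "(\<lambda>y. cis (\<xi> \<bullet> (x - y))) \<in> borel_measurable borel"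
        by (intro borel_measurable_continuous_onI continuous_intros)
      show ?thesis
        using lborel_integral_affine[of "\<lambda>y. cnj (g y) * cis (\<xi> \<bullet> (x - y))" "-1" x] by simp
    qed
    also have "\<dots> = (LBINT y. cis (\<xi> \<bullet> x) * cnj (g y * cis (\<xi> \<bullet> y)))"
      by (simp add: inner_diff_right cis_cnj cis_mult[symmetric] cis_divide[symmetric] divide_inverse mult_ac)
    also have "\<dots> = cis (\<xi> \<bullet> x) * cnj (ft g \<xi>)"
      unfolding ft_def integral_mult_right_zero
      using integral_bounded_linear'[OF bounded_linear_cnj bounded_linear_cnj, of lborel "\<lambda>y. g y * cis (\<xi> \<bullet> y)"] by simp
    finally show "(LBINT z. g x * cnj (g (x - z)) * cis (\<xi> \<bullet> z)) = g x * cis (\<xi> \<bullet> x) * cnj (ft g \<xi>)"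
      by (simp add: mult.assoc)
  qed
  also have "\<dots> = ft g \<xi> * cnj (ft g \<xi>)" unfolding ft_def by simp
  finally show "ft (autocorrelation g) \<xi> = of_real ((norm (ft g \<xi>))\<^sup>2)"
    by (simp only: complex_norm_square)
qed

lemma autocorrelation_bound:
  fixes g :: "'a::euclidean_space \<Rightarrow> complex"
  assumes [measurable]: "g \<in> borel_measurable borel" and g2: "integrable lborel (\<lambda>x. (norm (g x))\<^sup>2)"
  shows "norm (autocorrelation g z) \<le> (LBINT x. (norm (g x))\<^sup>2)"
proof -
  let ?h = "\<lambda>x. ((norm (g x))\<^sup>2 + (norm (g (x - z)))\<^sup>2) / 2"
  have g2z: "integrable lborel (\<lambda>x. (norm (g (x - z)))\<^sup>2)"
    using lborel_integrable_affine[OF g2, of 1 "- z"] by simp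
  have "(LBINT x. (norm (g (x - z)))\<^sup>2) = (LBINT x. (norm (g x))\<^sup>2)"
    using lborel_integral_affine[of "\<lambda>x. (norm (g x))\<^sup>2" 1 "- z"] by simp
  then have h: "(LBINT x. ?h x) = (LBINT x. (norm (g x))\<^sup>2)" using g2 g2z by simp
  have "norm (autocorrelation g z) \<le> (LBINT x. norm (g x * cnj (g (x - z))))"
    unfolding autocorrelation_def by (rule integral_norm_bound)
  also have "\<dots> \<le> (LBINT x. ?h x)"
  proof (rule integral_mono')
    show "integrable lborel ?h" using g2 g2z by simp
    show "norm (g x * cnj (g (x - z))) \<le> ?h x" for x
      using sum_squares_bound[of "norm (g x)" "norm (g (x - z))"] by (simp add: norm_mult)
  qed simp
  finally show ?thesis unfolding h .
qed

text \<open>Fourier inversion of the autocorrelation at 0, regularised by a Gaussian weight. The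
  transform of a Gaussian is again Gaussian, so Fubini's theorem turns the weighted integral into an
  average of the autocorrelation at scale \<open>e\<close>.\<close>

lemma weighted_plancherel:
  fixes g :: "'a::euclidean_space \<Rightarrow> complex"
  assumes g: "integrable lborel g" and e: "0 < e"
  shows "integrable lborel (\<lambda>\<xi>. (norm (ft g \<xi>))\<^sup>2 * exp (- (norm (e *\<^sub>R \<xi>))\<^sup>2 / 2))"
    and "of_real (LBINT \<xi>. (norm (ft g \<xi>))\<^sup>2 * exp (- (norm (e *\<^sub>R \<xi>))\<^sup>2 / 2))
    = of_real ((2 * pi) ^ DIM('a)) * (LBINT s. autocorrelation g (e *\<^sub>R s) * of_real (gauss s))"
proof -
  have [measurable]: "g \<in> borel_measurable borel" using g by auto
  define H where "H = autocorrelation g"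
  have H: "integrable lborel H" unfolding H_def by (rule autocorrelation_fourier[OF g])
  have [measurable]: "H \<in> borel_measurable borel" using H by auto
  define c where "c = sqrt (2 * pi) ^ DIM('a)"
  have c: "0 < c" by (simp add: c_def)
  have cc: "c * c = (2 * pi) ^ DIM('a)" unfolding c_def power_mult_distrib[symmetric] by simp
  have ge: "exp (- (norm x)\<^sup>2 / 2) = c * gauss x" for x :: 'a by (simp add: gauss_eq c_def power_divide)
  let ?g = "\<lambda>\<xi>::'a. gauss (e *\<^sub>R \<xi>)"
  have gi: "integrable lborel ?g"
    using lborel_integrable_affine[OF gauss_fourier(2), of e 0] e by simp
  show "integrable lborel (\<lambda>\<xi>. (norm (ft g \<xi>))\<^sup>2 * exp (- (norm (e *\<^sub>R \<xi>))\<^sup>2 / 2))"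
    unfolding ge
  proof (rule integrable_bound')
    show "integrable lborel (\<lambda>\<xi>. (LBINT x. norm (g x))\<^sup>2 * (c * ?g \<xi>))" using gi by simp
    show "(\<lambda>\<xi>. (norm (ft g \<xi>))\<^sup>2 * (c * gauss (e *\<^sub>R \<xi>))) \<in> borel_measurable lborel" by measurable
    show "AE x in lborel. norm ((cmod (ft g x))\<^sup>2 * (c * gauss (e *\<^sub>R x))) \<le> norm ((LBINT x. norm (g x))\<^sup>2 * (c * gauss (e *\<^sub>R x)))"
      using ft_bound[OF g] c gauss_nonneg by (intro AE_I2) (auto simp: abs_mult intro!: mult_right_mono power_mono)
  qed
  have int: "integrable (lborel \<Otimes>\<^sub>M lborel) (\<lambda>(\<xi>, z). of_real (?g \<xi>) * (H z * cis (\<xi> \<bullet> z)))"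
  proof (rule lborel_pair.Fubini_integrable)
    have [measurable]: "(\<lambda>p::'a \<times> 'a. cis (fst p \<bullet> snd p)) \<in> borel_measurable (borel \<Otimes>\<^sub>M borel)"
      using cis_measurable_pair by (simp add: case_prod_unfold)
    show "(\<lambda>(\<xi>, z). of_real (?g \<xi>) * (H z * cis (\<xi> \<bullet> z))) \<in> borel_measurable (lborel \<Otimes>\<^sub>M lborel)"
      by (simp add: case_prod_unfold)
    show "integrable lborel (\<lambda>x. \<integral>z. norm (case (x, z) of (\<xi>, z) \<Rightarrow> of_real (?g \<xi>) * (H z * cis (\<xi> \<bullet> z))) \<partial>lborel)"
      using gi H by (simp add: norm_mult)
    show "AE x in lborel. integrable lborel (\<lambda>z. case (x, z) of (\<xi>, z) \<Rightarrow> of_real (?g \<xi>) * (H z * cis (\<xi> \<bullet> z)))"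
      using integrable_mult_cis[OF H] by simp
  qed
  have inner: "(LBINT \<xi>. of_real (?g \<xi>) * cis (\<xi> \<bullet> z)) = of_real (inverse e ^ DIM('a) * c * gauss (inverse e *\<^sub>R z))" for z
  proof -
    have m: "(\<lambda>x. gauss x *\<^sub>R cis ((inverse e *\<^sub>R z) \<bullet> x)) \<in> borel_measurable borel" by measurable
    have "of_real (c * gauss (inverse e *\<^sub>R z)) = e ^ DIM('a) *\<^sub>R (LBINT \<xi>. ?g \<xi> *\<^sub>R cis ((inverse e *\<^sub>R z) \<bullet> (e *\<^sub>R \<xi>)))"
      using gauss_fourier(1)[of "inverse e *\<^sub>R z"] lborel_integral_affine[OF m, of e 0] e by (simp add: c_def)
    also have "(\<lambda>\<xi>. ?g \<xi> *\<^sub>R cis ((inverse e *\<^sub>R z) \<bullet> (e *\<^sub>R \<xi>))) = (\<lambda>\<xi>. of_real (?g \<xi>) * cis (\<xi> \<bullet> z))"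
      using e by (simp add: fun_eq_iff scaleR_conv_of_real inner_commute mult.assoc[symmetric])
    finally show ?thesis using e by (simp add: scaleR_conv_of_real field_simps)
  qed
  have "of_real (LBINT \<xi>. (norm (ft g \<xi>))\<^sup>2 * exp (- (norm (e *\<^sub>R \<xi>))\<^sup>2 / 2))
    = (LBINT \<xi>. of_real c * (of_real (?g \<xi>) * ft H \<xi>))"
    unfolding ge H_def autocorrelation_fourier(2)[OF g] integral_complex_of_real[symmetric]
    by (simp add: mult_ac)
  also have "\<dots> = of_real c * (LBINT \<xi>. (LBINT z. of_real (?g \<xi>) * (H z * cis (\<xi> \<bullet> z))))"
    unfolding ft_def by simp
  also have "\<dots> = of_real c * (LBINT z. (LBINT \<xi>. of_real (?g \<xi>) * (H z * cis (\<xi> \<bullet> z))))"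
    using lborel_pair.Fubini_integral[OF int] by simp
  also have "(\<lambda>z. \<integral>\<xi>. of_real (?g \<xi>) * (H z * cis (\<xi> \<bullet> z)) \<partial>lborel)
     = (\<lambda>z. H z * of_real (inverse e ^ DIM('a) * c * gauss (inverse e *\<^sub>R z)))"
    unfolding mult.left_commute[of "of_real _" "H _"] by (simp add: inner fun_eq_iff)
  also have "(LBINT z. H z * of_real (inverse e ^ DIM('a) * c * gauss (inverse e *\<^sub>R z)))
     = e ^ DIM('a) *\<^sub>R (LBINT s. H (e *\<^sub>R s) * of_real (inverse e ^ DIM('a) * c * gauss s))"
    using lborel_integral_affine[of "\<lambda>z. H z * of_real (inverse e ^ DIM('a) * c * gauss (inverse e *\<^sub>R z))" e 0] e
    by simp
  also have "\<dots> = of_real c * (LBINT s. H (e *\<^sub>R s) * of_real (gauss s))"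
    using e by (simp add: scaleR_conv_of_real mult.left_commute[of "H _"] power_inverse)
  finally show "of_real (LBINT \<xi>. (norm (ft g \<xi>))\<^sup>2 * exp (- (norm (e *\<^sub>R \<xi>))\<^sup>2 / 2))
    = of_real ((2 * pi) ^ DIM('a)) * (LBINT s. autocorrelation g (e *\<^sub>R s) * of_real (gauss s))"
    unfolding H_def cc[symmetric] by (simp add: mult.assoc)
qed

text \<open>As \<open>e\<close> decreases to 0 the Gaussian weights increase to 1, so monotone
  convergence together with the bound of the autocorrelation by the squared L2 norm suffices. This
  inequality is what the discontinuous truncations to balls rely on later.\<close>

lemma plancherel_le:
  fixes g :: "'a::euclidean_space \<Rightarrow> complex"
  assumes g: "integrable lborel g" and g2: "integrable lborel (\<lambda>x. (norm (g x))\<^sup>2)"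
  shows "integrable lborel (\<lambda>\<xi>. (norm (ft g \<xi>))\<^sup>2)"
    and "(LBINT \<xi>. (norm (ft g \<xi>))\<^sup>2) \<le> (2 * pi) ^ DIM('a) * (LBINT x. (norm (g x))\<^sup>2)"
    and "(\<lambda>n. \<integral>\<xi>. (norm (ft g \<xi>))\<^sup>2 * exp (- (norm (inverse (real (Suc n)) *\<^sub>R \<xi>))\<^sup>2 / 2) \<partial>lborel)
       \<longlonglongrightarrow> (LBINT \<xi>. (norm (ft g \<xi>))\<^sup>2)"
proof -
  have [measurable]: "g \<in> borel_measurable borel" using g by auto
  define A where "A = (2 * pi) ^ DIM('a) * (LBINT x. (norm (g x))\<^sup>2)"
  define f where "f n \<xi> = (norm (ft g \<xi>))\<^sup>2 * exp (- (norm (inverse (real (Suc n)) *\<^sub>R \<xi>))\<^sup>2 / 2)" for n \<xi>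
  have fi: "integrable lborel (f n)" for n
    unfolding f_def by (rule weighted_plancherel(1)[OF g]) simp
  have fle: "(LBINT \<xi>. f n \<xi>) \<le> A" for n
  proof -
    define e where "e = inverse (real (Suc n))"
    have e: "0 < e" by (simp add: e_def)
    have "norm (LBINT s. autocorrelation g (e *\<^sub>R s) * of_real (gauss s))
      \<le> (LBINT s. norm (autocorrelation g (e *\<^sub>R s) * of_real (gauss s)))" by (rule integral_norm_bound)
    also have "\<dots> \<le> (LBINT s. (LBINT x. (norm (g x))\<^sup>2) * gauss (s::'a))"
      using gauss_fourier(2) by (intro integral_mono')
        (auto simp: norm_mult gauss_nonneg intro!: mult_right_mono autocorrelation_bound g2)
    also have "\<dots> = (LBINT x. (norm (g x))\<^sup>2)" by (simp add: gauss_fourier(3))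
    finally have "norm (complex_of_real (LBINT \<xi>. f n \<xi>)) \<le> A"
      unfolding f_def e_def[symmetric] weighted_plancherel(2)[OF g e] norm_mult A_def norm_of_real
      by (intro mult_mono) auto
    then show ?thesis by simp
  qed
  have mono: "mono (\<lambda>n. f n \<xi>)" for \<xi>
    unfolding f_def by (intro monoI mult_left_mono) (auto intro!: power_mono divide_right_mono mult_right_mono)
  have lim: "(\<lambda>n. f n \<xi>) \<longlonglongrightarrow> (norm (ft g \<xi>))\<^sup>2" for \<xi>
  proof -
    have "(\<lambda>n. (norm (ft g \<xi>))\<^sup>2 * exp (- (norm (inverse (real (Suc n)) *\<^sub>R \<xi>))\<^sup>2 / 2))
      \<longlonglongrightarrow> (norm (ft g \<xi>))\<^sup>2 * exp (- (norm (0 *\<^sub>R \<xi>))\<^sup>2 / 2)"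
      by (intro tendsto_intros LIMSEQ_inverse_real_of_nat) simp
    then show ?thesis by (simp add: f_def)
  qed
  have minc: "incseq (\<lambda>n. \<integral>\<xi>. f n \<xi> \<partial>lborel)"
    using mono fi by (auto simp: incseq_def mono_def intro!: integral_mono)
  obtain L where L: "(\<lambda>n. \<integral>\<xi>. f n \<xi> \<partial>lborel) \<longlonglongrightarrow> L"
    using incseq_convergent[OF minc] fle by blast
  have u: "(\<lambda>\<xi>. (norm (ft g \<xi>))\<^sup>2) \<in> borel_measurable lborel" by measurable
  show "integrable lborel (\<lambda>\<xi>. (norm (ft g \<xi>))\<^sup>2)"
    by (rule integrable_monotone_convergence[OF fi _ _ L u]) (use mono lim in auto)
  have eq: "(LBINT \<xi>. (norm (ft g \<xi>))\<^sup>2) = L"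
    by (rule integral_monotone_convergence[OF fi _ _ L u]) (use mono lim in auto)
  show "(\<lambda>n. \<integral>\<xi>. (norm (ft g \<xi>))\<^sup>2 * exp (- (norm (inverse (real (Suc n)) *\<^sub>R \<xi>))\<^sup>2 / 2) \<partial>lborel)
       \<longlonglongrightarrow> (LBINT \<xi>. (norm (ft g \<xi>))\<^sup>2)"
    using L unfolding eq f_def .
  show "(LBINT \<xi>. (norm (ft g \<xi>))\<^sup>2) \<le> (2 * pi) ^ DIM('a) * (LBINT x. (norm (g x))\<^sup>2)"
    unfolding eq A_def[symmetric] using L fle by (intro LIMSEQ_le_const2) auto
qed

text \<open>For equality the Gaussian averages of the autocorrelation have to converge to its value
  at 0; for continuous bounded \<open>g\<close> this follows by dominated convergence. This is why
  continuity is carried along for all the operators above.\<close>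

lemma plancherel_eq:
  fixes g :: "'a::euclidean_space \<Rightarrow> complex"
  assumes g: "integrable lborel g" and c: "continuous_on UNIV g" and b: "\<And>x. norm (g x) \<le> M"
  shows "integrable lborel (\<lambda>x. (norm (g x))\<^sup>2)"
    and "(LBINT \<xi>. (norm (ft g \<xi>))\<^sup>2) = (2 * pi) ^ DIM('a) * (LBINT x. (norm (g x))\<^sup>2)"
proof -
  have [measurable]: "g \<in> borel_measurable borel" using g by auto
  have M: "0 \<le> M" using b[of 0] norm_ge_zero order_trans by blast
  show g2: "integrable lborel (\<lambda>x. (norm (g x))\<^sup>2)"
  proof (rule integrable_bound')
    show "integrable lborel (\<lambda>x. M * norm (g x))" using g by simp
    show "AE x in lborel. norm ((norm (g x))\<^sup>2) \<le> norm (M * norm (g x))"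
      using b M by (auto simp: power2_eq_square intro!: mult_right_mono)
  qed simp
  define e where "e n = inverse (real (Suc n))" for n
  have e: "0 < e n" "e \<longlonglongrightarrow> 0" for n
    using LIMSEQ_inverse_real_of_nat by (simp_all add: e_def[abs_def])
  define H where "H = autocorrelation g"
  have Hb: "norm (H z) \<le> (LBINT x. (norm (g x))\<^sup>2)" for z
    unfolding H_def by (rule autocorrelation_bound[OF _ g2]) simp
  have [measurable]: "H \<in> borel_measurable borel" using autocorrelation_fourier(1)[OF g] by (auto simp: H_def)
  have Hlim: "(\<lambda>n. H (e n *\<^sub>R s)) \<longlonglongrightarrow> H 0" for s
    unfolding H_def autocorrelation_def
  proof (rule integral_dominated_convergence)
    show "integrable lborel (\<lambda>x. norm (g x) * M)" using g by simp
    show "AE x in lborel. norm (g x * cnj (g (x - e n *\<^sub>R s))) \<le> norm (g x) * M" for n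
      using b by (intro AE_I2) (simp add: norm_mult mult_left_mono)
    have [measurable]: "cnj \<in> borel_measurable borel"
      by (intro borel_measurable_continuous_onI continuous_intros)
    show "(\<lambda>x. g x * cnj (g (x - 0))) \<in> borel_measurable lborel" by measurable
    show "(\<lambda>x. g x * cnj (g (x - e n *\<^sub>R s))) \<in> borel_measurable lborel" for n by measurable
    show "AE x in lborel. (\<lambda>n. g x * cnj (g (x - e n *\<^sub>R s))) \<longlonglongrightarrow> g x * cnj (g (x - 0))"
    proof (intro AE_I2 tendsto_mult tendsto_const tendsto_cnj)
      fix x
      have "(\<lambda>n. x - e n *\<^sub>R s) \<longlonglongrightarrow> x - 0 *\<^sub>R s" by (intro tendsto_intros e)
      then show "(\<lambda>n. g (x - e n *\<^sub>R s)) \<longlonglongrightarrow> g (x - 0)"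
        using c by (intro isCont_tendsto_compose[of _ g]) (auto simp: continuous_on_eq_continuous_at)
    qed
  qed
  have "(\<lambda>n. \<integral>s. H (e n *\<^sub>R s) * of_real (gauss s) \<partial>lborel) \<longlonglongrightarrow> (LBINT s. H 0 * of_real (gauss (s::'a)))"
  proof (rule integral_dominated_convergence)
    show "integrable lborel (\<lambda>s::'a. (LBINT x. (norm (g x))\<^sup>2) * gauss s)" by (simp add: gauss_fourier(2))
    show "AE x in lborel. norm (H (e n *\<^sub>R x) * complex_of_real (gauss x)) \<le> (LBINT x. (norm (g x))\<^sup>2) * gauss x" for n
      using Hb by (intro AE_I2) (simp add: norm_mult gauss_nonneg mult_right_mono)
    show "AE x in lborel. (\<lambda>n. H (e n *\<^sub>R x) * complex_of_real (gauss x)) \<longlonglongrightarrow> H 0 * complex_of_real (gauss x)"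
      by (intro AE_I2 tendsto_intros Hlim)
  qed measurable
  also have "(LBINT s. H 0 * of_real (gauss (s::'a))) = H 0"
    using integral_complex_of_real[of lborel "gauss :: 'a \<Rightarrow> real"] by (simp add: gauss_fourier(3))
  also have "H 0 = of_real (LBINT x. (norm (g x))\<^sup>2)"
    unfolding H_def autocorrelation_def integral_complex_of_real[symmetric] complex_norm_square by simp
  finally have "(\<lambda>n. complex_of_real ((2 * pi) ^ DIM('a)) * (LBINT s. H (e n *\<^sub>R s) * of_real (gauss s))) \<longlonglongrightarrow>
      complex_of_real ((2 * pi) ^ DIM('a)) * of_real (LBINT x. (norm (g x))\<^sup>2)"
    by (intro tendsto_intros)
  then have "(\<lambda>n. complex_of_real (LBINT \<xi>. (norm (ft g \<xi>))\<^sup>2 * exp (- (norm (e n *\<^sub>R \<xi>))\<^sup>2 / 2))) \<longlonglongrightarrow>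
      of_real ((2 * pi) ^ DIM('a) * (LBINT x. (norm (g x))\<^sup>2))"
    unfolding weighted_plancherel(2)[OF g e(1)] H_def by simp
  moreover have "(\<lambda>n. complex_of_real (LBINT \<xi>. (norm (ft g \<xi>))\<^sup>2 * exp (- (norm (e n *\<^sub>R \<xi>))\<^sup>2 / 2))) \<longlonglongrightarrow>
      of_real (LBINT \<xi>. (norm (ft g \<xi>))\<^sup>2)"
    unfolding e_def by (intro tendsto_of_real plancherel_le(3) g g2)
  ultimately show "(LBINT \<xi>. (norm (ft g \<xi>))\<^sup>2) = (2 * pi) ^ DIM('a) * (LBINT x. (norm (g x))\<^sup>2)"
    using LIMSEQ_unique of_real_eq_iff by blast
qed

section \<open>Fractional powers of the lattice walk\<close>

text \<open>The power series coefficients of \<open>1 - (1 - z)^d\<close>.\<close>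

definition frac_coeff :: "real \<Rightarrow> nat \<Rightarrow> real" where
  "frac_coeff d n = (if n = 0 then 0 else - ((- 1) ^ n * (d gchoose n)))"

text \<open>The coefficient at index 1 is \<open>d\<close>, and from index \<open>n \<ge> 1\<close>
  to the next the coefficients change by the factor \<open>(n - d) / (n + 1)\<close>, which is
  nonnegative because \<open>d \<le> 1\<close>.\<close>

lemma frac_coeff_nonneg:
  assumes "0 \<le> d" "d \<le> 1" shows "0 \<le> frac_coeff d n"
proof (induction n)
  case (Suc n)
  show ?case
  proof (cases n)
    case (Suc m)
    have "(d gchoose Suc n) = (d - real n) * (d gchoose n) / real (Suc n)"
      using gbinomial_mult_1[of d n] by (simp add: field_simps)
    moreover have "frac_coeff d (Suc n) = (- 1) ^ n * (d gchoose Suc n)" "frac_coeff d n = - ((- 1) ^ n * (d gchoose n))"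
      using Suc by (simp_all add: frac_coeff_def)
    ultimately have "frac_coeff d (Suc n) = frac_coeff d n * (real n - d) / real (Suc n)"
      by (simp only: times_divide_eq_right) (simp add: algebra_simps)
    moreover have "0 \<le> real n - d" using Suc assms by simp
    ultimately show ?thesis using \<open>0 \<le> frac_coeff d n\<close> by simp
  qed (use assms in \<open>simp add: frac_coeff_def\<close>)
qed (simp add: frac_coeff_def)

lemma frac_coeff_sums:
  assumes "\<bar>z\<bar> < 1" shows "(\<lambda>n. frac_coeff d n * z ^ n) sums (1 - (1 - z) powr d)"
proof -
  have "(\<lambda>n. (d gchoose n) * (- z) ^ n) sums (1 - z) powr d"
    using gen_binomial_real[of "- z" d] assms by simp
  moreover have "(\<lambda>n. if n = 0 then 1 else 0 :: real) sums 1"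
    using sums_single[of 0 "\<lambda>_. 1::real"] by (simp add: eq_commute)
  ultimately have "(\<lambda>n. (if n = 0 then 1 else 0) - (d gchoose n) * (- z) ^ n) sums (1 - (1 - z) powr d)"
    by (intro sums_diff)
  moreover have "(if n = 0 then 1 else 0) - (d gchoose n) * (- z) ^ n = frac_coeff d n * z ^ n" for n
    by (simp add: frac_coeff_def power_minus[of z])
  ultimately show ?thesis by simp
qed

text \<open>For \<open>0 < z < 1\<close> a partial sum at \<open>z\<close> is at most the full value
  \<open>1 - (1 - z) powr d\<close>, hence at most 1. Letting \<open>z\<close> tend to 1 in a finite
  sum avoids any discussion of the series at the boundary of its disc of convergence.\<close>

lemma sub_prob_frac_coeff:
  assumes d: "0 \<le> d" "d \<le> 1" shows "sub_prob (frac_coeff d)"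
proof -
  have le: "(\<Sum>n<N. frac_coeff d n) \<le> 1" for N
  proof -
    have "(\<Sum>n<N. frac_coeff d n * z ^ n) \<le> 1" if "0 < z" "z < 1" for z
    proof -
      have s: "(\<lambda>n. frac_coeff d n * z ^ n) sums (1 - (1 - z) powr d)"
        using that by (intro frac_coeff_sums) auto
      have "(\<Sum>n<N. frac_coeff d n * z ^ n) \<le> (\<Sum>n. frac_coeff d n * z ^ n)"
        using s that frac_coeff_nonneg[OF d] by (intro sum_le_suminf) (auto simp: sums_iff)
      also have "\<dots> \<le> 1" using s by (simp add: sums_iff)
      finally show ?thesis .
    qed
    moreover have "((\<lambda>z. \<Sum>n<N. frac_coeff d n * z ^ n) \<longlongrightarrow> (\<Sum>n<N. frac_coeff d n * 1 ^ n)) (at_left 1)"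
      by (intro tendsto_intros)
    moreover have "\<forall>\<^sub>F z in at_left (1::real). 0 < z \<and> z < 1"
      using eventually_at_left_real[of 0 "1::real"] by simp
    ultimately show ?thesis
      by (intro tendsto_upperbound[of _ "\<Sum>n<N. frac_coeff d n" "at_left 1"]) (auto elim!: eventually_mono)
  qed
  have "summable (frac_coeff d)"
    by (rule summableI_nonneg_bounded[OF frac_coeff_nonneg[OF d] le])
  then show ?thesis using frac_coeff_nonneg[OF d] suminf_le_const[OF _ le] by (simp add: sub_prob_def)
qed

text \<open>With \<open>A = (1 - z)^d\<close> this is
  \<open>(1 - A)^2 + (1 - A^2) = 2 (1 - A)\<close> for power series. Vandermonde's identity gives
  the coefficients of \<open>A^2\<close>, and the unit of the convolution, supported at index 0,
  yields the two terms that are linear in \<open>c\<close>.\<close>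

lemma frac_coeff_convolution:
  "(\<Sum>i\<le>n. frac_coeff d i * frac_coeff d (n - i)) + frac_coeff (2 * d) n = 2 * frac_coeff d n"
proof (cases "n = 0")
  case False
  define c where "c i = (- 1) ^ i * (d gchoose i)" for i
  have cc: "(\<Sum>i\<le>n. c i * c (n - i)) = - frac_coeff (2 * d) n"
  proof -
    have "c i * c (n - i) = (- 1) ^ n * ((d gchoose i) * (d gchoose (n - i)))" if "i \<le> n" for i
    proof -
      have "(- 1) ^ n = (- 1 :: real) ^ i * (- 1) ^ (n - i)" using that by (simp add: power_add[symmetric])
      then show ?thesis by (simp add: c_def)
    qed
    then have "(\<Sum>i\<le>n. c i * c (n - i)) = (- 1) ^ n * (\<Sum>i\<in>{0..n}. (d gchoose i) * (d gchoose (n - i)))"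
      by (simp add: sum_distrib_left atMost_atLeast0)
    moreover have "d + d = 2 * d" by simp
    ultimately show ?thesis using False gbinomial_Vandermonde[of d d n] by (simp add: frac_coeff_def)
  qed
  have a: "frac_coeff d i = (if i = 0 then 1 else 0) - c i" for i by (simp add: frac_coeff_def c_def)
  have "(\<Sum>i\<le>n. frac_coeff d i * frac_coeff d (n - i)) =
    (\<Sum>i\<le>n. c i * c (n - i) - (if i = 0 then c (n - i) else 0) - (if i = n then c i else 0))"
    using False by (intro sum.cong refl) (auto simp: a algebra_simps)
  also have "\<dots> = (\<Sum>i\<le>n. c i * c (n - i)) - c n - c n"
    by (simp add: sum_subtractf sum.delta)
  finally show ?thesis unfolding cc using False by (simp add: a)
qed (simp add: frac_coeff_def)

text \<open>Symbol of the walk that rests with probability 1/2 and otherwise moves by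
  \<open>e\<close> along a random axis in a random direction. The resting probability makes it
  nonnegative.\<close>

definition lattice_symbol :: "real \<Rightarrow> 'a::euclidean_space \<Rightarrow> real" where
  "lattice_symbol e \<xi> = (\<Sum>b\<in>Basis. (1 + cos (e * (\<xi> \<bullet> b))) / 2) / DIM('a)"

text \<open>The symbol of \<open>S\<close>, kept as a series so that it is controlled at every
  frequency; the closed form in \<open>down_symbol_eq\<close> is for those with
  \<open>lattice_symbol\<close> below 1.\<close>

definition down_symbol :: "real \<Rightarrow> real \<Rightarrow> 'a::euclidean_space \<Rightarrow> real" where
  "down_symbol d e \<xi> = (\<Sum>n. frac_coeff d n * lattice_symbol e \<xi> ^ n)"

lemma lattice_symbol_01: "0 \<le> lattice_symbol e \<xi>" "lattice_symbol e \<xi> \<le> 1"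
proof -
  have c: "- 1 \<le> cos (e * (\<xi> \<bullet> b))" "cos (e * (\<xi> \<bullet> b)) \<le> 1" for b by auto
  have "0 \<le> 1 + cos (e * (\<xi> \<bullet> b))" for b using c(1)[of b] by linarith
  then show "0 \<le> lattice_symbol e \<xi>"
    unfolding lattice_symbol_def by (intro divide_nonneg_nonneg sum_nonneg) auto
  have "(\<Sum>b\<in>Basis. (1 + cos (e * (\<xi> \<bullet> b))) / 2) \<le> (\<Sum>b\<in>(Basis :: 'a set). 1)"
    using c(2) by (intro sum_mono) (simp add: field_simps)
  then show "lattice_symbol e \<xi> \<le> 1"
    unfolding lattice_symbol_def by (simp add: divide_le_eq)
qed

lemma down_symbol_01:
  assumes d: "0 \<le> d" "d \<le> 1"
  shows "0 \<le> down_symbol d e \<xi>" "down_symbol d e \<xi> \<le> 1"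
proof -
  let ?t = "\<lambda>n. frac_coeff d n * lattice_symbol e \<xi> ^ n"
  have b: "0 \<le> ?t n" "?t n \<le> frac_coeff d n" for n
    using frac_coeff_nonneg[OF d] lattice_symbol_01[of e \<xi>] by (auto simp: mult_left_le power_le_one)
  have s: "summable (frac_coeff d)" "suminf (frac_coeff d) \<le> 1"
    using sub_prob_frac_coeff[OF d] by (auto simp: sub_prob_def)
  have st: "summable ?t" by (rule summable_comparison_test[OF _ s(1)]) (use b in auto)
  show "0 \<le> down_symbol d e \<xi>" unfolding down_symbol_def by (rule suminf_nonneg[OF st b(1)])
  show "down_symbol d e \<xi> \<le> 1" unfolding down_symbol_def
    using suminf_le[OF b(2) st s(1)] s(2) by linarith
qed

lemma down_symbol_eq:
  "lattice_symbol e \<xi> < 1 \<Longrightarrow> down_symbol d e \<xi> = 1 - (1 - lattice_symbol e \<xi>) powr d"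
  unfolding down_symbol_def using frac_coeff_sums[of "lattice_symbol e \<xi>" d] lattice_symbol_01(1)[of e \<xi>]
  by (simp add: sums_iff)

lemma symbol_measurable [measurable]:
  "lattice_symbol e \<in> borel_measurable borel"
  "down_symbol d e \<in> borel_measurable borel"
proof -
  show [measurable]: "lattice_symbol e \<in> borel_measurable borel"
    unfolding lattice_symbol_def[abs_def]
    by (intro borel_measurable_continuous_onI continuous_intros) auto
  show "down_symbol d e \<in> borel_measurable borel"
    unfolding down_symbol_def[abs_def] by measurable
qed

text \<open>The limit argument uses the operators only through the four exported properties, so the
  walk disappears from here on. In the index set, \<open>(b, s)\<close> is a move by
  \<open>e * s\<close> along the axis \<open>b\<close>, and \<open>s = 0\<close> is the lazy
  step.\<close>

lemma lattice_multiplier: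
  fixes e d p R :: real and \<rho> :: "nat \<Rightarrow> real"
  assumes d: "0 < d" "d \<le> 1/2" and p: "1 < p" and R: "0 < R" and \<rho>: "\<And>n. \<bar>\<rho> n\<bar> \<le> R * real n"
  obtains T :: "('a::euclidean_space \<Rightarrow> real) \<Rightarrow> 'a \<Rightarrow> real"
  where "\<And>f. tame f \<Longrightarrow> tame (T f)"
    and "\<And>f. tame f \<Longrightarrow> continuous_on UNIV f \<Longrightarrow> continuous_on UNIV (T f)"
    and "\<And>f \<xi>. tame f \<Longrightarrow> ft (\<lambda>x. of_real (T f x)) \<xi> =
       of_real (\<Sum>n\<le>N. \<rho> n * ((1 - down_symbol d e \<xi>)\<^sup>2 * down_symbol d e \<xi> ^ (2 * n))) * ft (\<lambda>x. of_real (f x)) \<xi>"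
    and "\<And>f. tame f \<Longrightarrow> (LBINT x. \<bar>T f x\<bar> powr p) \<le>
        (2 * (R * (bellman_const (min p (p / (p - 1))) / 2))) powr p * (LBINT x. \<bar>f x\<bar> powr p)"
proof -
  define I where "I = (Basis :: 'a set) \<times> {- 1, 0, 1 :: real}"
  define w where "w = (\<lambda>(b :: 'a, s :: real). (if s = 0 then 1/2 else 1/4) / real DIM('a))"
  define y where "y = (\<lambda>(b :: 'a, s :: real). (e * s) *\<^sub>R b)"
  have sumI: "(\<Sum>i\<in>I. h i) = (\<Sum>b\<in>Basis. h (b, - 1) + h (b, 0) + h (b, 1))" for h :: "'a \<times> real \<Rightarrow> real"
    unfolding I_def sum.cartesian_product' by (simp add: add.assoc)
  interpret half_space_walk I w y "frac_coeff d" "frac_coeff (2 * d)"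
  proof
    show "sum w I = 1" unfolding sumI by (simp add: w_def)
    show "(\<Sum>i\<in>I. w i * g (- y i)) = (\<Sum>i\<in>I. w i * g (y i))" for g :: "'a \<Rightarrow> real"
      unfolding sumI by (simp add: w_def y_def add.commute add.left_commute)
  qed (use d in \<open>auto simp: I_def w_def frac_coeff_convolution intro!: sub_prob_frac_coeff\<close>)
  have sym: "symbol \<xi> = lattice_symbol e \<xi>" for \<xi>
    unfolding symbol_def sumI lattice_symbol_def sum_divide_distrib
    by (intro sum.cong refl) (simp add: w_def y_def field_simps)
  have fd: "ft (\<lambda>x. of_real (down n f x)) \<xi> = of_real (down_symbol d e \<xi> ^ n) * ft (\<lambda>x. of_real (f x)) \<xi>"
    if "tame f" for f n \<xi>
    using down_fourier[OF that, of n \<xi>] by (simp add: ft_def scaleR_conv_of_real sym down_symbol_def)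
  have ift: "integrable lborel (\<lambda>x. of_real (f x) * cis (\<xi> \<bullet> x))" if "tame f" for f :: "'a \<Rightarrow> real" and \<xi>
    using integrable_mult_cis[of "\<lambda>x. of_real (f x)"] tame_integrable[OF that] by simp
  show thesis
  proof (rule that[of "truncated \<rho> N"])
    fix f :: "'a \<Rightarrow> real" and \<xi> assume f: "tame f"
    let ?s = "down_symbol d e \<xi>" and ?f = "ft (\<lambda>x. of_real (f x)) \<xi>"
    have "ft (\<lambda>x. of_real (truncated \<rho> N f x)) \<xi> = (\<Sum>n\<le>N. of_real (\<rho> n) *
      (ft (\<lambda>x. of_real (down (2 * n) f x)) \<xi> - 2 * ft (\<lambda>x. of_real (down (2 * n + 1) f x)) \<xi> + ft (\<lambda>x. of_real (down (2 * n + 2) f x)) \<xi>))"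
    proof -
      have "(\<lambda>x. of_real (truncated \<rho> N f x) * cis (\<xi> \<bullet> x)) = (\<lambda>x. \<Sum>n\<le>N. of_real (\<rho> n) *
        (of_real (down (2 * n) f x) * cis (\<xi> \<bullet> x) - 2 * (of_real (down (2 * n + 1) f x) * cis (\<xi> \<bullet> x)) + of_real (down (2 * n + 2) f x) * cis (\<xi> \<bullet> x)))"
        unfolding truncated_def of_real_sum sum_distrib_right
        by (intro ext sum.cong refl) (simp add: algebra_simps del: mult_Suc)
      then show ?thesis unfolding ft_def using ift[OF tame_down[OF f]] by simp
    qed
    also have "\<dots> = (\<Sum>n\<le>N. of_real (\<rho> n) * (of_real (?s ^ (2 * n) - 2 * ?s ^ (2 * n + 1) + ?s ^ (2 * n + 2)) * ?f))"
      unfolding fd[OF f] by (simp add: algebra_simps)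
    also have "\<dots> = of_real (\<Sum>n\<le>N. \<rho> n * ((1 - ?s)\<^sup>2 * ?s ^ (2 * n))) * ?f"
    proof -
      have "?s ^ (2 * n) - 2 * ?s ^ (2 * n + 1) + ?s ^ (2 * n + 2) = (1 - ?s)\<^sup>2 * ?s ^ (2 * n)" for n
        by (simp add: power2_eq_square algebra_simps)
      then show ?thesis by (simp add: sum_distrib_right mult.assoc)
    qed
    finally show "ft (\<lambda>x. of_real (truncated \<rho> N f x)) \<xi> = of_real (\<Sum>n\<le>N. \<rho> n * ((1 - ?s)\<^sup>2 * ?s ^ (2 * n))) * ?f" .
  qed (intro tame_truncated continuous_truncated truncated_Lp p R \<rho>; assumption)+
qed

section \<open>Convergence of the symbols\<close>

definition mesh :: "nat \<Rightarrow> real" where "mesh k = inverse (real (Suc k))"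

text \<open>Chosen so that one application of the Markov operator \<open>S\<close> corresponds to a time step \<open>mesh k\<close>.\<close>

definition lattice_step :: "real \<Rightarrow> 'a::euclidean_space itself \<Rightarrow> nat \<Rightarrow> real" where
  "lattice_step d (_ :: 'a itself) k = sqrt (4 * DIM('a)) * mesh k powr (1 / (2 * d))"

lemma mesh_pos: "0 < mesh k" and mesh_le: "mesh k \<le> 1" and mesh_tendsto: "mesh \<longlonglongrightarrow> 0"
  unfolding mesh_def[abs_def] using LIMSEQ_inverse_real_of_nat by (auto simp: field_simps)

lemma cos_quotient_limit: "((\<lambda>e. 2 * (1 - cos (e * t)) / e\<^sup>2) \<longlongrightarrow> t\<^sup>2) (at_right (0::real))" for t :: real
proof -
  have "((\<lambda>e. 2 * (1 - cos (e * t)) / e\<^sup>2) \<longlongrightarrow> t * t) (at_right (0::real))" by real_asymp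
  then show ?thesis unfolding power2_eq_square[of t] .
qed

text \<open>For small \<open>e\<close>, \<open>1 - lattice_symbol e \<xi>\<close> is asymptotically
  \<open>e^2 |xi|^2 / (4 DIM)\<close>. With \<open>e = lattice_step\<close> the factor
  \<open>e^2 / (4 DIM)\<close> equals \<open>mesh powr (1 / d)\<close>, so the \<open>d\<close>-th
  power is asymptotically \<open>mesh * |xi| powr (2 d)\<close>.\<close>

lemma down_symbol_limit:
  fixes \<xi> :: "'a::euclidean_space"
  assumes d: "0 < d" and \<xi>: "\<xi> \<noteq> 0"
  shows "(\<lambda>k. (1 - down_symbol d (lattice_step d TYPE('a) k) \<xi>) / mesh k) \<longlonglongrightarrow> norm \<xi> powr (2 * d)"
proof -
  define e where "e = lattice_step d TYPE('a)"
  have e_pos: "0 < e k" for k using mesh_pos[of k] by (simp add: e_def lattice_step_def)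
  have "(\<lambda>k. sqrt (4 * DIM('a)) * mesh k powr (1 / (2 * d))) \<longlonglongrightarrow> sqrt (4 * DIM('a)) * 0"
    using mesh_pos d by (intro tendsto_mult tendsto_const tendsto_zero_powrI[OF mesh_tendsto tendsto_const])
      (auto simp: less_imp_le)
  then have e0: "filterlim e (at_right 0) sequentially"
    using e_pos less_imp_neq[OF mesh_pos] unfolding filterlim_at
    by (auto simp: e_def lattice_step_def[abs_def] intro!: always_eventually)
  define X where "X k = (1 - lattice_symbol (e k) \<xi>) / mesh k powr (1 / d)" for k
  have mesh_e: "mesh k powr (1 / d) = (e k)\<^sup>2 / (4 * DIM('a))" for k
  proof -
    have "(mesh k powr (1 / (2 * d)))\<^sup>2 = mesh k powr (1 / d)"
      unfolding power2_eq_square powr_add[symmetric] using d by (simp add: field_simps)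
    then show ?thesis by (simp add: e_def lattice_step_def power_mult_distrib)
  qed
  have X: "X k = (\<Sum>b\<in>Basis. 2 * (1 - cos (e k * (\<xi> \<bullet> b))) / (e k)\<^sup>2)" for k
  proof -
    have "1 - lattice_symbol (e k) \<xi> = (\<Sum>b\<in>(Basis::'a set). 1 - (1 + cos (e k * (\<xi> \<bullet> b))) / 2) / DIM('a)"
      unfolding lattice_symbol_def sum_subtractf by (simp add: field_simps)
    then have "X k = (\<Sum>b\<in>(Basis::'a set). 1 - (1 + cos (e k * (\<xi> \<bullet> b))) / 2) * (4 / (e k)\<^sup>2)"
      unfolding X_def mesh_e by simp
    also have "\<dots> = (\<Sum>b\<in>Basis. 2 * (1 - cos (e k * (\<xi> \<bullet> b))) / (e k)\<^sup>2)"
      unfolding sum_distrib_right using e_pos[of k] by (intro sum.cong refl) (simp add: field_simps)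
    finally show ?thesis .
  qed
  have "X \<longlonglongrightarrow> (\<Sum>b\<in>Basis. (\<xi> \<bullet> b)\<^sup>2)"
    unfolding X by (intro tendsto_sum filterlim_compose[OF cos_quotient_limit e0])
  then have Xlim: "X \<longlonglongrightarrow> (norm \<xi>)\<^sup>2" unfolding sum_Basis_sq .
  then have "(\<lambda>k. X k powr d) \<longlonglongrightarrow> ((norm \<xi>)\<^sup>2) powr d"
    using \<xi> by (intro tendsto_powr tendsto_const) auto
  moreover have "((norm \<xi>)\<^sup>2) powr d = norm \<xi> powr (2 * d)"
    using \<xi> by (simp add: powr_powr[symmetric])
  ultimately have "(\<lambda>k. X k powr d) \<longlonglongrightarrow> norm \<xi> powr (2 * d)" by simp
  \<comment> \<open>Positivity of \<open>X k\<close> means that \<open>lattice_symbol\<close> is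
    below 1, where the closed form of \<open>down_symbol\<close> is available.\<close>
  moreover have "\<forall>\<^sub>F k in sequentially. 0 < X k" using order_tendstoD(1)[OF Xlim, of 0] \<xi> by simp
  then have "\<forall>\<^sub>F k in sequentially. X k powr d = (1 - down_symbol d (e k) \<xi>) / mesh k"
  proof eventually_elim
    case (elim k)
    have z: "lattice_symbol (e k) \<xi> < 1" using elim mesh_pos[of k] by (simp add: X_def zero_less_divide_iff)
    have "X k powr d = (1 - lattice_symbol (e k) \<xi>) powr d / mesh k"
      unfolding X_def using z mesh_pos[of k] d by (simp add: powr_divide powr_powr)
    then show ?case using down_symbol_eq[OF z, of d] by simp
  qed
  ultimately show ?thesis unfolding e_def[symmetric] by (rule Lim_transform_eventually)
qed

text \<open>Half of the decay pays for the factor \<open>t\<close>, by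
  \<open>s t / 2 \<le> exp (s t / 2)\<close>; what remains is a multiple of the exponential density
  of rate \<open>s / 2\<close>.\<close>

lemma integrable_power_exp:
  fixes s :: real assumes "0 < s"
  shows "integrable lborel (\<lambda>t. indicator {0<..} t * (t * exp (- s * t)))"
proof (rule integrable_bound')
  interpret prob_space "density lborel (exponential_density (s / 2))"
    using assms by (intro prob_space_exponential_density) simp
  have "(\<integral>\<^sup>+t. ennreal (exponential_density (s / 2) t) \<partial>lborel) = 1"
    using emeasure_space_1 by (simp add: emeasure_density)
  then have "integrable lborel (exponential_density (s / 2))"
    using assms by (intro integrableI_nonneg) (auto simp: erlang_density_def)
  then show "integrable lborel (\<lambda>t. 4 / s\<^sup>2 * exponential_density (s / 2) t)" by simp
  show "AE t in lborel. norm (indicator {0<..} t * (t * exp (- s * t))) \<le> norm (4 / s\<^sup>2 * exponential_density (s / 2) t)"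
  proof (intro AE_I2)
    fix t :: real
    show "norm (indicator {0<..} t * (t * exp (- s * t))) \<le> norm (4 / s\<^sup>2 * exponential_density (s / 2) t)"
    proof (cases "0 < t")
      case True
      have "s / 2 * t \<le> exp (s / 2 * t)" using exp_ge_add_one_self[of "s / 2 * t"] by linarith
      then have "(s / 2 * t) * exp (- s * t) \<le> exp (s / 2 * t) * exp (- s * t)" by (intro mult_right_mono) auto
      also have "\<dots> = exp (- (t * s) / 2)" by (simp add: exp_add[symmetric] field_simps)
      finally have "t * exp (- s * t) \<le> 2 / s * exp (- (t * s) / 2)" using assms by (simp add: field_simps)
      then show ?thesis using True assms
        by (simp add: exponential_density_def abs_mult power2_eq_square field_simps)
    qed simp
  qed
qed simp

text \<open>Cell averages take the place of sample values: for a function that is merely Borel, the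
  values on a grid say nothing about its integrals.\<close>

definition local_average :: "(real \<Rightarrow> real) \<Rightarrow> nat \<Rightarrow> nat \<Rightarrow> real" where
  "local_average r k n = (LBINT t. indicator {real n * mesh k..<(real n + 1) * mesh k} t * r t) / mesh k"

lemma integrable_interval:
  fixes r :: "real \<Rightarrow> real"
  assumes [measurable]: "r \<in> borel_measurable borel" and R: "\<And>t. \<bar>r t\<bar> \<le> R"
  shows "integrable lborel (\<lambda>t. indicator {a..<b} t * r t)"
proof (rule integrable_bound')
  have "integrable lborel (indicat_real {a..<b})"
    by (rule integrable_indicator_bounded) auto
  then show "integrable lborel (\<lambda>t. R * indicator {a..<b} t)" by simp
  show "AE t in lborel. norm (indicator {a..<b} t * r t) \<le> norm (R * indicator {a..<b} t)"
    using R order_trans[OF abs_ge_zero R] by (auto simp: indicator_def)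
qed simp

lemma local_average_bound:
  assumes r: "r \<in> borel_measurable borel" and R: "\<And>t. \<bar>r t\<bar> \<le> R"
  shows "\<bar>local_average r k n\<bar> \<le> R"
proof -
  let ?A = "{real n * mesh k..<(real n + 1) * mesh k}"
  have i: "integrable lborel (indicat_real ?A)"
    by (rule integrable_indicator_bounded) auto
  have "\<bar>\<integral>t. indicator ?A t * r t \<partial>lborel\<bar> \<le> (LBINT t. \<bar>indicator ?A t * r t\<bar>)" by (rule integral_abs_bound)
  also have "\<dots> \<le> (LBINT t. R * indicator ?A t)"
  proof (rule integral_mono')
    show "integrable lborel (\<lambda>t. R * indicator ?A t)" using i by simp
  qed (use R order_trans[OF abs_ge_zero R] in \<open>auto simp: indicator_def\<close>)
  also have "\<dots> = R * mesh k" using mesh_pos[of k] by (simp add: algebra_simps)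
  finally show ?thesis using mesh_pos[of k] unfolding local_average_def abs_divide by (simp add: divide_le_eq)
qed

text \<open>Writing the averages as integrals turns the sum into the integral of \<open>J k\<close>,
  in which only the kernel is discretised while \<open>r\<close> is evaluated at \<open>t\<close>
  itself. Pointwise convergence therefore asks no regularity of \<open>r\<close>, and dominated
  convergence applies. The range of summation reaches the time
  \<open>(Suc k)^2 * mesh k = Suc k\<close>, which tends to infinity.\<close>

lemma riemann_sum_limit:
  fixes r :: "real \<Rightarrow> real" and s :: real and \<sigma> :: "nat \<Rightarrow> real"
  assumes r: "r \<in> borel_measurable borel" and R: "\<And>t. \<bar>r t\<bar> \<le> R" and s: "0 < s"
    and \<sigma>: "\<And>k. 0 \<le> \<sigma> k" and lim: "(\<lambda>k. (1 - \<sigma> k) / mesh k) \<longlonglongrightarrow> s"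
  shows "(\<lambda>k. \<Sum>n\<le>(Suc k)\<^sup>2. (real n * local_average r k n) * ((1 - \<sigma> k)\<^sup>2 * \<sigma> k ^ (2 * n)))
    \<longlonglongrightarrow> s\<^sup>2 * (LBINT t. indicator {0<..} t * (t * r t * exp (- 2 * t * s)))"
proof -
  note [measurable] = r
  define S where "S k = (1 - \<sigma> k) / mesh k" for k
  have Slim: "S \<longlonglongrightarrow> s" using lim by (simp add: S_def[abs_def])
  have \<sigma>S: "\<sigma> k = 1 - mesh k * S k" for k using mesh_pos[of k] by (simp add: S_def)
  define A where "A k n = {real n * mesh k..<(real n + 1) * mesh k}" for k n
  define J where "J k t = (\<Sum>n\<le>(Suc k)\<^sup>2. (real n * mesh k * (S k)\<^sup>2 * \<sigma> k ^ (2 * n)) * (indicator (A k n) t * r t))" for k t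
  have sumJ: "(\<Sum>n\<le>(Suc k)\<^sup>2. (real n * local_average r k n) * ((1 - \<sigma> k)\<^sup>2 * \<sigma> k ^ (2 * n))) = (LBINT t. J k t)" for k
  proof -
    have "(LBINT t. J k t) = (\<Sum>n\<le>(Suc k)\<^sup>2. (real n * mesh k * (S k)\<^sup>2 * \<sigma> k ^ (2 * n)) * (LBINT t. indicator (A k n) t * r t))"
      unfolding J_def A_def using integrable_interval[OF r R] by simp
    also have "\<dots> = (\<Sum>n\<le>(Suc k)\<^sup>2. (real n * local_average r k n) * ((1 - \<sigma> k)\<^sup>2 * \<sigma> k ^ (2 * n)))"
      unfolding local_average_def A_def[symmetric] S_def using mesh_pos[of k]
      by (intro sum.cong refl) (simp add: power_divide power2_eq_square)
    finally show ?thesis by simp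
  qed
  have Jeq: "J k t = (if n \<le> (Suc k)\<^sup>2 then (real n * mesh k * (S k)\<^sup>2 * \<sigma> k ^ (2 * n)) * r t else 0)"
    if "t \<in> A k n" for k t n
  proof -
    have "indicator (A k i) t = (if i = n then 1 else 0 :: real)" for i
    proof (cases "i = n")
      case False
      have "t \<notin> A k i"
      proof
        assume "t \<in> A k i"
        then have "real i * mesh k < (real n + 1) * mesh k" "real n * mesh k < (real i + 1) * mesh k"
          using that by (auto simp: A_def)
        then have "real i < real n + 1" "real n < real i + 1" using mesh_pos[of k] by auto
        then show False using False by linarith
      qed
      then show ?thesis using False by simp
    qed (use that in simp)
    then show ?thesis unfolding J_def by (simp add: if_distrib[of "\<lambda>x. x * _"] if_distrib[of "\<lambda>x. _ * x"] sum.delta cong: if_cong)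
  qed
  define fl where "fl k t = nat \<lfloor>t / mesh k\<rfloor>" for k and t :: real
  have fl: "t \<in> A k (fl k t)" "real (fl k t) * mesh k \<le> t" "t < real (fl k t) * mesh k + mesh k" if "0 \<le> t" for k t
  proof -
    have "0 \<le> t / mesh k" using that mesh_pos[of k] by simp
    then have "real (fl k t) \<le> t / mesh k" "t / mesh k < real (fl k t) + 1" unfolding fl_def by linarith+
    then show 1: "real (fl k t) * mesh k \<le> t" and 2: "t < real (fl k t) * mesh k + mesh k"
      using mesh_pos[of k] by (simp_all add: field_simps)
    show "t \<in> A k (fl k t)" unfolding A_def using 1 2 by (simp add: algebra_simps)
  qed
  have J0: "J k t = 0" if "t \<le> 0" for k t
  proof (cases "t = 0")
    case True
    then have "t \<in> A k 0" using mesh_pos[of k] by (simp add: A_def)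
    from Jeq[OF this] show ?thesis by simp
  next
    case False
    have "t \<notin> A k n" for n using False that mesh_pos[of k] by (auto simp: A_def not_le intro: less_le_trans[of t 0])
    then show ?thesis by (simp add: J_def)
  qed
  have "\<forall>\<^sub>F k in sequentially. s / 2 < S k \<and> S k < 2 * s \<and> mesh k * S k < 1"
  proof -
    have "(\<lambda>k. mesh k * S k) \<longlonglongrightarrow> 0 * s" by (intro tendsto_mult mesh_tendsto Slim)
    then have "\<forall>\<^sub>F k in sequentially. mesh k * S k < 1" by (intro order_tendstoD) auto
    moreover have "\<forall>\<^sub>F k in sequentially. s / 2 < S k" "\<forall>\<^sub>F k in sequentially. S k < 2 * s"
      using s by (auto intro!: order_tendstoD[OF Slim] simp del: less_divide_eq_numeral1 divide_less_eq_numeral1)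
    ultimately show ?thesis by eventually_elim auto
  qed
  then obtain k0 where k0: "s / 2 < S k" "S k < 2 * s" "mesh k * S k < 1" if "k0 \<le> k" for k
    unfolding eventually_sequentially by metis
  have "(\<lambda>k. \<integral>t. J (k + k0) t \<partial>lborel) \<longlonglongrightarrow> (LBINT t. s\<^sup>2 * (indicator {0<..} t * (t * r t * exp (- 2 * t * s))))"
  proof (rule integral_dominated_convergence)
    show "(\<lambda>t. s\<^sup>2 * (indicator {0<..} t * (t * r t * exp (- 2 * t * s)))) \<in> borel_measurable lborel" by measurable
    show "J (k + k0) \<in> borel_measurable lborel" for k unfolding J_def[abs_def] A_def by measurable
    show "integrable lborel (\<lambda>t. 4 * s\<^sup>2 * R * exp s * (indicator {0<..} t * (t * exp (- s * t))))"
      using integrable_power_exp[OF s] by simp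
    show "AE t in lborel. norm (J (k + k0) t) \<le> 4 * s\<^sup>2 * R * exp s * (indicator {0<..} t * (t * exp (- s * t)))" for k
    proof (intro AE_I2)
      fix t :: real
      have Rn: "0 \<le> R" using R[of 0] by linarith
      define K where "K = k + k0"
      have K: "s / 2 < S K" "S K < 2 * s" "mesh K * S K < 1" using k0[of K] by (auto simp: K_def)
      show "norm (J (k + k0) t) \<le> 4 * s\<^sup>2 * R * exp s * (indicator {0<..} t * (t * exp (- s * t)))"
      proof (cases "0 < t")
        case True
        define n where "n = fl K t"
        have n: "real n * mesh K \<le> t" "t < real n * mesh K + mesh K" "t \<in> A K n" using fl[of t K] True by (auto simp: n_def)
        have "\<sigma> K \<le> exp (- (mesh K * S K))" using exp_ge_add_one_self[of "- (mesh K * S K)"] by (simp add: \<sigma>S)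
        then have "\<sigma> K ^ (2 * n) \<le> exp (- (mesh K * S K)) ^ (2 * n)" using \<sigma> by (intro power_mono) auto
        also have "\<dots> = exp (- (2 * S K * (real n * mesh K)))" by (simp add: exp_of_nat_mult[symmetric] algebra_simps)
        \<comment> \<open>Cells have length at most 1, so the left end point of the cell of
          \<open>t\<close> is at least \<open>t - 1\<close>. Together with
          \<open>s < 2 * S K\<close> this costs the factor \<open>exp s\<close> of the majorant and
          half of the decay of the limit.\<close>
        also have "\<dots> \<le> exp (- s * (t - 1))"
        proof -
          have "t - 1 \<le> real n * mesh K" using n(2) mesh_le[of K] by linarith
          then have "s * (t - 1) \<le> s * (real n * mesh K)" using s by (intro mult_left_mono) auto
          also have "\<dots> \<le> (2 * S K) * (real n * mesh K)" using K s mesh_pos[of K] by (intro mult_right_mono) auto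
          finally show ?thesis by simp
        qed
        finally have e: "\<sigma> K ^ (2 * n) \<le> exp s * exp (- s * t)" by (simp add: exp_add[symmetric] algebra_simps)
        have S2: "(S K)\<^sup>2 \<le> (2 * s)\<^sup>2" using K s by (intro power_mono) auto
        have "\<bar>J K t\<bar> \<le> (real n * mesh K * (S K)\<^sup>2 * \<sigma> K ^ (2 * n)) * \<bar>r t\<bar>"
          unfolding Jeq[OF n(3)] using \<sigma>[of K] mesh_pos[of K] by (simp add: abs_mult)
        also have "\<dots> \<le> (t * (2 * s)\<^sup>2 * (exp s * exp (- s * t))) * R"
          using n(1) S2 e R Rn True \<sigma>[of K] mesh_pos[of K] s by (intro mult_mono) auto
        finally show ?thesis using True by (simp add: K_def mult_ac power_mult_distrib)
      qed (use J0 in simp)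
    qed
    show "AE t in lborel. (\<lambda>k. J (k + k0) t) \<longlonglongrightarrow> s\<^sup>2 * (indicator {0<..} t * (t * r t * exp (- 2 * t * s)))"
    proof (intro AE_I2 LIMSEQ_ignore_initial_segment)
      fix t :: real
      show "(\<lambda>k. J k t) \<longlonglongrightarrow> s\<^sup>2 * (indicator {0<..} t * (t * r t * exp (- 2 * t * s)))"
      proof (cases "0 < t")
        case True
        define n where "n k = fl k t" for k
        have n: "real (n k) * mesh k \<le> t" "t < real (n k) * mesh k + mesh k" "t \<in> A k (n k)" for k
          using fl[of t k] True by (auto simp: n_def)
        have nlim: "(\<lambda>k. real (n k) * mesh k) \<longlonglongrightarrow> t"
        proof (rule tendsto_sandwich)
          show "(\<lambda>k. t - mesh k) \<longlonglongrightarrow> t" using tendsto_diff[OF tendsto_const mesh_tendsto, of t] by simp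
                have "t - mesh k \<le> real (n k) * mesh k" for k using n(2)[of k] by linarith
          then show "\<forall>\<^sub>F k in sequentially. t - mesh k \<le> real (n k) * mesh k" by simp
          show "\<forall>\<^sub>F k in sequentially. real (n k) * mesh k \<le> t" using n(1) by simp
        qed simp
        have xlim: "(\<lambda>k. mesh k * S k) \<longlonglongrightarrow> 0" using tendsto_mult[OF mesh_tendsto Slim] by simp
        \<comment> \<open>Squeezed by \<open>- x - 2 x^2 \<le> ln (1 - x) \<le> - x\<close> at
          \<open>x = mesh k * S k\<close>, after division by \<open>mesh k\<close>.\<close>
        have lnlim: "(\<lambda>k. ln (\<sigma> k) / mesh k) \<longlonglongrightarrow> - s"
        proof (rule tendsto_sandwich)
          have ev: "\<forall>\<^sub>F k in sequentially. mesh k * S k < 1/2 \<and> 0 < S k"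
            using order_tendstoD(2)[OF xlim, of "1/2"] order_tendstoD(1)[OF Slim, of 0] s
            by (simp add: eventually_conj)
          show "(\<lambda>k. - S k - 2 * (mesh k * S k) * S k) \<longlonglongrightarrow> - s"
            using tendsto_diff[OF tendsto_minus[OF Slim] tendsto_mult[OF tendsto_mult[OF tendsto_const xlim, of 2] Slim]] by simp
          show "(\<lambda>k. - S k) \<longlonglongrightarrow> - s" by (intro tendsto_minus Slim)
          show "\<forall>\<^sub>F k in sequentially. - S k - 2 * (mesh k * S k) * S k \<le> ln (\<sigma> k) / mesh k"
            using ev
          proof eventually_elim
            case (elim k)
            have "- (mesh k * S k) - 2 * (mesh k * S k)\<^sup>2 \<le> ln (\<sigma> k)"
              unfolding \<sigma>S using elim mesh_pos[of k] by (intro ln_one_minus_pos_lower_bound) auto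
            then show ?case using mesh_pos[of k] by (simp add: field_simps power2_eq_square)
          qed
          show "\<forall>\<^sub>F k in sequentially. ln (\<sigma> k) / mesh k \<le> - S k"
            using ev
          proof eventually_elim
            case (elim k)
            have "ln (\<sigma> k) \<le> - (mesh k * S k)"
              unfolding \<sigma>S using elim mesh_pos[of k] by (intro ln_one_minus_pos_upper_bound) auto
            then show ?case using mesh_pos[of k] by (simp add: field_simps)
          qed
        qed
        have "(\<lambda>k. exp (2 * (real (n k) * mesh k) * (ln (\<sigma> k) / mesh k))) \<longlonglongrightarrow> exp (2 * t * (- s))"
          by (intro tendsto_intros nlim lnlim)
        moreover have "\<forall>\<^sub>F k in sequentially. mesh k * S k < 1" using order_tendstoD(2)[OF xlim, of 1] by simp
        then have "\<forall>\<^sub>F k in sequentially. exp (2 * (real (n k) * mesh k) * (ln (\<sigma> k) / mesh k)) = \<sigma> k ^ (2 * n k)"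
        proof eventually_elim
          case (elim k)
          then have pos: "0 < \<sigma> k" by (simp add: \<sigma>S)
          have "\<sigma> k ^ (2 * n k) = exp (real (2 * n k) * ln (\<sigma> k))" using pos by (subst exp_of_nat_mult) simp
          then show ?case using mesh_pos[of k] by simp
        qed
        ultimately have plim: "(\<lambda>k. \<sigma> k ^ (2 * n k)) \<longlonglongrightarrow> exp (2 * t * (- s))" by (rule Lim_transform_eventually)
        have "(\<lambda>k. (real (n k) * mesh k * (S k)\<^sup>2 * \<sigma> k ^ (2 * n k)) * r t) \<longlonglongrightarrow> (t * s\<^sup>2 * exp (2 * t * (- s))) * r t"
          by (intro tendsto_intros nlim plim Slim)
        moreover have "\<forall>\<^sub>F k in sequentially. (real (n k) * mesh k * (S k)\<^sup>2 * \<sigma> k ^ (2 * n k)) * r t = J k t"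
        proof -
          \<comment> \<open>The index of the cell of \<open>t\<close> is at most
            \<open>t * Suc k\<close>, which does not exceed \<open>(Suc k)^2\<close> once
            \<open>t \<le> real k\<close>; from then on the cell takes part in the sum.\<close>
          obtain k1 where k1: "t \<le> real k1" using real_arch_simple by blast
          have "n k \<le> (Suc k)\<^sup>2" if "k1 \<le> k" for k
          proof -
            have "real (n k) \<le> t * real (Suc k)" using n(1)[of k] by (simp add: mesh_def field_simps)
            also have "\<dots> \<le> real (Suc k) * real (Suc k)" using k1 that by (intro mult_right_mono) auto
            finally show ?thesis by (simp only: power2_eq_square of_nat_mult[symmetric] of_nat_le_iff)
          qed
          then show ?thesis using Jeq[OF n(3)] by (intro eventually_sequentiallyI[of k1]) simp
        qed
        ultimately have "(\<lambda>k. J k t) \<longlonglongrightarrow> (t * s\<^sup>2 * exp (2 * t * (- s))) * r t" by (rule Lim_transform_eventually)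
        then show ?thesis using True by (simp add: mult_ac)
      qed (use J0 in simp)
    qed
  qed
  then have "(\<lambda>k. \<integral>t. J k t \<partial>lborel) \<longlonglongrightarrow> s\<^sup>2 * (LBINT t. indicator {0<..} t * (t * r t * exp (- 2 * t * s)))"
    by (intro LIMSEQ_offset[of "\<lambda>k. \<integral>t. J k t \<partial>lborel" k0]) simp
  then show ?thesis unfolding sumJ .
qed

text \<open>For \<open>x < 1\<close> the sum over all \<open>n\<close> of
  \<open>n (1 - x)^2 x^n\<close> is \<open>x\<close>, and its partial sums have a closed form by
  induction. This yields a bound of the discrete symbols that is uniform in mesh and
  frequency.\<close>

lemma weighted_geometric_bound:
  fixes x :: real assumes "0 \<le> x" "x \<le> 1"
  shows "(\<Sum>n\<le>N. real n * ((1 - x)\<^sup>2 * x ^ (2 * n))) \<le> 1"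
proof -
  have "(\<Sum>n\<le>N. real n * ((1 - x)\<^sup>2 * x ^ n)) = x - real (Suc N) * x ^ Suc N + real N * x ^ (N + 2)"
    by (induction N) (simp_all add: algebra_simps power2_eq_square)
  also have "\<dots> \<le> 1"
  proof -
    have "real N * x ^ (N + 2) \<le> real (Suc N) * x ^ Suc N"
      using assms by (intro mult_mono power_decreasing) auto
    then show ?thesis using assms by linarith
  qed
  finally have 1: "(\<Sum>n\<le>N. real n * ((1 - x)\<^sup>2 * x ^ n)) \<le> 1" .
  have "(\<Sum>n\<le>N. real n * ((1 - x)\<^sup>2 * x ^ (2 * n))) \<le> (\<Sum>n\<le>N. real n * ((1 - x)\<^sup>2 * x ^ n))"
    using assms by (intro sum_mono mult_left_mono power_decreasing) auto
  with 1 show ?thesis by linarith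
qed

section \<open>Passage to the limit\<close>

lemma fourier_transform_eq_ft:
  assumes "f \<in> borel_measurable borel" shows "fourier_transform f \<xi> = ft f \<xi>"
  unfolding fourier_transform_def ft_def cis_conv_exp[symmetric]
  using assms by (intro integral_completion) simp

lemma integrable_lebesgue:
  fixes f :: "'a::euclidean_space \<Rightarrow> real"
  assumes "integrable lborel f"
  shows "integrable lebesgue f" and "(\<integral>x. f x \<partial>lebesgue) = (LBINT x. f x)"
  using assms by (auto simp: integrable_completion integral_completion)

lemma borel_imp_lebesgue:
  "f \<in> borel_measurable borel \<Longrightarrow> f \<in> borel_measurable lebesgue"
  by (rule measurable_completion) simp

lemma tame_compact_support:
  fixes g :: "'a::euclidean_space \<Rightarrow> real"
  assumes c: "continuous_on UNIV g" and K: "compact K" and z: "\<And>x. x \<notin> K \<Longrightarrow> g x = 0"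
  shows "tame g"
proof -
  have m: "g \<in> borel_measurable borel" using c by (rule borel_measurable_continuous_onI)
  have "bounded (g ` K)" using compact_continuous_image[OF continuous_on_subset[OF c] K] compact_imp_bounded by auto
  then obtain M where M: "0 < M" "\<And>x. x \<in> K \<Longrightarrow> \<bar>g x\<bar> \<le> M" unfolding bounded_pos by auto
  then have b: "\<bar>g x\<bar> \<le> M * indicator K x" for x using z[of x] by (cases "x \<in> K") auto
  show ?thesis
  proof (rule tameI[OF m])
    show "\<bar>g x\<bar> \<le> M" for x using b[of x] M(1) by (cases "x \<in> K") auto
    show "integrable lborel g"
    proof (rule integrable_bound')
      have "integrable lborel (indicat_real K)"
        using K by (intro integrable_indicator_bounded) (auto simp: compact_imp_bounded compact_imp_closed)
      then show "integrable lborel (\<lambda>x. M * indicator K x)" by simp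
      show "AE x in lborel. norm (g x) \<le> norm (M * indicator K x)"
        using b order_trans[OF abs_ge_zero b] by (intro AE_I2) simp
    qed (use m in simp)
  qed
qed

text \<open>Fatou's lemma, phrased with nonnegative integrals because integrability of the limit is
  to be a consequence.\<close>

lemma nn_integral_limit_le:
  fixes h :: "'a \<Rightarrow> real"
  assumes m: "\<And>n. hs n \<in> borel_measurable M" and h: "h \<in> borel_measurable M"
    and lim: "AE x in M. (\<lambda>n. hs n x) \<longlonglongrightarrow> h x"
    and le: "\<forall>\<^sub>F n in sequentially. (\<integral>\<^sup>+x. ennreal (hs n x) \<partial>M) \<le> c"
  shows "(\<integral>\<^sup>+x. ennreal (h x) \<partial>M) \<le> c"
proof -
  have "AE x in M. ennreal (h x) = liminf (\<lambda>n. ennreal (hs n x))"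
    using lim
  proof eventually_elim
    case (elim x)
    then have "(\<lambda>n. ennreal (hs n x)) \<longlonglongrightarrow> ennreal (h x)" by (rule tendsto_ennrealI)
    then show ?case by (rule lim_imp_Liminf[OF sequentially_bot, symmetric])
  qed
  then have "(\<integral>\<^sup>+x. ennreal (h x) \<partial>M) = (\<integral>\<^sup>+x. liminf (\<lambda>n. ennreal (hs n x)) \<partial>M)"
    by (rule nn_integral_cong_AE)
  also have "\<dots> \<le> liminf (\<lambda>n. \<integral>\<^sup>+x. ennreal (hs n x) \<partial>M)"
    using m by (intro nn_integral_liminf) simp
  also have "\<dots> \<le> liminf (\<lambda>n. c)" by (rule Liminf_mono[OF le])
  also have "\<dots> = c" by (simp add: Liminf_const)
  finally show ?thesis .
qed

lemma gauss_le_1: "gauss x \<le> 1"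
proof -
  have "1 \<le> sqrt (2 * pi)" using pi_gt3 by simp
  then have "(1 / sqrt (2 * pi)) ^ DIM('a) * exp (- (norm (x::'a::euclidean_space))\<^sup>2 / 2) \<le> 1 * 1"
    by (intro mult_mono power_le_one) auto
  then show ?thesis unfolding gauss_eq by simp
qed

lemma gauss_pos: "0 < gauss x"
  unfolding gauss_eq by simp

lemma norm_sum_sq: "(norm (a + b))\<^sup>2 \<le> 2 * (norm a)\<^sup>2 + 2 * (norm b)\<^sup>2"
  for a b :: "'b::real_normed_vector"
proof -
  have "(norm (a + b))\<^sup>2 \<le> (norm a + norm b)\<^sup>2" by (intro power_mono norm_triangle_ineq) auto
  also have "\<dots> \<le> 2 * (norm a)\<^sup>2 + 2 * (norm b)\<^sup>2"
    using sum_squares_bound[of "norm a" "norm b"] by (simp add: power2_sum)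
  finally show ?thesis .
qed

lemma norm_diff_sq: "(norm (a - b))\<^sup>2 \<le> 2 * (norm a)\<^sup>2 + 2 * (norm b)\<^sup>2"
  for a b :: "'b::real_normed_vector"
  using norm_sum_sq[of a "- b"] by simp

lemma integrable_norm_diff_sq:
  fixes f g :: "'a::euclidean_space \<Rightarrow> complex"
  assumes [measurable]: "f \<in> borel_measurable borel" "g \<in> borel_measurable borel"
    and i: "integrable lborel (\<lambda>x. (norm (f x))\<^sup>2)" "integrable lborel (\<lambda>x. (norm (g x))\<^sup>2)"
  shows "integrable lborel (\<lambda>x. (norm (f x - g x))\<^sup>2)"
proof (rule integrable_bound')
  show "integrable lborel (\<lambda>x. 2 * (norm (f x))\<^sup>2 + 2 * (norm (g x))\<^sup>2)" using i by simp
  show "AE x in lborel. norm ((norm (f x - g x))\<^sup>2) \<le> norm (2 * (norm (f x))\<^sup>2 + 2 * (norm (g x))\<^sup>2)"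
    by (intro AE_I2) (simp add: norm_diff_sq)
qed measurable

lemma norm_complex_powr:
  assumes "0 \<le> p" shows "norm (Complex a b) powr p \<le> 2 powr p * (\<bar>a\<bar> powr p + \<bar>b\<bar> powr p)"
proof -
  have "norm (Complex a b) \<le> \<bar>a\<bar> + \<bar>b\<bar>" by (rule order_trans[OF cmod_le]) simp
  also have "\<dots> \<le> 2 * max \<bar>a\<bar> \<bar>b\<bar>" by simp
  finally have "norm (Complex a b) powr p \<le> (2 * max \<bar>a\<bar> \<bar>b\<bar>) powr p" using assms by (intro powr_mono2) auto
  also have "\<dots> = 2 powr p * max \<bar>a\<bar> \<bar>b\<bar> powr p" by (simp add: powr_mult)
  also have "\<dots> \<le> 2 powr p * (\<bar>a\<bar> powr p + \<bar>b\<bar> powr p)"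
    by (intro mult_left_mono) (auto simp: max_def)
  finally show ?thesis .
qed

text \<open>Convergence in \<open>L\<^sup>2\<close> implies \<open>L\<^sup>1\<close> convergence for the weight \<open>gauss\<close>, which gives a limit almost everywhere.\<close>

lemma L2_complete:
  fixes G :: "nat \<Rightarrow> 'a::euclidean_space \<Rightarrow> complex"
  assumes G: "\<And>k. integrable lborel (G k)"
    and G2: "\<And>k. integrable lborel (\<lambda>x. (norm (G k x))\<^sup>2)"
    and cauchy: "\<And>e. 0 < e \<Longrightarrow> \<exists>K. \<forall>i\<ge>K. \<forall>j\<ge>K. (LBINT x. (norm (G i x - G j x))\<^sup>2) < e"
  obtains g r where "g \<in> borel_measurable borel" "strict_mono r" "AE x in lborel. (\<lambda>n. G (r n) x) \<longlonglongrightarrow> g x"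
    "integrable lborel (\<lambda>x. (norm (g x))\<^sup>2)"
    "(\<lambda>k. \<integral>x. (norm (g x - G k x))\<^sup>2 \<partial>lborel) \<longlonglongrightarrow> 0"
proof -
  have [measurable]: "G k \<in> borel_measurable borel" for k using G[of k] by auto
  have D2: "integrable lborel (\<lambda>x. (norm (G i x - G j x))\<^sup>2)" for i j
    by (rule integrable_norm_diff_sq) (use G2 in auto)
  have bd: "integrable lborel (\<lambda>x. gauss x *\<^sub>R G k x)" for k
    by (rule integrable_bound'[OF G[of k]])
      (auto simp: gauss_nonneg gauss_le_1 intro!: AE_I2 mult_left_le_one_le)
  have L1: "\<exists>N. \<forall>i\<ge>N. \<forall>j\<ge>N. (LBINT x. norm (gauss x *\<^sub>R G i x - gauss x *\<^sub>R G j x)) < e" if e: "0 < e" for e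
  proof -
    \<comment> \<open>The threshold is \<open>e^2\<close> in view of the splitting
      \<open>n \<le> e / 2 + n^2 / (2 e)\<close> used below: the first part integrates to
      \<open>e / 2\<close> because \<open>gauss\<close> has mass 1, the second to less than
      \<open>e / 2\<close>.\<close>
    obtain K where K: "\<And>i j. K \<le> i \<Longrightarrow> K \<le> j \<Longrightarrow> (LBINT x. (norm (G i x - G j x))\<^sup>2) < e\<^sup>2"
      using cauchy[of "e\<^sup>2"] e by auto
    have "(LBINT x. norm (gauss x *\<^sub>R G i x - gauss x *\<^sub>R G j x)) < e" if "K \<le> i" "K \<le> j" for i j
    proof -
      have "(LBINT x. norm (gauss x *\<^sub>R G i x - gauss x *\<^sub>R G j x))
        \<le> (LBINT x. e / 2 * gauss x + (norm (G i x - G j x))\<^sup>2 / (2 * e))"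
      proof (rule integral_mono')
        show "integrable lborel (\<lambda>x. e / 2 * gauss x + (norm (G i x - G j x))\<^sup>2 / (2 * e))"
          using D2 by (simp add: gauss_fourier(2))
        show "norm (gauss x *\<^sub>R G i x - gauss x *\<^sub>R G j x) \<le> e / 2 * gauss x + (norm (G i x - G j x))\<^sup>2 / (2 * e)" for x
        proof -
          let ?n = "norm (G i x - G j x)"
          have "2 * e * ?n \<le> e\<^sup>2 + ?n\<^sup>2" by (rule sum_squares_bound)
          then have n: "?n \<le> e / 2 + ?n\<^sup>2 / (2 * e)" using e by (simp add: field_simps power2_eq_square)
          have "norm (gauss x *\<^sub>R G i x - gauss x *\<^sub>R G j x) = gauss x * ?n"
            by (simp add: scaleR_diff_right[symmetric] gauss_nonneg)
          also have "\<dots> \<le> gauss x * (e / 2 + ?n\<^sup>2 / (2 * e))" by (intro mult_left_mono n gauss_nonneg)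
          also have "\<dots> = e / 2 * gauss x + gauss x * (?n\<^sup>2 / (2 * e))" by (simp add: distrib_left mult.commute)
          also have "gauss x * (?n\<^sup>2 / (2 * e)) \<le> 1 * (?n\<^sup>2 / (2 * e))"
            using e by (intro mult_right_mono gauss_le_1) auto
          finally show ?thesis by simp
        qed
      qed (use e in \<open>auto simp: gauss_nonneg intro!: add_nonneg_nonneg\<close>)
      also have "\<dots> = e / 2 + (LBINT x. (norm (G i x - G j x))\<^sup>2) / (2 * e)"
        using D2 by (simp add: gauss_fourier(2,3))
      also have "\<dots> < e" using K[OF that] e by (simp add: field_simps power2_eq_square)
      finally show ?thesis .
    qed
    then show ?thesis by blast
  qed
  obtain r where r: "strict_mono r" and c: "AE x in lborel. Cauchy (\<lambda>i. gauss x *\<^sub>R G (r i) x)"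
    using cauchy_L1_AE_cauchy_subseq[of lborel "\<lambda>k x. gauss x *\<^sub>R G k x", OF bd L1] by blast
  define g where "g x = lim (\<lambda>n. G (r n) x)" for x
  have [measurable]: "g \<in> borel_measurable borel" unfolding g_def[abs_def] by measurable
  have lim: "AE x in lborel. (\<lambda>n. G (r n) x) \<longlonglongrightarrow> g x"
    using c
  proof eventually_elim
    case (elim x)
    then obtain L where "(\<lambda>i. gauss x *\<^sub>R G (r i) x) \<longlonglongrightarrow> L" using Cauchy_convergent convergent_def by blast
    then have "(\<lambda>i. inverse (gauss x) *\<^sub>R (gauss x *\<^sub>R G (r i) x)) \<longlonglongrightarrow> inverse (gauss x) *\<^sub>R L"
      by (intro tendsto_intros)
    then have "convergent (\<lambda>n. G (r n) x)" using gauss_pos[of x] by (auto simp: convergent_def)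
    then show ?case unfolding g_def by (simp add: convergent_LIMSEQ_iff)
  qed
  \<comment> \<open>Fatou's lemma in the first index along the subsequence, the second index being
    fixed: convergence almost everywhere of a subsequence becomes L2 convergence of the whole
    sequence.\<close>
  have fatou: "\<exists>K. \<forall>j\<ge>K. (\<integral>\<^sup>+x. ennreal ((norm (g x - G j x))\<^sup>2) \<partial>lborel) \<le> ennreal e" if e: "0 < e" for e
  proof -
    obtain K where K: "\<And>i j. K \<le> i \<Longrightarrow> K \<le> j \<Longrightarrow> (LBINT x. (norm (G i x - G j x))\<^sup>2) < e"
      using cauchy[OF e] by auto
    have "(\<integral>\<^sup>+x. ennreal ((norm (g x - G j x))\<^sup>2) \<partial>lborel) \<le> ennreal e" if "K \<le> j" for j
    proof (rule nn_integral_limit_le)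
      show "AE x in lborel. (\<lambda>n. (norm (G (r n) x - G j x))\<^sup>2) \<longlonglongrightarrow> (norm (g x - G j x))\<^sup>2"
        using lim by eventually_elim (intro tendsto_intros)
      have "(\<integral>\<^sup>+x. ennreal ((norm (G (r n) x - G j x))\<^sup>2) \<partial>lborel) \<le> ennreal e" if "K \<le> n" for n
        using K[of "r n" j] \<open>K \<le> j\<close> that seq_suble[OF r, of n]
        by (subst nn_integral_eq_integral[OF D2]) (simp_all add: ennreal_leI)
      then show "\<forall>\<^sub>F n in sequentially. (\<integral>\<^sup>+x. ennreal ((norm (G (r n) x - G j x))\<^sup>2) \<partial>lborel) \<le> ennreal e"
        by (intro eventually_sequentiallyI[of K])
    qed measurable
    then show ?thesis by blast
  qed
  have gi: "integrable lborel (\<lambda>x. (norm (g x))\<^sup>2)"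
  proof -
    obtain j where j: "(\<integral>\<^sup>+x. ennreal ((norm (g x - G j x))\<^sup>2) \<partial>lborel) \<le> ennreal 1" using fatou[of 1] by auto
    have "integrable lborel (\<lambda>x. (norm (g x - G j x))\<^sup>2)"
      by (rule integrableI_nonneg) (use j in \<open>auto intro: le_less_trans\<close>)
    then have i: "integrable lborel (\<lambda>x. 2 * (norm (g x - G j x))\<^sup>2 + 2 * (norm (G j x))\<^sup>2)" using G2 by simp
    show ?thesis
    proof (rule integrable_bound'[OF i])
      show "AE x in lborel. norm ((norm (g x))\<^sup>2) \<le> norm (2 * (norm (g x - G j x))\<^sup>2 + 2 * (norm (G j x))\<^sup>2)"
        using norm_sum_sq[of "g x - G j x" "G j x" for x] by (intro AE_I2) simp
    qed simp
  qed
  have gGi: "integrable lborel (\<lambda>x. (norm (g x - G k x))\<^sup>2)" for k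
    by (rule integrable_norm_diff_sq) (use gi G2 in auto)
  have "(\<lambda>k. \<integral>x. (norm (g x - G k x))\<^sup>2 \<partial>lborel) \<longlonglongrightarrow> 0"
  proof (rule LIMSEQ_I)
    fix e :: real assume e: "0 < e"
    obtain K where K: "\<And>j. K \<le> j \<Longrightarrow> (\<integral>\<^sup>+x. ennreal ((norm (g x - G j x))\<^sup>2) \<partial>lborel) \<le> ennreal (e / 2)"
      using fatou[of "e / 2"] e by auto
    have "(LBINT x. (norm (g x - G j x))\<^sup>2) \<le> e / 2" if "K \<le> j" for j
      using K[OF that] e by (subst (asm) nn_integral_eq_integral[OF gGi]) auto
    then show "\<exists>K. \<forall>k\<ge>K. norm ((LBINT x. (norm (g x - G k x))\<^sup>2) - 0) < e"
      using e by (intro exI[of _ K]) fastforce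
  qed
  then show thesis using that[OF _ r lim gi] by simp
qed

text \<open>The truncations \<open>E R\<close> and the approximants \<open>G k\<close> are
  integrable and square integrable, so the Plancherel inequality applies to their difference. The
  distance from \<open>ft (E R)\<close> to \<open>h\<close> is thus bounded by a quantity depending
  on \<open>k\<close> alone plus a multiple of the tail of \<open>g\<close>; \<open>k\<close> is
  fixed first, and then \<open>R\<close> tends to infinity.\<close>

lemma has_L2_fourier_transform_limit:
  fixes g h :: "'a::euclidean_space \<Rightarrow> complex"
  assumes g: "g \<in> borel_measurable borel" "integrable lborel (\<lambda>x. (norm (g x))\<^sup>2)"
    and h: "h \<in> borel_measurable borel" "integrable lborel (\<lambda>x. (norm (h x))\<^sup>2)"
    and G: "\<And>k. integrable lborel (G k)" "\<And>k. integrable lborel (\<lambda>x. (norm (G k x))\<^sup>2)"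
    and lim1: "(\<lambda>k. \<integral>x. (norm (g x - G k x))\<^sup>2 \<partial>lborel) \<longlonglongrightarrow> 0"
    and lim2: "(\<lambda>k. \<integral>\<xi>. (norm (ft (G k) \<xi> - h \<xi>))\<^sup>2 \<partial>lborel) \<longlonglongrightarrow> 0"
  shows "has_L2_fourier_transform g h"
proof -
  note [measurable] = g(1) h(1)
  have [measurable]: "G k \<in> borel_measurable borel" for k using G(1)[of k] by auto
  have p2: "norm z powr 2 = (norm z)\<^sup>2" for z :: complex by simp
  have Lp2: "in_Lp 2 g" "in_Lp 2 h"
    unfolding in_Lp_def p2 using g h by (auto intro: borel_imp_lebesgue integrable_lebesgue)
  define E where "E R = (\<lambda>x. indicator (ball 0 R) x *\<^sub>R g x)" for R
  have [measurable]: "ball (0::'a) R \<in> sets borel" for R by simp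
  have [measurable]: "E R \<in> borel_measurable borel" for R unfolding E_def by measurable
  have Ei: "integrable lborel (E R)" for R
  proof (rule integrable_bound')
    have "integrable lborel (indicat_real (ball (0::'a) R))"
      by (rule integrable_indicator_bounded) auto
    then show "integrable lborel (\<lambda>x. indicat_real (ball (0::'a) R) x + (norm (g x))\<^sup>2)" using g by simp
    have "norm z \<le> 1 + (norm z)\<^sup>2" for z :: complex
      using sum_squares_bound[of "norm z" 1] norm_ge_zero[of z] unfolding power_one mult_1_right by linarith
    then show "AE x in lborel. norm (E R x) \<le> norm (indicat_real (ball (0::'a) R) x + (norm (g x))\<^sup>2)"
      by (intro AE_I2) (auto simp: E_def indicator_def)
  qed simp
  define tail where "tail R = (LBINT x. indicator (- ball 0 R) x * (norm (g x))\<^sup>2)" for R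
  have taili: "integrable lborel (\<lambda>x. indicator (- ball 0 R) x * (norm (g x))\<^sup>2)" for R
    by (rule integrable_bound'[OF g(2)]) (auto simp: indicator_def)
  have tail0: "(tail \<longlongrightarrow> 0) at_top"
  proof -
    have "((\<lambda>R. tail R) \<longlongrightarrow> integral\<^sup>L (lborel :: 'a measure) (\<lambda>x. 0)) at_top"
      unfolding tail_def
    proof (rule integral_dominated_convergence_at_top[OF _ _ g(2)])
      show "\<forall>\<^sub>F R in at_top. AE x in lborel. norm (indicator (- ball 0 R) x * (norm (g x))\<^sup>2) \<le> (norm (g x))\<^sup>2"
        by (auto simp: indicator_def)
      show "AE x in lborel. ((\<lambda>R. indicator (- ball 0 R) x * (norm (g x))\<^sup>2) \<longlongrightarrow> 0) at_top"
      proof (intro AE_I2 tendsto_eventually)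
        fix x :: 'a
        show "\<forall>\<^sub>F R in at_top. indicator (- ball 0 R) x * (norm (g x))\<^sup>2 = 0"
          using eventually_gt_at_top[of "norm x"] by eventually_elim (simp add: indicator_def)
      qed
    qed auto
    then show ?thesis by simp
  qed
  define c where "c = (2 * pi) ^ DIM('a)"
  have c: "0 < c" by (simp add: c_def)
  \<comment> \<open>The square of a sum is split once on the Fourier side and once on the side of
    \<open>g\<close>, each time at the cost of a factor 2; hence \<open>4 * c\<close>.\<close>
  define A where "A k = 4 * c * (LBINT x. (norm (g x - G k x))\<^sup>2) + 2 * (LBINT \<xi>. (norm (ft (G k) \<xi> - h \<xi>))\<^sup>2)" for k
  have A0: "A \<longlonglongrightarrow> 0"
  proof -
    have "A \<longlonglongrightarrow> 4 * c * 0 + 2 * 0" unfolding A_def by (intro tendsto_intros lim1 lim2)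
    then show ?thesis by simp
  qed
  have main: "(\<integral>\<^sup>+\<xi>. ennreal ((norm (ft (E R) \<xi> - h \<xi>))\<^sup>2) \<partial>lborel) \<le> ennreal (A k + 4 * c * tail R)" for R k
  proof -
    let ?D = "\<lambda>x. E R x - G k x"
    have gGi: "integrable lborel (\<lambda>x. (norm (g x - G k x))\<^sup>2)"
      by (rule integrable_norm_diff_sq) (use g G in auto)
    \<comment> \<open>Inside the ball the difference is \<open>g - G k\<close>; outside it is
      \<open>- G k = (g - G k) - g\<close>, which produces the tail.\<close>
    have Db: "(norm (?D x))\<^sup>2 \<le> 2 * (norm (g x - G k x))\<^sup>2 + 2 * (indicator (- ball 0 R) x * (norm (g x))\<^sup>2)" for x
      using norm_sum_sq[of "g x - G k x" "- g x"] by (cases "x \<in> ball 0 R") (auto simp: E_def)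
    have bi: "integrable lborel (\<lambda>x. 2 * (norm (g x - G k x))\<^sup>2 + 2 * (indicator (- ball 0 R) x * (norm (g x))\<^sup>2))"
      using gGi taili by simp
    have D: "integrable lborel ?D" using Ei G by simp
    have D2: "integrable lborel (\<lambda>x. (norm (?D x))\<^sup>2)"
    proof (rule integrable_bound'[OF bi])
      show "AE x in lborel. norm ((norm (?D x))\<^sup>2) \<le> norm (2 * (norm (g x - G k x))\<^sup>2 + 2 * (indicator (- ball 0 R) x * (norm (g x))\<^sup>2))"
        using Db by (intro AE_I2) (simp add: order_trans[OF Db])
    qed simp
    have D2le: "(LBINT x. (norm (?D x))\<^sup>2) \<le> 2 * (LBINT x. (norm (g x - G k x))\<^sup>2) + 2 * tail R"
    proof -
      have "(LBINT x. (norm (?D x))\<^sup>2) \<le> (LBINT x. 2 * (norm (g x - G k x))\<^sup>2 + 2 * (indicator (- ball 0 R) x * (norm (g x))\<^sup>2))"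
        by (intro integral_mono D2 bi Db)
      also have "\<dots> = 2 * (LBINT x. (norm (g x - G k x))\<^sup>2) + 2 * tail R"
        unfolding tail_def using gGi taili by simp
      finally show ?thesis .
    qed
    have ftD: "ft (E R) \<xi> - h \<xi> = ft ?D \<xi> + (ft (G k) \<xi> - h \<xi>)" for \<xi>
      unfolding ft_def left_diff_distrib
      using integrable_mult_cis[OF Ei] integrable_mult_cis[OF G(1)] by simp
    have i1: "integrable lborel (\<lambda>\<xi>. (norm (ft ?D \<xi>))\<^sup>2)" by (rule plancherel_le(1)[OF D D2])
    have i2: "integrable lborel (\<lambda>\<xi>. (norm (ft (G k) \<xi> - h \<xi>))\<^sup>2)"
      by (rule integrable_norm_diff_sq) (use plancherel_le(1)[OF G(1) G(2)] h in auto)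
    have "(\<integral>\<^sup>+\<xi>. ennreal ((norm (ft (E R) \<xi> - h \<xi>))\<^sup>2) \<partial>lborel)
      \<le> (\<integral>\<^sup>+\<xi>. ennreal (2 * (norm (ft ?D \<xi>))\<^sup>2 + 2 * (norm (ft (G k) \<xi> - h \<xi>))\<^sup>2) \<partial>lborel)"
      unfolding ftD by (intro nn_integral_mono ennreal_leI norm_sum_sq)
    also have "\<dots> = ennreal (2 * (LBINT \<xi>. (norm (ft ?D \<xi>))\<^sup>2) + 2 * (LBINT \<xi>. (norm (ft (G k) \<xi> - h \<xi>))\<^sup>2))"
      using i1 i2 by (subst nn_integral_eq_integral) auto
    also have "\<dots> \<le> ennreal (A k + 4 * c * tail R)"
    proof (rule ennreal_leI)
      have "(LBINT \<xi>. (norm (ft ?D \<xi>))\<^sup>2) \<le> c * (LBINT x. (norm (?D x))\<^sup>2)"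
        unfolding c_def by (rule plancherel_le(2)[OF D D2])
      also have "\<dots> \<le> c * (2 * (LBINT x. (norm (g x - G k x))\<^sup>2) + 2 * tail R)"
        using D2le c by (intro mult_left_mono) auto
      finally show "2 * (LBINT \<xi>. (norm (ft ?D \<xi>))\<^sup>2) + 2 * (LBINT \<xi>. (norm (ft (G k) \<xi> - h \<xi>))\<^sup>2) \<le> A k + 4 * c * tail R"
        unfolding A_def by (simp add: algebra_simps)
    qed
    finally show ?thesis .
  qed
  have "((\<lambda>R. \<integral>\<^sup>+\<xi>. ennreal ((norm (ft (E R) \<xi> - h \<xi>))\<^sup>2) \<partial>lborel) \<longlongrightarrow> 0) at_top"
  proof (rule order_tendstoI)
    fix a :: ennreal assume a: "0 < a"
    obtain e where e: "0 < e" "ennreal e < a"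
    proof (cases a)
      case (real t)
      then show thesis using a that[of "t / 2"] by (auto simp: ennreal_less_iff)
    qed (use that[of 1] in auto)
    obtain k where k: "A k < e / 2"
      using eventually_happens[OF order_tendstoD(2)[OF A0, of "e / 2"]] e by auto
    have "((\<lambda>R. 4 * c * tail R) \<longlongrightarrow> 4 * c * 0) at_top" by (intro tendsto_intros tail0)
    then have "\<forall>\<^sub>F R in at_top. 4 * c * tail R < e / 2" using e by (intro order_tendstoD) auto
    then show "\<forall>\<^sub>F R in at_top. (\<integral>\<^sup>+\<xi>. ennreal ((norm (ft (E R) \<xi> - h \<xi>))\<^sup>2) \<partial>lborel) < a"
    proof eventually_elim
      case (elim R)
      have "ennreal (A k + 4 * c * tail R) \<le> ennreal e" using elim k by (intro ennreal_leI) simp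
      then show ?case using main[of R k] e(2) by (meson le_less_trans order_trans)
    qed
  qed simp
  moreover have "(\<integral>\<^sup>+\<xi>. ennreal ((norm (fourier_transform (\<lambda>x. indicator (ball 0 R) x *\<^sub>R g x) \<xi> - h \<xi>))\<^sup>2) \<partial>lebesgue)
     = (\<integral>\<^sup>+\<xi>. ennreal ((norm (ft (E R) \<xi> - h \<xi>))\<^sup>2) \<partial>lborel)" for R
  proof -
    have "fourier_transform (E R) \<xi> = ft (E R) \<xi>" for \<xi> by (rule fourier_transform_eq_ft) simp
    then show ?thesis unfolding E_def[symmetric] by (simp add: nn_integral_completion)
  qed
  ultimately show ?thesis unfolding has_L2_fourier_transform_def using Lp2 by simp
qed

text \<open>Dominated convergence of the symbols and Plancherel's formula make the approximants
  converge in L2, which identifies the Fourier transform of the limit. A subsequence converges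
  almost everywhere to the same function, and along it Fatou's lemma hands on the uniform bound in
  Lp.\<close>

lemma Lp_multiplier_limit:
  fixes m :: "'a::euclidean_space \<Rightarrow> real" and mk :: "nat \<Rightarrow> 'a \<Rightarrow> real"
    and T :: "nat \<Rightarrow> ('a \<Rightarrow> real) \<Rightarrow> 'a \<Rightarrow> real"
  assumes p: "1 < p" and C: "0 \<le> C"
    and mk: "\<And>k. mk k \<in> borel_measurable borel" and B: "\<And>k \<xi>. \<bar>mk k \<xi>\<bar> \<le> B"
    and lim: "\<And>\<xi>. \<xi> \<noteq> 0 \<Longrightarrow> (\<lambda>k. mk k \<xi>) \<longlonglongrightarrow> m \<xi>"
    and T: "\<And>k f. tame f \<Longrightarrow> tame (T k f)"
    and Tc: "\<And>k f. tame f \<Longrightarrow> continuous_on UNIV f \<Longrightarrow> continuous_on UNIV (T k f)"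
    and Tft: "\<And>k f \<xi>. tame f \<Longrightarrow> ft (\<lambda>x. of_real (T k f x)) \<xi> = of_real (mk k \<xi>) * ft (\<lambda>x. of_real (f x)) \<xi>"
    and TLp: "\<And>k f. tame f \<Longrightarrow> (LBINT x. \<bar>T k f x\<bar> powr p) \<le> C * (LBINT x. \<bar>f x\<bar> powr p)"
  shows "Lp_multiplier p (\<lambda>\<xi>. complex_of_real (m \<xi>))"
proof -
  note [measurable] = mk
  have B0: "0 \<le> B" using B[of 0 0] by linarith
  have [measurable]: "m \<in> borel_measurable borel"
  proof -
    have "m \<xi> = (if \<xi> = 0 then m 0 else lim (\<lambda>k. mk k \<xi>))" for \<xi>
      using limI[OF lim[of \<xi>]] by auto
    then have "m = (\<lambda>\<xi>. if \<xi> = 0 then m 0 else lim (\<lambda>k. mk k \<xi>))" by blast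
    moreover have "(\<lambda>\<xi>. if \<xi> = 0 then m 0 else lim (\<lambda>k. mk k \<xi>)) \<in> borel_measurable borel" by measurable
    ultimately show ?thesis by simp
  qed
  have mB: "\<bar>m \<xi>\<bar> \<le> B" if "\<xi> \<noteq> 0" for \<xi>
    using tendsto_rabs[OF lim[OF that]] B by (intro LIMSEQ_le_const2[of "\<lambda>k. \<bar>mk k \<xi>\<bar>"]) auto
  have ne0: "AE \<xi> in lborel. \<xi> \<noteq> (0::'a)" by (rule AE_lborel_singleton)
  have norm_AE: "AE \<xi> in lebesgue. norm (complex_of_real (m \<xi>)) \<le> B"
    by (rule AE_completion, use ne0 in eventually_elim) (use mB in simp)
  \<comment> \<open>\<open>2 powr p\<close> is the constant of \<open>norm_complex_powr\<close>, and
    \<open>2 * C\<close> adds the bounds for real and imaginary part, because the operators act on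
    real functions.\<close>
  define Q where "Q = (2 powr p * (2 * C)) powr (1 / p)"
  have "\<exists>g. has_L2_fourier_transform g (\<lambda>\<xi>. of_real (m \<xi>) * fourier_transform f \<xi>) \<and>
        in_Lp p g \<and> Lp_norm p g \<le> Q * Lp_norm p f" if f: "f \<in> Cc_infinity" for f :: "'a \<Rightarrow> complex"
  proof -
    have "times_differentiable 0 f" using f unfolding Cc_infinity_def by blast
    then have fc: "continuous_on UNIV f" by simp
    define K where "K = closure {x. f x \<noteq> 0}"
    have K: "compact K" using f unfolding Cc_infinity_def K_def by blast
    have fK: "f x = 0" if "x \<notin> K" for x using that closure_subset[of "{x. f x \<noteq> 0}"] by (auto simp: K_def)
    define u v where "u x = Re (f x)" and "v x = Im (f x)" for x
    have uc: "continuous_on UNIV u" "continuous_on UNIV v"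
      unfolding u_def v_def by (intro continuous_intros fc)+
    have u: "tame u" and v: "tame v"
      using fK by (auto intro!: tame_compact_support[OF _ K] uc simp: u_def v_def)
    have fuv: "f x = of_real (u x) + \<i> * of_real (v x)" for x by (simp add: complex_eq_iff u_def v_def)
    have cint: "integrable lborel (\<lambda>x. of_real (a x) + \<i> * of_real (b x))" if "tame a" "tame b" for a b :: "'a \<Rightarrow> real"
      using tame_integrable[OF that(1)] tame_integrable[OF that(2)] by simp
    have cbd: "\<exists>M. \<forall>x. norm (of_real (a x) + \<i> * of_real (b x)) \<le> M" if ab: "tame a" "tame b" for a b :: "'a \<Rightarrow> real"
    proof -
      obtain M N where "\<And>x. \<bar>a x\<bar> \<le> M" "\<And>x. \<bar>b x\<bar> \<le> N" using tame_bound[OF ab(1)] tame_bound[OF ab(2)] by metis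
      then have "norm (of_real (a x) + \<i> * of_real (b x)) \<le> M + N" for x
        by (intro norm_triangle_le add_mono) (auto simp: norm_mult)
      then show ?thesis by blast
    qed
    have cft: "ft (\<lambda>x. of_real (a x) + \<i> * of_real (b x)) \<xi> = ft (\<lambda>x. of_real (a x)) \<xi> + \<i> * ft (\<lambda>x. of_real (b x)) \<xi>"
      if "tame a" "tame b" for a b :: "'a \<Rightarrow> real" and \<xi>
    proof -
      have "integrable lborel (\<lambda>x. of_real (a x) * cis (\<xi> \<bullet> x))" "integrable lborel (\<lambda>x. of_real (b x) * cis (\<xi> \<bullet> x))"
        using tame_integrable[OF that(1)] tame_integrable[OF that(2)] by (auto intro!: integrable_mult_cis)
      then show ?thesis by (simp add: ft_def distrib_right mult.assoc)
    qed
    define G where "G k x = complex_of_real (T k u x) + \<i> * of_real (T k v x)" for k x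
    have tG: "tame (T k u)" "tame (T k v)" for k using u v T by auto
    have Gi: "integrable lborel (G k)" for k unfolding G_def by (rule cint[OF tG])
    have Gc: "continuous_on UNIV (G k)" for k
      unfolding G_def by (intro continuous_intros Tc u v uc)
    have Gb: "\<exists>M. \<forall>x. norm (G k x) \<le> M" for k unfolding G_def by (rule cbd[OF tG])
    have G2: "integrable lborel (\<lambda>x. (norm (G k x))\<^sup>2)" for k
      using plancherel_eq(1)[OF Gi Gc] Gb[of k] by blast
    have fi: "integrable lborel f" using cint[OF u v] unfolding fuv[symmetric] .
    have f2: "integrable lborel (\<lambda>x. (norm (f x))\<^sup>2)"
      using plancherel_eq(1)[OF fi fc] cbd[OF u v] unfolding fuv[symmetric] by blast
    have [measurable]: "f \<in> borel_measurable borel" using fi by auto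
    have [measurable]: "G k \<in> borel_measurable borel" for k using Gi[of k] by auto
    have F2: "integrable lborel (\<lambda>\<xi>. (norm (ft f \<xi>))\<^sup>2)" by (rule plancherel_le(1)[OF fi f2])
    have Gft: "ft (G k) \<xi> = of_real (mk k \<xi>) * ft f \<xi>" for k \<xi>
    proof -
      have "ft f \<xi> = ft (\<lambda>x. of_real (u x)) \<xi> + \<i> * ft (\<lambda>x. of_real (v x)) \<xi>"
        using cft[OF u v] unfolding fuv[symmetric] .
      then show ?thesis unfolding G_def cft[OF tG] by (simp add: Tft u v algebra_simps)
    qed
    define h where "h \<xi> = complex_of_real (m \<xi>) * ft f \<xi>" for \<xi>
    have [measurable]: "h \<in> borel_measurable borel" unfolding h_def by measurable
    have h2: "integrable lborel (\<lambda>\<xi>. (norm (h \<xi>))\<^sup>2)"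
    proof (rule integrable_bound')
      show "integrable lborel (\<lambda>\<xi>. B\<^sup>2 * (norm (ft f \<xi>))\<^sup>2)" using F2 by simp
      show "AE \<xi> in lborel. norm ((norm (h \<xi>))\<^sup>2) \<le> norm (B\<^sup>2 * (norm (ft f \<xi>))\<^sup>2)"
        using ne0
      proof eventually_elim
        case (elim \<xi>)
        have "(norm (h \<xi>))\<^sup>2 = \<bar>m \<xi>\<bar>\<^sup>2 * (norm (ft f \<xi>))\<^sup>2" by (simp add: h_def norm_mult power_mult_distrib)
        also have "\<dots> \<le> B\<^sup>2 * (norm (ft f \<xi>))\<^sup>2" using mB[OF elim] by (intro mult_right_mono power_mono) auto
        finally show ?case by simp
      qed
    qed measurable
    have lim2: "(\<lambda>k. \<integral>\<xi>. (norm (ft (G k) \<xi> - h \<xi>))\<^sup>2 \<partial>lborel) \<longlonglongrightarrow> 0"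
    proof -
      have "(\<lambda>k. \<integral>\<xi>. (norm (ft (G k) \<xi> - h \<xi>))\<^sup>2 \<partial>lborel) \<longlonglongrightarrow> integral\<^sup>L (lborel :: 'a measure) (\<lambda>\<xi>. 0)"
      proof (rule integral_dominated_convergence)
        show "integrable lborel (\<lambda>\<xi>. (2 * B)\<^sup>2 * (norm (ft f \<xi>))\<^sup>2)" using F2 by simp
        have d: "(norm (ft (G k) \<xi> - h \<xi>))\<^sup>2 = \<bar>mk k \<xi> - m \<xi>\<bar>\<^sup>2 * (norm (ft f \<xi>))\<^sup>2" for k \<xi>
        proof -
          have "ft (G k) \<xi> - h \<xi> = of_real (mk k \<xi> - m \<xi>) * ft f \<xi>"
            unfolding Gft h_def by (simp add: left_diff_distrib)
          then show ?thesis by (simp only: norm_mult norm_of_real power_mult_distrib)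
        qed
        show "AE \<xi> in lborel. norm ((norm (ft (G k) \<xi> - h \<xi>))\<^sup>2) \<le> (2 * B)\<^sup>2 * (norm (ft f \<xi>))\<^sup>2" for k
          using ne0
        proof eventually_elim
          case (elim \<xi>)
          have "\<bar>mk k \<xi> - m \<xi>\<bar> \<le> 2 * B" using mB[OF elim] B[of k \<xi>] by linarith
          then have "\<bar>mk k \<xi> - m \<xi>\<bar>\<^sup>2 * (norm (ft f \<xi>))\<^sup>2 \<le> (2 * B)\<^sup>2 * (norm (ft f \<xi>))\<^sup>2"
            by (intro mult_right_mono power_mono) auto
          then show ?case unfolding d by (simp add: abs_mult)
        qed
        show "AE \<xi> in lborel. (\<lambda>k. (norm (ft (G k) \<xi> - h \<xi>))\<^sup>2) \<longlonglongrightarrow> 0"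
          using ne0
        proof eventually_elim
          case (elim \<xi>)
          have "(\<lambda>k. \<bar>mk k \<xi> - m \<xi>\<bar>\<^sup>2 * (norm (ft f \<xi>))\<^sup>2) \<longlonglongrightarrow> \<bar>m \<xi> - m \<xi>\<bar>\<^sup>2 * (norm (ft f \<xi>))\<^sup>2"
            by (intro tendsto_intros lim elim)
          then show ?case unfolding d by simp
        qed
      qed measurable
      then show ?thesis by simp
    qed
    define c where "c = (2 * pi) ^ DIM('a)"
    have c: "0 < c" by (simp add: c_def)
    have cauchy: "\<exists>K. \<forall>i\<ge>K. \<forall>j\<ge>K. (LBINT x. (norm (G i x - G j x))\<^sup>2) < e" if e: "0 < e" for e
    proof -
      define a where "a k = (LBINT \<xi>. (norm (ft (G k) \<xi> - h \<xi>))\<^sup>2)" for k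
      have ai: "integrable lborel (\<lambda>\<xi>. (norm (ft (G k) \<xi> - h \<xi>))\<^sup>2)" for k
        by (rule integrable_norm_diff_sq) (use plancherel_le(1)[OF Gi G2] h2 in auto)
      have "0 < c * e / 4" using c e by simp
      then obtain K where aK: "\<And>k. K \<le> k \<Longrightarrow> a k < c * e / 4"
        using order_tendstoD(2)[OF lim2, of "c * e / 4"] unfolding a_def eventually_sequentially by blast
      have "(LBINT x. (norm (G i x - G j x))\<^sup>2) < e" if "K \<le> i" "K \<le> j" for i j
      proof -
        have Di: "integrable lborel (\<lambda>x. G i x - G j x)" using Gi by simp
        have Dc: "continuous_on UNIV (\<lambda>x. G i x - G j x)" by (intro continuous_intros Gc)
        obtain M N where "\<And>x. norm (G i x) \<le> M" "\<And>x. norm (G j x) \<le> N" using Gb by meson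
        then have Db: "norm (G i x - G j x) \<le> M + N" for x by (intro norm_triangle_le_diff add_mono)
        have D2: "integrable lborel (\<lambda>x. (norm (G i x - G j x))\<^sup>2)" by (rule plancherel_eq(1)[OF Di Dc Db])
        \<comment> \<open>Here the L2 distance has to be bounded by the distance of the transforms,
          the direction that \<open>plancherel_le\<close> does not give; continuity of the
          approximants makes the equality available.\<close>
        have "c * (LBINT x. (norm (G i x - G j x))\<^sup>2) = (LBINT \<xi>. (norm (ft (\<lambda>x. G i x - G j x) \<xi>))\<^sup>2)"
          unfolding c_def by (rule plancherel_eq(2)[OF Di Dc Db, symmetric])
        also have "\<dots> \<le> (LBINT \<xi>. 2 * (norm (ft (G i) \<xi> - h \<xi>))\<^sup>2 + 2 * (norm (ft (G j) \<xi> - h \<xi>))\<^sup>2)"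
        proof (rule integral_mono[OF plancherel_le(1)[OF Di D2]])
          show "integrable lborel (\<lambda>\<xi>. 2 * (norm (ft (G i) \<xi> - h \<xi>))\<^sup>2 + 2 * (norm (ft (G j) \<xi> - h \<xi>))\<^sup>2)"
            using ai by simp
          fix \<xi>
          have "ft (\<lambda>x. G i x - G j x) \<xi> = (ft (G i) \<xi> - h \<xi>) - (ft (G j) \<xi> - h \<xi>)"
            unfolding ft_def left_diff_distrib using integrable_mult_cis[OF Gi] by simp
          then show "(norm (ft (\<lambda>x. G i x - G j x) \<xi>))\<^sup>2 \<le> 2 * (norm (ft (G i) \<xi> - h \<xi>))\<^sup>2 + 2 * (norm (ft (G j) \<xi> - h \<xi>))\<^sup>2"
            by (simp only: norm_diff_sq)
        qed
        also have "\<dots> = 2 * a i + 2 * a j" unfolding a_def using ai by simp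
        also have "\<dots> < c * e" using aK[OF that(1)] aK[OF that(2)] by linarith
        finally show ?thesis using c by simp
      qed
      then show ?thesis by blast
    qed
    obtain g r where [measurable]: "g \<in> borel_measurable borel" and r: "strict_mono r"
      and glim: "AE x in lborel. (\<lambda>n. G (r n) x) \<longlonglongrightarrow> g x"
      and g2: "integrable lborel (\<lambda>x. (norm (g x))\<^sup>2)"
      and lim1: "(\<lambda>k. \<integral>x. (norm (g x - G k x))\<^sup>2 \<partial>lborel) \<longlonglongrightarrow> 0"
    proof (rule L2_complete[OF Gi G2])
      show "0 < e \<Longrightarrow> \<exists>K. \<forall>i\<ge>K. \<forall>j\<ge>K. (LBINT x. (norm (G i x - G j x))\<^sup>2) < e" for e
        by (rule cauchy)
    qed (rule that)
    have L2: "has_L2_fourier_transform g (\<lambda>\<xi>. of_real (m \<xi>) * fourier_transform f \<xi>)"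
    proof -
      have "has_L2_fourier_transform g h"
        by (rule has_L2_fourier_transform_limit[OF _ g2 _ h2 Gi G2 lim1 lim2]) measurable
      moreover have "fourier_transform f = ft f" using fourier_transform_eq_ft[of f] by auto
      ultimately show ?thesis by (simp add: h_def[abs_def])
    qed
    define Y where "Y = (LBINT x. norm (f x) powr p)"
    have Y0: "0 \<le> Y" by (simp add: Y_def)
    have fp: "integrable lborel (\<lambda>x. norm (f x) powr p)"
    proof (rule integrable_bound')
      show "integrable lborel (\<lambda>x. 2 powr p * (\<bar>u x\<bar> powr p + \<bar>v x\<bar> powr p))"
        using p by (intro tame_integrable tame_cmult tame_add tame_powr u v) auto
      show "AE x in lborel. norm (norm (f x) powr p) \<le> norm (2 powr p * (\<bar>u x\<bar> powr p + \<bar>v x\<bar> powr p))"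
        using p norm_complex_powr[of p "u x" "v x" for x] by (intro AE_I2) (simp add: u_def v_def)
    qed measurable
    have le: "(LBINT x. norm (G k x) powr p) \<le> 2 powr p * (2 * C) * Y"
      and Gp: "integrable lborel (\<lambda>x. norm (G k x) powr p)" for k
    proof -
      have GC: "G k x = Complex (T k u x) (T k v x)" for x by (simp add: G_def complex_eq_iff)
      let ?b = "\<lambda>x. 2 powr p * (\<bar>T k u x\<bar> powr p + \<bar>T k v x\<bar> powr p)"
      have bi: "integrable lborel ?b"
        using p by (intro tame_integrable tame_cmult tame_add tame_powr tG) auto
      have b: "norm (G k x) powr p \<le> ?b x" for x
        unfolding GC using p by (intro norm_complex_powr) simp
      show Gp: "integrable lborel (\<lambda>x. norm (G k x) powr p)"
      proof (rule integrable_bound'[OF bi])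
        show "AE x in lborel. norm (norm (G k x) powr p) \<le> norm (?b x)" using b by (intro AE_I2) simp
      qed measurable
      have fu: "(LBINT x. \<bar>u x\<bar> powr p) \<le> Y" "(LBINT x. \<bar>v x\<bar> powr p) \<le> Y"
      proof -
        have "\<bar>u x\<bar> powr p \<le> norm (f x) powr p" "\<bar>v x\<bar> powr p \<le> norm (f x) powr p" for x
          using p by (auto intro!: powr_mono2 simp: u_def v_def abs_Re_le_cmod abs_Im_le_cmod)
        then show "(LBINT x. \<bar>u x\<bar> powr p) \<le> Y" "(LBINT x. \<bar>v x\<bar> powr p) \<le> Y"
          unfolding Y_def using p by (intro integral_mono fp tame_integrable tame_powr u v; simp)+
      qed
      have "(LBINT x. norm (G k x) powr p) \<le> (LBINT x. ?b x)" by (intro integral_mono Gp bi b)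
      also have "\<dots> = 2 powr p * ((LBINT x. \<bar>T k u x\<bar> powr p) + (LBINT x. \<bar>T k v x\<bar> powr p))"
        using p tame_integrable[OF tame_powr[OF tG(1), of p]] tame_integrable[OF tame_powr[OF tG(2), of p]] by simp
      also have "\<dots> \<le> 2 powr p * (C * Y + C * Y)"
        using TLp[OF u, of k] TLp[OF v, of k] mult_left_mono[OF fu(1) C] mult_left_mono[OF fu(2) C]
        by (intro mult_left_mono) auto
      finally show "(LBINT x. norm (G k x) powr p) \<le> 2 powr p * (2 * C) * Y" by (simp add: algebra_simps)
    qed
    have gp: "(\<integral>\<^sup>+x. ennreal (norm (g x) powr p) \<partial>lborel) \<le> ennreal (2 powr p * (2 * C) * Y)"
    proof (rule nn_integral_limit_le)
      show "AE x in lborel. (\<lambda>n. norm (G (r n) x) powr p) \<longlonglongrightarrow> norm (g x) powr p"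
        using glim
      proof eventually_elim
        case (elim x)
        show ?case using p by (intro tendsto_powr' tendsto_norm elim tendsto_const) auto
      qed
      show "\<forall>\<^sub>F n in sequentially. (\<integral>\<^sup>+x. ennreal (norm (G (r n) x) powr p) \<partial>lborel) \<le> ennreal (2 powr p * (2 * C) * Y)"
      proof (intro always_eventually allI)
        show "(\<integral>\<^sup>+x. ennreal (norm (G (r n) x) powr p) \<partial>lborel) \<le> ennreal (2 powr p * (2 * C) * Y)" for n
          using le[of "r n"] by (subst nn_integral_eq_integral[OF Gp]) (auto intro: ennreal_leI)
      qed
    qed measurable
    have gpi: "integrable lborel (\<lambda>x. norm (g x) powr p)"
      by (rule integrableI_nonneg) (use gp in \<open>auto intro: le_less_trans\<close>)
    have gle: "(LBINT x. norm (g x) powr p) \<le> 2 powr p * (2 * C) * Y"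
      using gp C Y0 by (subst (asm) nn_integral_eq_integral[OF gpi]) auto
    have inLp: "in_Lp p g" unfolding in_Lp_def using gpi by (auto intro: borel_imp_lebesgue integrable_lebesgue)
    have "Lp_norm p g \<le> (2 powr p * (2 * C) * Y) powr (1 / p)"
      unfolding Lp_norm_def integrable_lebesgue(2)[OF gpi] using gle p by (intro powr_mono2) auto
    also have "\<dots> = Q * Lp_norm p f"
      unfolding Lp_norm_def integrable_lebesgue(2)[OF fp] Q_def Y_def[symmetric] using C Y0 by (simp add: powr_mult)
    finally show ?thesis using L2 inLp by blast
  qed
  moreover have "(\<lambda>\<xi>. complex_of_real (m \<xi>)) \<in> borel_measurable lebesgue"
    by (rule borel_imp_lebesgue) measurable
  ultimately show ?thesis unfolding Lp_multiplier_def using norm_AE by blast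
qed

theorem corollary3p2:
  fixes \<alpha> p c :: real
    and r :: "real \<Rightarrow> real"
    and m :: "real ^ 'd \<Rightarrow> real"
  assumes "0 < \<alpha>" "\<alpha> < 1"
    and "1 < p"
    and "r \<in> borel_measurable (restrict_space borel {0<..})"
    and "bounded (r ` {0<..})"
    and "0 < c"
    and "\<And>\<xi>. \<xi> \<noteq> 0 \<Longrightarrow>
      m \<xi> = c * norm \<xi> powr \<alpha> *
        (LBINT t:{0<..}. t * r t * exp (- 2 * t * norm \<xi> powr (\<alpha> / 2)))"
  shows "Lp_multiplier p (\<lambda>\<xi>. complex_of_real (m \<xi>))"
proof -
  \<comment> \<open>With \<open>2 * d = \<alpha> / 2\<close> the quotient of
    \<open>1 - down_symbol\<close> by the mesh tends to
    \<open>s = norm \<xi> powr (\<alpha> / 2)\<close>, and \<open>s^2\<close> is the factor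
    \<open>norm \<xi> powr \<alpha>\<close> of \<open>m\<close>.\<close>
  define d where "d = \<alpha> / 4"
  have d: "0 < d" "d \<le> 1/2" "2 * d = \<alpha> / 2" using assms(1,2) by (auto simp: d_def)
  \<comment> \<open>\<open>r\<close> is controlled only on the positive half line; extension by 0
    gives a bounded Borel function on the whole line with the same integrals there.\<close>
  define r0 where "r0 t = indicator {0<..} t * r t" for t
  have r0m: "r0 \<in> borel_measurable borel"
    using assms(4) unfolding r0_def[abs_def]
    by (subst (asm) borel_measurable_restrict_space_iff) (auto simp: mult.commute)
  obtain R where R: "0 < R" "\<And>t. 0 < t \<Longrightarrow> \<bar>r t\<bar> \<le> R"
    using assms(5) unfolding bounded_pos by auto
  then have r0b: "\<bar>r0 t\<bar> \<le> R" for t by (auto simp: r0_def indicator_def)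
  \<comment> \<open>With \<open>t = n * mesh\<close> and \<open>dt = mesh\<close>, the factor
    \<open>mesh^2\<close> of \<open>t dt\<close> is already contained in the square of
    \<open>1 - down_symbol\<close>. The weights are therefore bounded by a multiple of
    \<open>n\<close> that does not depend on the mesh.\<close>
  define \<rho> where "\<rho> k n = c * (real n * local_average r0 k n)" for k n
  have \<rho>: "\<bar>\<rho> k n\<bar> \<le> (c * R) * real n" for k n
    using local_average_bound[OF r0m r0b, of k n] assms(6)
    by (simp add: \<rho>_def abs_mult mult.commute[of R] mult.assoc mult_left_mono)
  have cR: "0 < c * R" using assms(6) R by simp
  define e where "e = lattice_step d TYPE(real ^ 'd)"
  define mk where "mk k \<xi> = (\<Sum>n\<le>(Suc k)\<^sup>2. \<rho> k n * ((1 - down_symbol d (e k) \<xi>)\<^sup>2 * down_symbol d (e k) \<xi> ^ (2 * n)))"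
    for k and \<xi> :: "real ^ 'd"
  define C where "C = (2 * (c * R * (bellman_const (min p (p / (p - 1))) / 2))) powr p"
  define P where "P k T \<longleftrightarrow> (\<forall>f. tame f \<longrightarrow> tame (T f)) \<and>
    (\<forall>f. tame f \<longrightarrow> continuous_on UNIV f \<longrightarrow> continuous_on UNIV (T f)) \<and>
    (\<forall>f \<xi>. tame f \<longrightarrow> ft (\<lambda>x. of_real (T f x)) \<xi> = of_real (mk k \<xi>) * ft (\<lambda>x. of_real (f x)) \<xi>) \<and>
    (\<forall>f. tame f \<longrightarrow> (LBINT x. \<bar>T f x\<bar> powr p) \<le> C * (LBINT x. \<bar>f x\<bar> powr p))"
    for k and T :: "(real ^ 'd \<Rightarrow> real) \<Rightarrow> real ^ 'd \<Rightarrow> real"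
  have "\<exists>T. P k T" for k
  proof (rule lattice_multiplier[where \<rho> = "\<rho> k" and N = "(Suc k)\<^sup>2" and e = "e k", OF d(1,2) assms(3) cR \<rho>])
    fix T :: "(real ^ 'd \<Rightarrow> real) \<Rightarrow> real ^ 'd \<Rightarrow> real"
    assume "\<And>f. tame f \<Longrightarrow> tame (T f)"
      "\<And>f. tame f \<Longrightarrow> continuous_on UNIV f \<Longrightarrow> continuous_on UNIV (T f)"
      "\<And>f \<xi>. tame f \<Longrightarrow> ft (\<lambda>x. of_real (T f x)) \<xi> = of_real (\<Sum>n\<le>(Suc k)\<^sup>2.
          \<rho> k n * ((1 - down_symbol d (e k) \<xi>)\<^sup>2 * down_symbol d (e k) \<xi> ^ (2 * n))) * ft (\<lambda>x. of_real (f x)) \<xi>"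
      "\<And>f. tame f \<Longrightarrow> (LBINT x. \<bar>T f x\<bar> powr p) \<le>
          (2 * (c * R * (bellman_const (min p (p / (p - 1))) / 2))) powr p * (LBINT x. \<bar>f x\<bar> powr p)"
    then show "\<exists>T. P k T" unfolding P_def mk_def C_def by (intro exI[of _ T] conjI allI impI)
  qed
  then obtain T where T: "\<And>k. P k (T k)" by metis
  have s01: "0 \<le> down_symbol d (e k) \<xi>" "down_symbol d (e k) \<xi> \<le> 1" for k and \<xi> :: "real ^ 'd"
    using down_symbol_01[of d "e k" \<xi>] d by auto
  show ?thesis
  proof (rule Lp_multiplier_limit[where T = T and mk = mk and C = C and B = "c * R"])
    show "mk k \<in> borel_measurable borel" for k unfolding mk_def[abs_def] by measurable
    show "\<bar>mk k \<xi>\<bar> \<le> c * R" for k \<xi>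
    proof -
      let ?s = "down_symbol d (e k) \<xi>"
      have "\<bar>mk k \<xi>\<bar> \<le> (\<Sum>n\<le>(Suc k)\<^sup>2. \<bar>\<rho> k n * ((1 - ?s)\<^sup>2 * ?s ^ (2 * n))\<bar>)"
        unfolding mk_def by (rule sum_abs)
      also have "\<dots> \<le> (\<Sum>n\<le>(Suc k)\<^sup>2. c * R * (real n * ((1 - ?s)\<^sup>2 * ?s ^ (2 * n))))"
      proof (rule sum_mono)
        fix n
        have "\<bar>\<rho> k n\<bar> * ((1 - ?s)\<^sup>2 * ?s ^ (2 * n)) \<le> (c * R * real n) * ((1 - ?s)\<^sup>2 * ?s ^ (2 * n))"
          using s01 by (intro mult_right_mono \<rho>) auto
        then show "\<bar>\<rho> k n * ((1 - ?s)\<^sup>2 * ?s ^ (2 * n))\<bar> \<le> c * R * (real n * ((1 - ?s)\<^sup>2 * ?s ^ (2 * n)))"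
          using s01[of k \<xi>] by (simp add: abs_mult mult.assoc)
      qed
      also have "\<dots> \<le> c * R * 1"
        unfolding sum_distrib_left[symmetric] using cR
        by (intro mult_left_mono weighted_geometric_bound s01) auto
      finally show ?thesis by simp
    qed
    show "(\<lambda>k. mk k \<xi>) \<longlonglongrightarrow> m \<xi>" if \<xi>: "\<xi> \<noteq> 0" for \<xi>
    proof -
      define s where "s = norm \<xi> powr (\<alpha> / 2)"
      have s: "0 < s" using \<xi> by (simp add: s_def)
      have s2: "s\<^sup>2 = norm \<xi> powr \<alpha>" unfolding s_def power2_eq_square powr_add[symmetric] by simp
      have "(\<lambda>k. (1 - down_symbol d (e k) \<xi>) / mesh k) \<longlonglongrightarrow> s"
        using down_symbol_limit[OF d(1) \<xi>] unfolding e_def s_def d(3) .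
      from riemann_sum_limit[OF r0m r0b s s01(1) this]
      have "(\<lambda>k. c * (\<Sum>n\<le>(Suc k)\<^sup>2. (real n * local_average r0 k n) * ((1 - down_symbol d (e k) \<xi>)\<^sup>2 * down_symbol d (e k) \<xi> ^ (2 * n))))
        \<longlonglongrightarrow> c * (s\<^sup>2 * (LBINT t. indicator {0<..} t * (t * r0 t * exp (- 2 * t * s))))"
        by (intro tendsto_intros)
      also have "(\<lambda>t. indicator {0<..} t * (t * r0 t * exp (- 2 * t * s))) = (\<lambda>t. indicator {0<..} t *\<^sub>R (t * r t * exp (- 2 * t * s)))"
        by (auto simp: r0_def indicator_def)
      also have "c * (s\<^sup>2 * (LBINT t. indicator {0<..} t *\<^sub>R (t * r t * exp (- 2 * t * s)))) = m \<xi>"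
        unfolding assms(7)[OF \<xi>] set_lebesgue_integral_def s2 s_def[symmetric] by simp
      finally show ?thesis unfolding mk_def \<rho>_def by (simp add: sum_distrib_left mult.assoc)
    qed
  qed (use T assms(3) in \<open>auto simp: P_def C_def\<close>)
qed

end
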